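(* Let $\nu>0$, and for each choice of sign let $\mathcal{T}^\nu_{1,\mp}:=\mathcal{G}^\nu\circ\widetilde{\mathcal{F}}^\nu_{\mp}\circ(\mathcal{B}^{1,\nu})^{-1}$ on $\mathcal{F}^{2,\nu}(\mathbb{C})$ and $\mathcal{T}^\nu_{2,\mp}:=\mathcal{B}^{1,\nu}\circ\widetilde{\mathcal{F}}^\nu_{\mp}\circ\mathcal{R}^\nu$ on $\mathcal{F}^{2,\nu}(\mathbb{C}^2)$. Then $$\mathcal{T}^\nu_{1,\mp}=\mathcal{B}^{2,\nu}|_{\mathcal{F}^{2,\nu}(\mathbb{C})}\circ\Gamma_{\mp i}=\left(\frac{\nu}{\pi}\right)^{\frac12}\mathcal{C}_{\mp i\psi_1}\quad\text{on }\mathcal{F}^{2,\nu}(\mathbb{C}),$$ and $$\mathcal{T}^\nu_{2,\mp}=\Gamma_{\mp i}\circ Proj\circ(\mathcal{B}^{2,\nu})^{-1}=\left(\frac{\pi}{\nu}\right)^{\frac12}\mathcal{C}_{\mp i\psi_2}\quad\text{on }\mathcal{F}^{2,\nu}(\mathbb{C}^2).$$ Moreover, $\mathcal{T}^\nu_{2,\mp}\circ\mathcal{T}^\nu_{1,\pm}=\mathrm{Id}_{\mathcal{F}^{2,\nu}(\mathbb{C})}$ and $\mathcal{T}^\nu_{2,\mp}\circ\mathcal{T}^\nu_{1,\mp}=\Gamma_{-1}\,\mathrm{Id}_{\mathcal{F}^{2,\nu}(\mathbb{C})}$. In each formula the upper signs, respectively the lower signs, are taken simultaneously.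
   Context: Let $\nu>0$. $L^{2,\nu}(\mathbb{R}^d,\mathbb{C})$ is the Hilbert space of $\mathbb{C}$-valued functions on $\mathbb{R}^d$ that are square integrable with respect to $e^{-\nu|x|^2}dx$. $L^{2,\nu}(\mathbb{C},\mathbb{C})$ is the analogous space on $\mathbb{C}$ for $e^{-\nu|z|^2}d\lambda$ ($d\lambda$ the Lebesgue measure), identified with $L^{2,\nu}(\mathbb{R}^2,\mathbb{C})$ through $x+iy\leftrightarrow(x,y)$. The Bargmann-Fock space $\mathcal{F}^{2,\nu}(\mathbb{C}^d)$ consists of the holomorphic functions on $\mathbb{C}^d$ that are square integrable with respect to $e^{-\nu|z|^2}d\lambda$. The Segal-Bargmann transform, unitary from $L^{2,\nu}(\mathbb{R}^d,\mathbb{C})$ onto $\mathcal{F}^{2,\nu}(\mathbb{C}^d)$, is $$\mathcal{B}^{d,\nu}f(z)=\left(\frac{\nu}{\pi}\right)^{\frac{3d}{4}}\int_{\mathbb{R}^d}f(x)e^{-\nu\left(x-\frac{z}{\sqrt2}\right)^2}dx,\qquad u^2:=u_1^2+\cdots+u_d^2.$$ The map $Proj$ is the orthogonal projection of $L^{2,\nu}(\mathbb{C},\mathbb{C})$ onto $\mathcal{F}^{2,\nu}(\mathbb{C})$. The transform $\mathcal{G}^\nu:L^{2,\nu}(\mathbb{R},\mathbb{C})\to\mathcal{F}^{2,\nu}(\mathbb{C}^2)$ is $\mathcal{G}^\nu f(z,w)=\left(\frac{\nu}{\pi}\right)^{\frac12}(\mathcal{B}^{1,\nu}f)\left(\frac{z+iw}{\sqrt2}\right)$.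 The transform $\mathcal{R}^\nu:\mathcal{F}^{2,\nu}(\mathbb{C}^2)\to L^{2,\nu}(\mathbb{R},\mathbb{C})$ is $\mathcal{R}^\nu=(\mathcal{B}^{1,\nu})^{-1}\circ Proj\circ(\mathcal{B}^{2,\nu})^{-1}$. The rescaled Fourier transform $\widetilde{\mathcal{F}}^\nu_{\mp}$, a unitary operator of $L^{2,\nu}(\mathbb{R},\mathbb{C})$ onto itself, is $$\widetilde{\mathcal{F}}^\nu_{\mp}(\varphi)(x)=\left(\frac{\nu}{2\pi}\right)^{\frac12}\int_{\mathbb{R}}\varphi(u)\,e^{\frac{\nu}{2}(x\mp iu)^2}\,du,$$ the integral being understood in the usual $L^2$ (Plancherel) sense. That is, $\widetilde{\mathcal{F}}^\nu_{\mp}\varphi(x)=e^{\frac{\nu}{2}x^2}\mathcal{F}^\nu_{\mp}\big(e^{-\frac{\nu}{2}(\cdot)^2}\varphi\big)(x)$, where $\mathcal{F}^\nu_{\mp}(g)(x)=\left(\frac{\nu}{2\pi}\right)^{1/2}\int_{\mathbb{R}}g(u)e^{\mp i\nu xu}du$ on $L^2(\mathbb{R},dx)$. Notation: $\mathcal{C}_\psi f=f\circ\psi$ is the composition operator with symbol $\psi$; $\psi_1(z,w)=\frac{z+iw}{\sqrt2}$ and $\psi_2(\xi)=\frac{1}{\sqrt2}(\xi,-i\xi)$; $\Gamma_\theta\varphi(\xi)=\varphi(\theta\xi)$ for $\theta\in\mathbb{C}$, $|\theta|=1$. *)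

theory Defs
  imports "HOL-Complex_Analysis.Complex_Analysis"
begin

text \<open>
  Elements of the weighted spaces are represented by Borel functions. Two functions that agree
  almost everywhere represent the same element. The operators below that take values in such a
  space return an arbitrary representative of their value; elements of the Bargmann-Fock spaces
  are genuine functions. The parameter 0 gives the unweighted space.
\<close>

definition L2w :: "real \<Rightarrow> ('a::euclidean_space \<Rightarrow> complex) set" where
  "L2w \<nu> = {f \<in> borel_measurable borel.
              integrable lborel (\<lambda>x. (cmod (f x))\<^sup>2 * exp (- \<nu> * (norm x)\<^sup>2))}"

definition inner_w ::
    "real \<Rightarrow> ('a::euclidean_space \<Rightarrow> complex) \<Rightarrow> ('a \<Rightarrow> complex) \<Rightarrow> complex" where
  "inner_w \<nu> f g = (LINT x|lborel. f x * cnj (g x) * of_real (exp (- \<nu> * (norm x)\<^sup>2)))"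

definition cscale2 :: "complex \<Rightarrow> complex \<times> complex \<Rightarrow> complex \<times> complex" where
  "cscale2 c p = (c * fst p, c * snd p)"

text \<open>Holomorphy on \<open>\<complex>\<^sup>2\<close>: the real Frechet derivative exists everywhere and is complex linear.\<close>

definition entire2 :: "(complex \<times> complex \<Rightarrow> complex) \<Rightarrow> bool" where
  "entire2 F \<longleftrightarrow>
     (\<forall>p. \<exists>D. (F has_derivative D) (at p) \<and> (\<forall>c v. D (cscale2 c v) = c * D v))"

definition fock1 :: "real \<Rightarrow> (complex \<Rightarrow> complex) set" where
  "fock1 \<nu> = {F \<in> L2w \<nu>. F holomorphic_on UNIV}"

definition fock2 :: "real \<Rightarrow> (complex \<times> complex \<Rightarrow> complex) set" where
  "fock2 \<nu> = {F \<in> L2w \<nu>. entire2 F}"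

definition segal_bargmann1 :: "real \<Rightarrow> (real \<Rightarrow> complex) \<Rightarrow> complex \<Rightarrow> complex" where
  "segal_bargmann1 \<nu> f z =
     of_real ((\<nu> / pi) powr (3 / 4)) *
     (LINT x|lborel. f x * exp (- of_real \<nu> * (of_real x - z / of_real (sqrt 2))\<^sup>2))"

definition segal_bargmann2 ::
    "real \<Rightarrow> (real \<times> real \<Rightarrow> complex) \<Rightarrow> complex \<times> complex \<Rightarrow> complex" where
  "segal_bargmann2 \<nu> f p =
     of_real ((\<nu> / pi) powr (3 * 2 / 4)) *
     (LINT x|lborel. f x * exp (- of_real \<nu> *
        ((of_real (fst x) - fst p / of_real (sqrt 2))\<^sup>2 +
         (of_real (snd x) - snd p / of_real (sqrt 2))\<^sup>2)))"

text \<open>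
  The transforms are injective only up to equality almost everywhere, so the inverses pick a
  representative.
\<close>

definition segal_bargmann1_inv :: "real \<Rightarrow> (complex \<Rightarrow> complex) \<Rightarrow> real \<Rightarrow> complex" where
  "segal_bargmann1_inv \<nu> = inv_into (L2w \<nu>) (segal_bargmann1 \<nu>)"

definition segal_bargmann2_inv ::
    "real \<Rightarrow> (complex \<times> complex \<Rightarrow> complex) \<Rightarrow> real \<times> real \<Rightarrow> complex" where
  "segal_bargmann2_inv \<nu> = inv_into (L2w \<nu>) (segal_bargmann2 \<nu>)"

text \<open>The identification of functions on \<open>\<complex>\<close> with functions on \<open>\<real>\<^sup>2\<close>.\<close>

definition to_R2 :: "(complex \<Rightarrow> complex) \<Rightarrow> real \<times> real \<Rightarrow> complex" where
  "to_R2 F = (\<lambda>(x, y). F (Complex x y))"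

definition of_R2 :: "(real \<times> real \<Rightarrow> complex) \<Rightarrow> complex \<Rightarrow> complex" where
  "of_R2 f = (\<lambda>z. f (Re z, Im z))"

definition fock_proj :: "real \<Rightarrow> (complex \<Rightarrow> complex) \<Rightarrow> complex \<Rightarrow> complex" where
  "fock_proj \<nu> f =
     (THE P. P \<in> fock1 \<nu> \<and> (\<forall>H\<in>fock1 \<nu>. inner_w \<nu> (\<lambda>z. f z - P z) H = 0))"

definition psi1 :: "complex \<times> complex \<Rightarrow> complex" where
  "psi1 = (\<lambda>(z, w). (z + \<i> * w) / of_real (sqrt 2))"

definition psi2 :: "complex \<Rightarrow> complex \<times> complex" where
  "psi2 \<xi> = cscale2 (1 / of_real (sqrt 2)) (\<xi>, - \<i> * \<xi>)"

definition rot :: "complex \<Rightarrow> (complex \<Rightarrow> complex) \<Rightarrow> complex \<Rightarrow> complex" where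
  "rot \<theta> \<phi> = (\<lambda>\<xi>. \<phi> (\<theta> * \<xi>))"

definition G_transform :: "real \<Rightarrow> (real \<Rightarrow> complex) \<Rightarrow> complex \<times> complex \<Rightarrow> complex" where
  "G_transform \<nu> f =
     (\<lambda>(z, w). of_real (sqrt (\<nu> / pi)) *
                segal_bargmann1 \<nu> f ((z + \<i> * w) / of_real (sqrt 2)))"

definition R_transform :: "real \<Rightarrow> (complex \<times> complex \<Rightarrow> complex) \<Rightarrow> real \<Rightarrow> complex" where
  "R_transform \<nu> G = segal_bargmann1_inv \<nu> (fock_proj \<nu> (of_R2 (segal_bargmann2_inv \<nu> G)))"

text \<open>
  The sign \<open>\<sigma>\<close> is that of the exponent in the Fourier kernel: \<open>\<sigma> = -1\<close> is the upper and
  \<open>\<sigma> = 1\<close> the lower choice in \<open>\<mp>\<close>.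
\<close>

definition fourier_integral :: "real \<Rightarrow> real \<Rightarrow> (real \<Rightarrow> complex) \<Rightarrow> real \<Rightarrow> complex" where
  "fourier_integral \<nu> \<sigma> g x =
     of_real (sqrt (\<nu> / (2 * pi))) *
     (LINT u|lborel. g u * exp (of_real \<sigma> * \<i> * of_real (\<nu> * x * u)))"

text \<open>The Plancherel transform: the limit in the mean of the integrals over \<open>[-n, n]\<close>.\<close>

definition fourier_L2 :: "real \<Rightarrow> real \<Rightarrow> (real \<Rightarrow> complex) \<Rightarrow> real \<Rightarrow> complex" where
  "fourier_L2 \<nu> \<sigma> g =
     (SOME h. h \<in> L2w 0 \<and>
        (\<lambda>n. \<integral>\<^sup>+x. ennreal ((cmod (h x -
               fourier_integral \<nu> \<sigma> (\<lambda>u. indicator {- real n..real n} u * g u) x))\<^sup>2) \<partial>lborel)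
        \<longlonglongrightarrow> 0)"

definition rescaled_fourier :: "real \<Rightarrow> real \<Rightarrow> (real \<Rightarrow> complex) \<Rightarrow> real \<Rightarrow> complex" where
  "rescaled_fourier \<nu> \<sigma> \<phi> =
     (\<lambda>x. of_real (exp (\<nu> / 2 * x\<^sup>2)) *
           fourier_L2 \<nu> \<sigma> (\<lambda>u. of_real (exp (- \<nu> / 2 * u\<^sup>2)) * \<phi> u) x)"

definition T1 :: "real \<Rightarrow> real \<Rightarrow> (complex \<Rightarrow> complex) \<Rightarrow> complex \<times> complex \<Rightarrow> complex" where
  "T1 \<nu> \<sigma> = G_transform \<nu> \<circ> rescaled_fourier \<nu> \<sigma> \<circ> segal_bargmann1_inv \<nu>"

definition T2 :: "real \<Rightarrow> real \<Rightarrow> (complex \<times> complex \<Rightarrow> complex) \<Rightarrow> complex \<Rightarrow> complex" where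
  "T2 \<nu> \<sigma> = segal_bargmann1 \<nu> \<circ> rescaled_fourier \<nu> \<sigma> \<circ> R_transform \<nu>"

end

theory Submission
  imports Defs "HOL-Probability.Probability"
begin

text \<open>
  After multiplication by the square root of the Gaussian weight, the Segal-Bargmann transforms
  become integral operators on unweighted \<open>L\<^sup>2\<close> whose Gram kernel is the reproducing kernel of the
  Fock space. Schur's test for that kernel makes the adjoint bounded, so a Fock function \<open>F\<close> is
  hit by the limit of the adjoint applied to truncations of \<open>F\<close>; this gives surjectivity without
  any orthonormal basis. The reproducing property itself is the mean value property, since
  Lebesgue measure on \<open>\<complex>\<close> is invariant under translations and rotations. The Plancherel transform
  is treated by the same test after Gaussian damping of its kernel, and a Gaussian integral shows
  that \<open>\<B>\<close> turns the rescaled Fourier transform into the rotation by \<open>\<sigma>\<i>\<close>. Everything else is a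
  computation with kernels: the kernel of \<open>\<B>\<^sup>2\<close> at \<open>\<psi>\<^sub>2(a)\<close> is the Bergman kernel at \<open>a\<close>, and the
  integral of a Fock function against the kernel of \<open>\<B>\<^sup>2\<close> is evaluated by the reproducing
  property.
\<close>

subsection \<open>Gaussian integrals and the mean value property\<close>

text \<open>The operators of the statement return representatives picked by \<open>inv_into\<close>
  and \<open>SOME\<close>, so no result may depend on the choice. Two facts ensure this:
  surjectivity makes \<open>inv_into\<close> a right inverse, and a picked function, once weighted,
  is only ever integrated against square integrable functions. The half weights are what makes
  Schur's test applicable: the kernel \<open>exp (\<nu> * z * cnj z')\<close> grows, but with
  \<open>exp (- \<nu> / 2 * |z|^2)\<close> attached for either variable its modulus is a Gaussian in
  \<open>z - z'\<close>, and its integral over a row is the same number for every row. Constants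
  such as 2, where an isometry would have 1, do no harm: the bounds serve only to carry Cauchy
  sequences along and to ensure finiteness. The adjoint integral is guaranteed to converge only on
  integrable functions; hence the truncations to balls and intervals, with limits taken afterwards.
  Pointwise identities survive these limits because the rows of the kernels are square
  integrable.\<close>

lemma std_gaussian_fourier:
  "has_bochner_integral lborel (\<lambda>x. exp (\<i> * of_real (t * x)) * of_real (exp (- x\<^sup>2 / 2)))
     (of_real (sqrt (2 * pi) * exp (- t\<^sup>2 / 2)) :: complex)"
proof -
  have e: "exp (\<i> * of_real (t * x)) * of_real (exp (- x\<^sup>2 / 2)) =
      complex_of_real (sqrt (2 * pi)) * (std_normal_density x *\<^sub>R iexp (t * x))" for x
    by (simp add: std_normal_density_def scaleR_conv_of_real)
  have "integrable std_normal_distribution (\<lambda>x. iexp (t * x))"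
    by (rule finite_measure.integrable_const_bound[where B = 1]) (auto intro!: prob_space.finite_measure prob_space_normal_density)
  then have i: "integrable lborel (\<lambda>x. std_normal_density x *\<^sub>R iexp (t * x))"
    by (subst (asm) integrable_density) (auto simp: normal_density_nonneg)
  have "(LINT x|lborel. std_normal_density x *\<^sub>R iexp (t * x)) = of_real (exp (- t\<^sup>2 / 2))"
    using fun_cong[OF char_std_normal_distribution, of t] unfolding char_def
    by (subst (asm) integral_density) (auto simp: normal_density_nonneg)
  with i have "has_bochner_integral lborel (\<lambda>x. std_normal_density x *\<^sub>R iexp (t * x)) (of_real (exp (- t\<^sup>2 / 2)))"
    by (simp add: has_bochner_integral_iff)
  from has_bochner_integral_mult_right[OF this, of "complex_of_real (sqrt (2 * pi))"] show ?thesis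
    unfolding e unfolding of_real_mult .
qed

text \<open>With \<open>c = sqrt (2 * a)\<close>, substituting \<open>- p / c + c * x\<close>
  completes the square for the real part \<open>p\<close> of \<open>b\<close> and produces the
  integrand of \<open>std_gaussian_fourier\<close>; the imaginary part \<open>q\<close> becomes the
  frequency \<open>q / c\<close>.\<close>

lemma gaussian_integral:
  fixes a :: real and b :: complex
  assumes a: "a > 0"
  shows "has_bochner_integral lborel (\<lambda>x. exp (b * of_real x - of_real a * (of_real x)\<^sup>2))
           (of_real (sqrt (pi / a)) * exp (b\<^sup>2 / (4 * of_real a)))"
proof -
  define p q where "p = Re b" and "q = Im b"
  have b: "b = of_real p + \<i> * of_real q" by (simp add: p_def q_def complex_eq_iff)
  define c where "c = sqrt (2 * a)"
  have c: "c > 0" "c\<^sup>2 = 2 * a" using a by (auto simp: c_def)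
  have h: "has_bochner_integral lborel
     (\<lambda>x. exp (\<i> * of_real ((q / c) * (- p / c + c * x))) * complex_of_real (exp (- (- p / c + c * x)\<^sup>2 / 2)))
     (of_real (sqrt (2 * pi) * exp (- (q / c)\<^sup>2 / 2)) /\<^sub>R \<bar>c\<bar>)"
    using std_gaussian_fourier[of "q / c"] c
    by (subst (asm) lborel_has_bochner_integral_real_affine_iff[of c _ _ "- p / c"]) auto
  \<comment> \<open>The factor split off when the square is completed: a size coming from
    \<open>p\<close> and a phase caused by the translation.\<close>
  define K where "K = exp (\<i> * of_real (q * p / c\<^sup>2) + of_real (p\<^sup>2 / (2 * c\<^sup>2)))"
  have "has_bochner_integral lborel (\<lambda>x. K *
     (exp (\<i> * of_real ((q / c) * (- p / c + c * x))) * complex_of_real (exp (- (- p / c + c * x)\<^sup>2 / 2))))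
     (K * (of_real (sqrt (2 * pi) * exp (- (q / c)\<^sup>2 / 2)) /\<^sub>R \<bar>c\<bar>))"
    by (intro has_bochner_integral_mult_right h)
  also have "(\<lambda>x. K *
     (exp (\<i> * of_real ((q / c) * (- p / c + c * x))) * complex_of_real (exp (- (- p / c + c * x)\<^sup>2 / 2))))
     = (\<lambda>x. exp (b * of_real x - of_real a * (of_real x)\<^sup>2))"
  proof
    fix x :: real
    have 1: "q * p / c\<^sup>2 + (q / c) * (- p / c + c * x) = q * x"
      using c(1) by (simp add: field_simps power2_eq_square)
    have 2: "p\<^sup>2 / (2 * c\<^sup>2) - (- p / c + c * x)\<^sup>2 / 2 = p * x - a * x\<^sup>2"
    proof -
      have "(- p / c + c * x)\<^sup>2 = p\<^sup>2 / c\<^sup>2 - 2 * p * x + c\<^sup>2 * x\<^sup>2"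
        using c(1) by (simp add: power2_eq_square field_simps)
      then show ?thesis using c by (simp add: field_simps)
    qed
    have "K * (exp (\<i> * of_real ((q / c) * (- p / c + c * x))) * complex_of_real (exp (- (- p / c + c * x)\<^sup>2 / 2)))
      = exp (\<i> * of_real (q * p / c\<^sup>2 + (q / c) * (- p / c + c * x))
          + of_real (p\<^sup>2 / (2 * c\<^sup>2) - (- p / c + c * x)\<^sup>2 / 2))"
      unfolding K_def exp_of_real[symmetric] mult_exp_exp
      by (rule arg_cong[where f = exp]) (simp add: algebra_simps)
    also have "\<dots> = exp (b * of_real x - of_real a * (of_real x)\<^sup>2)"
      unfolding 1 2 b by (rule arg_cong[where f = exp]) (simp add: algebra_simps)
    finally show "K * (exp (\<i> * of_real ((q / c) * (- p / c + c * x))) * complex_of_real (exp (- (- p / c + c * x)\<^sup>2 / 2)))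
      = exp (b * of_real x - of_real a * (of_real x)\<^sup>2)" .
  qed
  also have "K * (of_real (sqrt (2 * pi) * exp (- (q / c)\<^sup>2 / 2)) /\<^sub>R \<bar>c\<bar>)
      = of_real (sqrt (2 * pi) / c) * (K * exp (of_real (- (q / c)\<^sup>2 / 2)))"
    using c by (simp add: scaleR_conv_of_real field_simps flip: exp_of_real)
  also have "sqrt (2 * pi) / c = sqrt (pi / a)"
    using a by (simp add: c_def real_sqrt_divide real_sqrt_mult)
  also have "K * exp (of_real (- (q / c)\<^sup>2 / 2)) = exp (b\<^sup>2 / (4 * of_real a))"
    unfolding K_def mult_exp_exp b power_divide c(2)
    by (rule arg_cong[where f = exp]) (use a in \<open>simp add: field_simps power2_eq_square\<close>)
  finally show ?thesis .
qed

section \<open>Lebesgue measure on the complex plane and its rotation invariance\<close>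

lemma measurable_Complex [measurable]:
  "(\<lambda>p. Complex (fst p) (snd p)) \<in> borel \<rightarrow>\<^sub>M borel"
  by (intro borel_measurable_continuous_onI continuous_intros)

lemma borel_measurable_Complex [measurable (raw)]:
  assumes [measurable]: "f \<in> borel_measurable M" "g \<in> borel_measurable M"
  shows "(\<lambda>x. Complex (f x) (g x)) \<in> borel_measurable M"
  by (auto simp: borel_measurable_complex_iff)

text \<open>Both measures give a box the product of its side lengths, and this determines Lebesgue
  measure. Integrals over the plane thereby become iterated real integrals, and the identification
  with the real plane preserves them.\<close>

lemma lborel_complex:
  "lborel = distr (lborel :: (real \<times> real) measure) borel (\<lambda>p. Complex (fst p) (snd p))"
proof (rule lborel_eqI)
  fix l u :: complex
  assume lu: "\<And>b. b \<in> Basis \<Longrightarrow> l \<bullet> b \<le> u \<bullet> b"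
  then have "Re l \<le> Re u" "Im l \<le> Im u"
    using lu[of 1] lu[of \<i>] by (auto simp: Basis_complex_def)
  moreover have "(\<lambda>p. Complex (fst p) (snd p)) -` box l u = box (Re l) (Re u) \<times> box (Im l) (Im u)"
    by (auto simp: in_box_complex_iff)
  moreover have "emeasure lborel (box (Re l) (Re u) \<times> box (Im l) (Im u)) =
      emeasure lborel (box (Re l) (Re u)) * emeasure lborel (box (Im l) (Im u))"
    by (subst lborel_prod[symmetric], rule lborel.emeasure_pair_measure_Times) auto
  ultimately show "emeasure (distr (lborel :: (real \<times> real) measure) borel (\<lambda>p. Complex (fst p) (snd p))) (box l u)
      = ennreal (\<Prod>b\<in>Basis. (u - l) \<bullet> b)"
    by (simp add: emeasure_distr ennreal_mult Basis_complex_def inner_complex_def complex_eq_iff)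
qed simp

lemma nn_integral_complex:
  assumes [measurable]: "f \<in> borel_measurable borel"
  shows "(\<integral>\<^sup>+z. f z \<partial>lborel) = (\<integral>\<^sup>+x. \<integral>\<^sup>+y. f (Complex x y) \<partial>lborel \<partial>lborel)"
proof -
  have "(\<integral>\<^sup>+z. f z \<partial>lborel) = (\<integral>\<^sup>+p. f (Complex (fst p) (snd p)) \<partial>(lborel \<Otimes>\<^sub>M lborel))"
    by (subst lborel_complex, subst nn_integral_distr) (auto simp: lborel_prod)
  also have "\<dots> = (\<integral>\<^sup>+x. \<integral>\<^sup>+y. f (Complex x y) \<partial>lborel \<partial>lborel)"
    by (subst lborel.nn_integral_fst[symmetric]) auto
  finally show ?thesis .
qed

lemma nn_integral_complex_swap:
  assumes [measurable]: "f \<in> borel_measurable borel"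
  shows "(\<integral>\<^sup>+z. f z \<partial>lborel) = (\<integral>\<^sup>+y. \<integral>\<^sup>+x. f (Complex x y) \<partial>lborel \<partial>lborel)"
  by (subst nn_integral_complex) (auto intro!: lborel_pair.Fubini')

text \<open>On each horizontal line a shear is a translation, so Tonelli reduces the claim to
  translation invariance on the real line.\<close>

lemma nn_integral_shear_Re:
  assumes [measurable]: "f \<in> borel_measurable borel"
  shows "(\<integral>\<^sup>+z. f (Complex (Re z + t * Im z) (Im z)) \<partial>lborel) = (\<integral>\<^sup>+z. f z \<partial>lborel)"
proof -
  have "(\<integral>\<^sup>+x. f (Complex (x + t * y) y) \<partial>lborel) = (\<integral>\<^sup>+x. f (Complex x y) \<partial>lborel)" for y
    by (subst (2) nn_integral_real_affine[where c = 1 and t = "t * y"]) (auto simp: add.commute)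
  then show ?thesis by (subst (1 2) nn_integral_complex_swap) auto
qed

lemma nn_integral_shear_Im:
  assumes [measurable]: "f \<in> borel_measurable borel"
  shows "(\<integral>\<^sup>+z. f (Complex (Re z) (Im z + t * Re z)) \<partial>lborel) = (\<integral>\<^sup>+z. f z \<partial>lborel)"
proof -
  have "(\<integral>\<^sup>+y. f (Complex x (y + t * x)) \<partial>lborel) = (\<integral>\<^sup>+y. f (Complex x y) \<partial>lborel)" for x
    by (subst (2) nn_integral_real_affine[where c = 1 and t = "t * x"]) (auto simp: add.commute)
  then show ?thesis by (subst (1 2) nn_integral_complex) auto
qed

text \<open>A rotation by \<theta> is a product of a horizontal, a vertical and again a horizontal
  shear, with parameters \<open>- tan (\<theta> / 2)\<close>, \<open>sin \<theta>\<close> and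
  \<open>- tan (\<theta> / 2)\<close>. The half turn, where the tangent is infinite, is the square
  of the rotation by \<open>\<i>\<close>.\<close>

lemma nn_integral_rotate:
  fixes c :: complex
  assumes [measurable]: "f \<in> borel_measurable borel" and c: "cmod c = 1"
  shows "(\<integral>\<^sup>+z. f (c * z) \<partial>lborel) = (\<integral>\<^sup>+z. f z \<partial>lborel)"
proof -
  have rot: "(\<integral>\<^sup>+z. f (c * z) \<partial>lborel) = (\<integral>\<^sup>+z. f z \<partial>lborel)"
    if [measurable]: "f \<in> borel_measurable borel" and c: "cmod c = 1" "Re c \<noteq> -1"
    for c :: complex and f :: "complex \<Rightarrow> ennreal"
  proof -
    define s t where "s = Im c" and "t = - Im c / (1 + Re c)"
    have sq: "s\<^sup>2 = 1 - (Re c)\<^sup>2"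
      using c(1) by (simp add: s_def cmod_def)
    have 1: "t * (1 + Re c) = - s" using c(2) by (simp add: s_def t_def)
    have "t * s * (1 + Re c) = (Re c - 1) * (1 + Re c)"
      using sq unfolding mult.commute[of t s] mult.assoc 1 by (simp add: algebra_simps power2_eq_square)
    then have 2: "t * s = Re c - 1" using c(2) by simp
    have e: "c * z = Complex ((Re z + t * Im z) + t * (Im z + s * (Re z + t * Im z)))
                 (Im z + s * (Re z + t * Im z))" for z
    proof -
      have "(Re z + t * Im z) + t * (Im z + s * (Re z + t * Im z)) =
        Re z * (1 + t * s) + Im z * (t * (1 + (1 + t * s)))" by (simp add: algebra_simps)
      also have "\<dots> = Re (c * z)" unfolding 2 using 1 by (simp add: s_def)
      finally have A: "(Re z + t * Im z) + t * (Im z + s * (Re z + t * Im z)) = Re (c * z)" .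
      have "Im z + s * (Re z + t * Im z) = s * Re z + (1 + t * s) * Im z" by (simp add: algebra_simps)
      also have "\<dots> = Im (c * z)" unfolding 2 by (simp add: s_def)
      finally show ?thesis using A by (simp add: complex_eq_iff)
    qed
    have "(\<integral>\<^sup>+z. f (c * z) \<partial>lborel) = (\<integral>\<^sup>+z. f (Complex (Re z + t * (Im z + s * Re z)) (Im z + s * Re z)) \<partial>lborel)"
      unfolding e by (subst (2) nn_integral_shear_Re[of _ t, symmetric]) auto
    also have "\<dots> = (\<integral>\<^sup>+z. f (Complex (Re z + t * Im z) (Im z)) \<partial>lborel)"
      by (subst (2) nn_integral_shear_Im[of _ s, symmetric]) auto
    finally show ?thesis by (simp add: nn_integral_shear_Re)
  qed
  show ?thesis
  proof (cases "Re c = -1")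
    case True
    with c have "c = -1" by (auto simp: complex_eq_iff cmod_def power2_eq_square)
    then have "(\<lambda>z. f (c * z)) = (\<lambda>z. f (\<i> * (\<i> * z)))" by (simp flip: mult.assoc)
    then show ?thesis using rot[of "\<lambda>z. f (\<i> * z)" \<i>] rot[of f \<i>] by simp
  qed (use rot c assms in auto)
qed

lemma lborel_distr_rotate:
  fixes c :: complex
  assumes "cmod c = 1"
  shows "distr lborel borel (\<lambda>z. c * z) = lborel"
proof (rule measure_eqI)
  fix A assume "A \<in> sets (distr lborel borel (\<lambda>z. c * z))"
  then have [measurable]: "A \<in> sets borel" by simp
  have "emeasure (distr lborel borel (\<lambda>z. c * z)) A = (\<integral>\<^sup>+z. indicator A z \<partial>distr lborel borel (\<lambda>z. c * z))"
    by simp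
  also have "\<dots> = (\<integral>\<^sup>+z. indicator A (c * z) \<partial>lborel)"
    by (subst nn_integral_distr) auto
  also have "\<dots> = emeasure lborel A"
    by (subst nn_integral_rotate) (use assms in auto)
  finally show "emeasure (distr lborel borel (\<lambda>z. c * z)) A = emeasure lborel A" .
qed simp

text \<open>Cauchy's formula at 0 for \<open>K (w * z)\<close> as a function of \<open>w\<close> on
  the unit circle, rather than for \<open>K\<close> on the circle of radius \<open>cmod z\<close>;
  in this form \<open>z = 0\<close> is not a special case.\<close>

lemma circle_mean_value:
  fixes K :: "complex \<Rightarrow> complex"
  assumes K: "K holomorphic_on UNIV"
  shows "(LINT t:{0..1}|lborel. K (exp (2 * of_real pi * \<i> * of_real t) * z)) = K 0"
proof -
  let ?e = "\<lambda>t::real. exp (2 * of_real pi * \<i> * of_real t)"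
  have hol: "(\<lambda>w. K (w * z)) holomorphic_on S" for S
    by (rule holomorphic_on_compose_gen[OF _ K, unfolded o_def]) (auto intro!: holomorphic_intros)
  have "((\<lambda>w. K (w * z) / (w - 0)) has_contour_integral (2 * of_real pi * \<i> * K (0 * z))) (circlepath 0 1)"
    by (rule Cauchy_integral_circlepath_simple[OF hol]) auto
  then have h: "((\<lambda>t. K (circlepath 0 1 t * z) / circlepath 0 1 t *
      vector_derivative (circlepath 0 1) (at t within {0..1})) has_integral (2 * of_real pi * \<i> * K 0)) {0..1}"
    by (simp add: has_contour_integral_def)
  \<comment> \<open>The velocity of \<open>circlepath\<close> is \<open>2 * pi * \<i>\<close> times
    its position, which cancels the denominator in Cauchy's formula.\<close>
  have "((\<lambda>t. 2 * of_real pi * \<i> * K (?e t * z)) has_integral (2 * of_real pi * \<i> * K 0)) {0..1}"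
    by (rule has_integral_eq[OF _ h])
       (simp add: vector_derivative_circlepath01, simp add: circlepath)
  from has_integral_mult_right[OF this, of "inverse (2 * of_real pi * \<i>)"]
  have hi: "((\<lambda>t. K (?e t * z)) has_integral K 0) {0..1}"
    by (simp add: field_simps)
  have "continuous_on {0..1} (\<lambda>t. K (?e t * z))"
    by (rule continuous_on_compose2[OF holomorphic_on_imp_continuous_on[OF K]])
       (auto intro!: continuous_intros)
  then have "set_integrable lborel {0..1} (\<lambda>t. K (?e t * z))"
    by (rule borel_integrable_atLeastAtMost')
  from set_borel_integral_eq_integral(2)[OF this] hi show ?thesis
    by (simp add: integral_unique)
qed

lemma nn_integral_gaussian_real:
  assumes "\<nu> > 0"
  shows "(\<integral>\<^sup>+x. ennreal (exp (- \<nu> * x\<^sup>2)) \<partial>lborel) = ennreal (sqrt (pi / \<nu>))"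
proof -
  have "has_bochner_integral lborel (\<lambda>x. exp (0 * complex_of_real x - of_real \<nu> * (of_real x)\<^sup>2))
           (of_real (sqrt (pi / \<nu>)) * exp (0\<^sup>2 / (4 * of_real \<nu>)))"
    by (rule gaussian_integral[OF assms])
  then have "has_bochner_integral lborel (\<lambda>x. complex_of_real (exp (- \<nu> * x\<^sup>2))) (of_real (sqrt (pi / \<nu>)))"
    by (simp flip: exp_of_real)
  then have "has_bochner_integral lborel (\<lambda>x. exp (- \<nu> * x\<^sup>2)) (sqrt (pi / \<nu>))"
    unfolding has_bochner_integral_iff
    by (simp add: complex_of_real_integrable_eq del: exp_of_real of_real_exp)
  then show ?thesis
    unfolding has_bochner_integral_iff by (subst nn_integral_eq_integral) auto
qed

lemma nn_integral_gaussian_complex: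
  assumes "\<nu> > 0"
  shows "(\<integral>\<^sup>+z. ennreal (exp (- \<nu> * (cmod z)\<^sup>2)) \<partial>lborel) = ennreal (pi / \<nu>)"
proof -
  have "(\<integral>\<^sup>+z. ennreal (exp (- \<nu> * (cmod z)\<^sup>2)) \<partial>lborel) =
     (\<integral>\<^sup>+x. \<integral>\<^sup>+y. ennreal (exp (- \<nu> * x\<^sup>2)) * ennreal (exp (- \<nu> * y\<^sup>2)) \<partial>lborel \<partial>lborel)"
    by (subst nn_integral_complex)
       (auto simp: cmod_power2 distrib_left exp_diff exp_minus field_simps exp_add simp flip: ennreal_mult)
  also have "\<dots> = ennreal (sqrt (pi / \<nu>)) * ennreal (sqrt (pi / \<nu>))"
    using nn_integral_gaussian_real[OF assms] by (simp add: nn_integral_cmult nn_integral_multc)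
  also have "\<dots> = ennreal (pi / \<nu>)"
    using assms by (simp flip: ennreal_mult)
  finally show ?thesis .
qed

subsection \<open>Square integrable functions\<close>

text \<open>Values in \<open>ennreal\<close> allow norms to be compared before finiteness is known.
  As no root is taken, the triangle inequality costs the factor 2 of
  \<open>sqnorm_add_le\<close>.\<close>

definition sqnorm :: "'a measure \<Rightarrow> ('a \<Rightarrow> complex) \<Rightarrow> ennreal" where
  "sqnorm M f = (\<integral>\<^sup>+x. ennreal ((cmod (f x))\<^sup>2) \<partial>M)"

lemma sqnorm_minus_commute: "sqnorm M (\<lambda>x. f x - g x) = sqnorm M (\<lambda>x. g x - f x)"
  by (simp add: sqnorm_def norm_minus_commute)

lemma sqnorm_add_le:
  assumes [measurable]: "f \<in> borel_measurable M" "g \<in> borel_measurable M"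
  shows "sqnorm M (\<lambda>x. f x + g x) \<le> 2 * (sqnorm M f + sqnorm M g)"
proof -
  have "(cmod (f x + g x))\<^sup>2 \<le> 2 * ((cmod (f x))\<^sup>2 + (cmod (g x))\<^sup>2)" for x
  proof -
    have "(cmod (f x + g x))\<^sup>2 \<le> (cmod (f x) + cmod (g x))\<^sup>2"
      by (intro power_mono norm_triangle_ineq) auto
    also have "\<dots> \<le> 2 * ((cmod (f x))\<^sup>2 + (cmod (g x))\<^sup>2)"
      using sum_squares_bound[of "cmod (f x)" "cmod (g x)"] by (simp add: power2_sum)
    finally show ?thesis .
  qed
  then have "sqnorm M (\<lambda>x. f x + g x) \<le> (\<integral>\<^sup>+x. ennreal (2 * ((cmod (f x))\<^sup>2 + (cmod (g x))\<^sup>2)) \<partial>M)"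
    unfolding sqnorm_def by (intro nn_integral_mono ennreal_leI)
  also have "\<dots> = (\<integral>\<^sup>+x. 2 * (ennreal ((cmod (f x))\<^sup>2) + ennreal ((cmod (g x))\<^sup>2)) \<partial>M)"
    by (intro nn_integral_cong) (simp add: ennreal_mult ennreal_plus distrib_left flip: ennreal_numeral)
  also have "\<dots> = 2 * (sqnorm M f + sqnorm M g)"
    unfolding sqnorm_def by (simp add: nn_integral_cmult nn_integral_add)
  finally show ?thesis .
qed

lemma sqnorm_triangle:
  assumes [measurable]: "f \<in> borel_measurable M" "g \<in> borel_measurable M" "h \<in> borel_measurable M"
  shows "sqnorm M (\<lambda>x. f x - h x) \<le> 2 * (sqnorm M (\<lambda>x. f x - g x) + sqnorm M (\<lambda>x. g x - h x))"
  using sqnorm_add_le[of "\<lambda>x. f x - g x" M "\<lambda>x. g x - h x"] by simp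

lemma sqnorm_diff_finite:
  assumes "f \<in> borel_measurable M" "g \<in> borel_measurable M" "sqnorm M f < \<infinity>" "sqnorm M g < \<infinity>"
  shows "sqnorm M (\<lambda>x. f x - g x) < \<infinity>"
proof -
  have "sqnorm M (\<lambda>x. f x + - g x) \<le> 2 * (sqnorm M f + sqnorm M (\<lambda>x. - g x))"
    using assms by (intro sqnorm_add_le) auto
  also have "sqnorm M (\<lambda>x. - g x) = sqnorm M g" by (simp add: sqnorm_def)
  also have "2 * (sqnorm M f + sqnorm M g) < \<infinity>"
    using assms by (simp add: ennreal_mult_less_top ennreal_add_less_top)
  finally show ?thesis by simp
qed

lemma nn_integral_mult_le_sqnorm:
  assumes [measurable]: "f \<in> borel_measurable M" "g \<in> borel_measurable M"
  shows "(\<integral>\<^sup>+x. ennreal (cmod (f x) * cmod (g x)) \<partial>M) \<le> sqnorm M f + sqnorm M g"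
proof -
  have "cmod (f x) * cmod (g x) \<le> (cmod (f x))\<^sup>2 + (cmod (g x))\<^sup>2" for x
    using sum_squares_bound[of "cmod (f x)" "cmod (g x)"]
      mult_nonneg_nonneg[OF norm_ge_zero[of "f x"] norm_ge_zero[of "g x"]] by linarith
  then have "(\<integral>\<^sup>+x. ennreal (cmod (f x) * cmod (g x)) \<partial>M)
      \<le> (\<integral>\<^sup>+x. ennreal ((cmod (f x))\<^sup>2 + (cmod (g x))\<^sup>2) \<partial>M)"
    by (intro nn_integral_mono ennreal_leI)
  also have "\<dots> = sqnorm M f + sqnorm M g"
    unfolding sqnorm_def by (subst nn_integral_add[symmetric]) (auto intro!: nn_integral_cong ennreal_plus)
  finally show ?thesis .
qed

lemma integrable_mult_sqnorm:
  assumes [measurable]: "f \<in> borel_measurable M" "g \<in> borel_measurable M"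
    and "sqnorm M f < \<infinity>" "sqnorm M g < \<infinity>"
  shows "integrable M (\<lambda>x. f x * g x)"
proof (rule integrableI_bounded)
  show "(\<integral>\<^sup>+x. ennreal (norm (f x * g x)) \<partial>M) < \<infinity>"
    using le_less_trans[OF nn_integral_mult_le_sqnorm[of f M g]] assms
    by (simp add: norm_mult)
qed auto

lemma Cauchy_Schwarz_sqnorm:
  assumes [measurable]: "f \<in> borel_measurable M" "g \<in> borel_measurable M"
    and "sqnorm M f < \<infinity>" "sqnorm M g < \<infinity>"
  shows "ennreal ((cmod (LINT x|M. f x * g x))\<^sup>2) \<le> sqnorm M f * sqnorm M g"
proof -
  have "ennreal (cmod (LINT x|M. f x * g x)) \<le> (\<integral>\<^sup>+x. ennreal (norm (f x * g x)) \<partial>M)"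
    by (rule integral_norm_bound_ennreal[OF integrable_mult_sqnorm[OF assms]])
  also have "\<dots> = (\<integral>\<^sup>+x. ennreal (cmod (f x)) * ennreal (cmod (g x)) \<partial>M)"
    by (simp add: norm_mult ennreal_mult)
  finally have "(ennreal (cmod (LINT x|M. f x * g x)))\<^sup>2 \<le> (\<integral>\<^sup>+x. ennreal (cmod (f x)) * ennreal (cmod (g x)) \<partial>M)\<^sup>2"
    by (rule power_mono_ennreal)
  also have "\<dots> \<le> sqnorm M f * sqnorm M g"
    unfolding sqnorm_def using Cauchy_Schwarz_nn_integral[of "\<lambda>x. ennreal (cmod (f x))" M "\<lambda>x. ennreal (cmod (g x))"]
    by (simp add: ennreal_power)
  finally show ?thesis by (simp add: ennreal_power)
qed

text \<open>Cauchy-Schwarz for the factors \<open>sqrt w\<close> and \<open>a * sqrt w\<close>. In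
  this form a bound on the integral of a kernel \<open>w\<close> becomes an L^2 bound for the
  integral operator.\<close>

lemma Cauchy_Schwarz_weighted:
  assumes [measurable]: "a \<in> borel_measurable M" "w \<in> borel_measurable M"
    and nn: "\<And>x. 0 \<le> a x" "\<And>x. 0 \<le> w x"
  shows "(\<integral>\<^sup>+x. ennreal (a x * w x) \<partial>M)\<^sup>2
    \<le> (\<integral>\<^sup>+x. ennreal (w x) \<partial>M) * (\<integral>\<^sup>+x. ennreal ((a x)\<^sup>2 * w x) \<partial>M)"
proof -
  have "(\<integral>\<^sup>+x. ennreal (sqrt (w x)) * ennreal (a x * sqrt (w x)) \<partial>M)\<^sup>2
     \<le> (\<integral>\<^sup>+x. (ennreal (sqrt (w x)))\<^sup>2 \<partial>M) * (\<integral>\<^sup>+x. (ennreal (a x * sqrt (w x)))\<^sup>2 \<partial>M)"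
    by (rule Cauchy_Schwarz_nn_integral) auto
  moreover have "ennreal (sqrt (w x)) * ennreal (a x * sqrt (w x)) = ennreal (a x * w x)" for x
    using nn[of x] by (simp add: ennreal_mult' [symmetric] mult.commute mult.left_commute)
  moreover have "(ennreal (a x * sqrt (w x)))\<^sup>2 = ennreal ((a x)\<^sup>2 * w x)" for x
    using nn[of x] by (simp add: ennreal_power power_mult_distrib)
  ultimately show ?thesis
    using nn by (simp add: ennreal_power)
qed

text \<open>Continuity of the bilinear pairing, by Cauchy-Schwarz. It carries identities at a fixed
  point of a kernel through limits in the mean.\<close>

lemma L2_inner_tendsto:
  assumes [measurable]: "\<And>n. f n \<in> borel_measurable M" "g \<in> borel_measurable M" "h \<in> borel_measurable M"
    and fin: "\<And>n. sqnorm M (f n) < \<infinity>" "sqnorm M g < \<infinity>" "sqnorm M h < \<infinity>"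
    and lim: "(\<lambda>n. sqnorm M (\<lambda>x. f n x - g x)) \<longlonglongrightarrow> 0"
  shows "(\<lambda>n. LINT x|M. h x * f n x) \<longlonglongrightarrow> (LINT x|M. h x * g x)"
proof -
  have d: "(LINT x|M. h x * (f n x - g x)) = (LINT x|M. h x * f n x) - (LINT x|M. h x * g x)" for n
    unfolding right_diff_distrib
    by (intro Bochner_Integration.integral_diff integrable_mult_sqnorm fin) auto
  have le: "ennreal ((cmod (LINT x|M. h x * (f n x - g x)))\<^sup>2) \<le> sqnorm M h * sqnorm M (\<lambda>x. f n x - g x)" for n
    by (intro Cauchy_Schwarz_sqnorm fin sqnorm_diff_finite) auto
  have "(\<lambda>n. sqnorm M h * sqnorm M (\<lambda>x. f n x - g x)) \<longlonglongrightarrow> sqnorm M h * 0"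
    using fin(3) by (intro tendsto_mult_ennreal lim tendsto_const) auto
  then have lim0: "(\<lambda>n. sqnorm M h * sqnorm M (\<lambda>x. f n x - g x)) \<longlonglongrightarrow> ennreal 0"
    by simp
  have "(\<lambda>n. ennreal ((cmod (LINT x|M. h x * (f n x - g x)))\<^sup>2)) \<longlonglongrightarrow> ennreal 0"
    by (rule tendsto_sandwich[OF _ always_eventually[OF allI, OF le] tendsto_const lim0]) simp
  then have "(\<lambda>n. (cmod (LINT x|M. h x * (f n x - g x)))\<^sup>2) \<longlonglongrightarrow> 0"
    by (subst (asm) tendsto_ennreal_iff) auto
  then have "(\<lambda>n. sqrt ((cmod (LINT x|M. h x * (f n x - g x)))\<^sup>2)) \<longlonglongrightarrow> sqrt 0"
    by (rule tendsto_real_sqrt)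
  then have "(\<lambda>n. LINT x|M. h x * (f n x - g x)) \<longlonglongrightarrow> 0"
    by (simp add: tendsto_norm_zero_iff)
  then show ?thesis unfolding d by (rule LIM_zero_cancel)
qed

text \<open>Riesz-Fischer: a fast subsequence converges almost everywhere, and Fatou's lemma shows
  that its limit is the norm limit of the whole sequence.\<close>

lemma L2_complete:
  fixes f :: "nat \<Rightarrow> 'a \<Rightarrow> complex"
  assumes [measurable]: "\<And>n. f n \<in> borel_measurable M"
    and Cauchy: "\<And>e::real. e > 0 \<Longrightarrow> \<exists>N. \<forall>m\<ge>N. \<forall>n\<ge>N. sqnorm M (\<lambda>x. f m x - f n x) \<le> ennreal e"
  obtains g where "g \<in> borel_measurable M" "(\<lambda>n. sqnorm M (\<lambda>x. f n x - g x)) \<longlonglongrightarrow> 0"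
proof -
  \<comment> \<open>The rate \<open>(1/8)^k\<close> against the weight \<open>4^k\<close> used below
    leaves the summable \<open>(1/2)^k\<close>, and finiteness of the weighted sum at a point forces
    the increments there below \<open>(1/2)^k\<close> eventually.\<close>
  have "\<forall>k. \<exists>N. \<forall>m\<ge>N. \<forall>n\<ge>N. sqnorm M (\<lambda>x. f m x - f n x) \<le> ennreal ((1/8) ^ k)"
    by (intro allI Cauchy) simp
  then obtain N where N: "\<And>k m n. m \<ge> N k \<Longrightarrow> n \<ge> N k \<Longrightarrow> sqnorm M (\<lambda>x. f m x - f n x) \<le> ennreal ((1/8) ^ k)"
    by metis
  \<comment> \<open>Partial sums make the indices monotone, so that \<open>r j\<close> lies beyond
    every \<open>N k\<close> with \<open>k \<le> j\<close>.\<close>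
  define r where "r k = (\<Sum>j\<le>k. N j)" for k
  have r: "r j \<ge> N k" if "k \<le> j" for j k
    unfolding r_def using that by (intro member_le_sum) auto
  define d where "d k x = f (r (Suc k)) x - f (r k) x" for k x
  have [measurable]: "d k \<in> borel_measurable M" for k by (simp add: d_def[abs_def])
  have "(\<integral>\<^sup>+x. (\<Sum>k. ennreal (4 ^ k * (cmod (d k x))\<^sup>2)) \<partial>M) = (\<Sum>k. \<integral>\<^sup>+x. ennreal (4 ^ k * (cmod (d k x))\<^sup>2) \<partial>M)"
    by (rule nn_integral_suminf) auto
  also have "\<dots> = (\<Sum>k. ennreal (4 ^ k) * sqnorm M (d k))"
    unfolding sqnorm_def by (subst nn_integral_cmult[symmetric]) (auto simp: ennreal_mult)
  also have "\<dots> \<le> (\<Sum>k. ennreal ((1/2) ^ k))"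
  proof (rule suminf_le)
    fix k
    have "sqnorm M (d k) \<le> ennreal ((1/8) ^ k)"
      unfolding d_def[abs_def] by (rule N) (auto intro!: r)
    then have "ennreal (4 ^ k) * sqnorm M (d k) \<le> ennreal (4 ^ k) * ennreal ((1/8) ^ k)"
      by (rule mult_left_mono) auto
    also have "\<dots> = ennreal ((1/2) ^ k)"
      by (simp add: ennreal_mult[symmetric] power_mult_distrib[symmetric])
    finally show "ennreal (4 ^ k) * sqnorm M (d k) \<le> ennreal ((1/2) ^ k)" .
  qed auto
  also have "\<dots> = ennreal (\<Sum>k. (1/2) ^ k)"
    by (rule suminf_ennreal2) (auto intro: summable_geometric)
  finally have "(\<integral>\<^sup>+x. (\<Sum>k. ennreal (4 ^ k * (cmod (d k x))\<^sup>2)) \<partial>M) < \<infinity>"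
    using le_less_trans by fastforce
  then have "AE x in M. (\<Sum>k. ennreal (4 ^ k * (cmod (d k x))\<^sup>2)) \<noteq> \<infinity>"
    by (intro nn_integral_PInf_AE) auto
  then have conv: "AE x in M. convergent (\<lambda>k. f (r k) x)"
  proof (eventually_elim)
    fix x assume "(\<Sum>k. ennreal (4 ^ k * (cmod (d k x))\<^sup>2)) \<noteq> \<infinity>"
    then have "summable (\<lambda>k. 4 ^ k * (cmod (d k x))\<^sup>2)"
      by (intro summable_suminf_not_top) auto
    then have "(\<lambda>k. 4 ^ k * (cmod (d k x))\<^sup>2) \<longlonglongrightarrow> 0" by (rule summable_LIMSEQ_zero)
    then have "eventually (\<lambda>k. 4 ^ k * (cmod (d k x))\<^sup>2 < 1) sequentially"
      by (rule order_tendstoD) simp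
    then have "eventually (\<lambda>k. norm (d k x) \<le> (1/2) ^ k) sequentially"
    proof eventually_elim
      fix k assume "4 ^ k * (cmod (d k x))\<^sup>2 < 1"
      then have "(2 ^ k * cmod (d k x))\<^sup>2 \<le> 1\<^sup>2"
        by (simp add: power_mult_distrib power_mult[symmetric] mult.commute[of k] power_mult)
      then have "2 ^ k * cmod (d k x) \<le> 1" by (rule power2_le_imp_le) simp
      then show "norm (d k x) \<le> (1/2) ^ k" by (simp add: field_simps)
    qed
    then have "summable (\<lambda>k. d k x)"
      by (rule summable_comparison_test_ev) (simp add: summable_geometric)
    then have "convergent (\<lambda>n. f (r 0) x + (\<Sum>k<n. d k x))"
      by (intro convergent_add convergent_const) (simp add: summable_iff_convergent)
    also have "(\<lambda>n. f (r 0) x + (\<Sum>k<n. d k x)) = (\<lambda>k. f (r k) x)"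
      unfolding d_def by (subst sum_lessThan_telescope) auto
    finally show "convergent (\<lambda>k. f (r k) x)" .
  qed
  define g where "g x = lim (\<lambda>k. f (r k) x)" for x
  have [measurable]: "g \<in> borel_measurable M" unfolding g_def[abs_def] by measurable
  have lim: "AE x in M. (\<lambda>k. f (r k) x) \<longlonglongrightarrow> g x"
    using conv by eventually_elim (simp add: g_def convergent_LIMSEQ_iff)
  \<comment> \<open>The member \<open>f n\<close> of the full sequence is compared with the
    subsequence, so the estimate holds for all large \<open>n\<close> and not only along
    \<open>r\<close>.\<close>
  have le: "sqnorm M (\<lambda>x. f n x - g x) \<le> ennreal ((1/8) ^ k)" if "n \<ge> N k" for n k
  proof -
    have "AE x in M. ennreal ((cmod (f n x - g x))\<^sup>2) = liminf (\<lambda>j. ennreal ((cmod (f n x - f (r j) x))\<^sup>2))"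
      using lim
    proof eventually_elim
      fix x assume "(\<lambda>k. f (r k) x) \<longlonglongrightarrow> g x"
      then have "(\<lambda>j. ennreal ((cmod (f n x - f (r j) x))\<^sup>2)) \<longlonglongrightarrow> ennreal ((cmod (f n x - g x))\<^sup>2)"
        by (intro tendsto_ennrealI tendsto_intros)
      from lim_imp_Liminf[OF _ this]
      show "ennreal ((cmod (f n x - g x))\<^sup>2) = liminf (\<lambda>j. ennreal ((cmod (f n x - f (r j) x))\<^sup>2))"
        by simp
    qed
    then have "sqnorm M (\<lambda>x. f n x - g x) = (\<integral>\<^sup>+x. liminf (\<lambda>j. ennreal ((cmod (f n x - f (r j) x))\<^sup>2)) \<partial>M)"
      unfolding sqnorm_def by (rule nn_integral_cong_AE)
    also have "\<dots> \<le> liminf (\<lambda>j. sqnorm M (\<lambda>x. f n x - f (r j) x))"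
      unfolding sqnorm_def by (rule nn_integral_liminf) auto
    also have "\<dots> \<le> ennreal ((1/8) ^ k)"
    proof (rule Liminf_le)
      show "\<forall>\<^sub>F j in sequentially. sqnorm M (\<lambda>x. f n x - f (r j) x) \<le> ennreal ((1/8) ^ k)"
        using eventually_ge_at_top[of k] by eventually_elim (intro N that r)
    qed simp
    finally show ?thesis .
  qed
  have "(\<lambda>n. sqnorm M (\<lambda>x. f n x - g x)) \<longlonglongrightarrow> 0"
  proof (rule order_tendstoI)
    fix e :: ennreal assume "e > 0"
    have "(\<lambda>k. ennreal ((1/8) ^ k)) \<longlonglongrightarrow> ennreal 0"
      by (intro tendsto_ennrealI LIMSEQ_power_zero) simp
    then have "eventually (\<lambda>k. ennreal ((1/8) ^ k) < e) sequentially"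
      using \<open>e > 0\<close> by (intro order_tendstoD) auto
    then obtain k where k: "ennreal ((1/8) ^ k) < e" by (auto simp: eventually_sequentially)
    show "eventually (\<lambda>n. sqnorm M (\<lambda>x. f n x - g x) < e) sequentially"
      using eventually_ge_at_top[of "N k"] by eventually_elim (use le[of k] k le_less_trans in blast)
  qed simp
  then show ?thesis by (intro that[of g]) auto
qed

lemma sqnorm_limit_finite:
  assumes [measurable]: "\<And>n. f n \<in> borel_measurable M" "g \<in> borel_measurable M"
    and "\<And>n. sqnorm M (f n) < \<infinity>" and lim: "(\<lambda>n. sqnorm M (\<lambda>x. f n x - g x)) \<longlonglongrightarrow> 0"
  shows "sqnorm M g < \<infinity>"
proof -
  have "eventually (\<lambda>n. sqnorm M (\<lambda>x. f n x - g x) < 1) sequentially"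
    using lim by (rule order_tendstoD) simp
  then obtain n where "sqnorm M (\<lambda>x. f n x - g x) < 1" by (auto simp: eventually_sequentially)
  then have fin: "sqnorm M (\<lambda>x. f n x - g x) < \<infinity>" by (rule less_trans) simp
  have "sqnorm M (\<lambda>x. f n x - (f n x - g x)) < \<infinity>"
    by (rule sqnorm_diff_finite[OF _ _ assms(3) fin]) measurable
  then show ?thesis by simp
qed

text \<open>A bounded linear map carries Cauchy sequences to Cauchy sequences. The lemma speaks of
  the images \<open>f n\<close> of \<open>F n\<close> instead of a map, because \<open>synth\<close>
  and the Fourier integral are at first controlled on integrable functions only.\<close>

lemma L2_bounded_image_limit:
  fixes f :: "nat \<Rightarrow> 'a \<Rightarrow> complex" and F :: "nat \<Rightarrow> 'b \<Rightarrow> complex" and C :: real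
  assumes [measurable]: "\<And>n. f n \<in> borel_measurable M" "\<And>n. F n \<in> borel_measurable N" "G \<in> borel_measurable N"
    and bound: "\<And>m n. sqnorm M (\<lambda>x. f m x - f n x) \<le> ennreal C * sqnorm N (\<lambda>z. F m z - F n z)"
    and lim: "(\<lambda>n. sqnorm N (\<lambda>z. F n z - G z)) \<longlonglongrightarrow> 0"
  obtains g where "g \<in> borel_measurable M" "(\<lambda>n. sqnorm M (\<lambda>x. f n x - g x)) \<longlonglongrightarrow> 0"
proof (rule L2_complete[of f M])
  fix e :: real assume "e > 0"
  define s where "s n = sqnorm N (\<lambda>z. F n z - G z)" for n
  have "(\<lambda>n. ennreal C * (2 * (2 * s n))) \<longlonglongrightarrow> ennreal C * (2 * (2 * 0))"
    using lim by (intro tendsto_mult_ennreal tendsto_const) (auto simp: s_def)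
  then have "eventually (\<lambda>n. ennreal C * (2 * (2 * s n)) < ennreal e) sequentially"
    using \<open>e > 0\<close> by (intro order_tendstoD) auto
  then obtain n0 where n0: "\<And>n. n \<ge> n0 \<Longrightarrow> ennreal C * (2 * (2 * s n)) < ennreal e"
    by (auto simp: eventually_sequentially)
  show "\<exists>n0. \<forall>m\<ge>n0. \<forall>n\<ge>n0. sqnorm M (\<lambda>x. f m x - f n x) \<le> ennreal e"
  proof (intro exI[of _ n0] allI impI)
    fix m n assume mn: "m \<ge> n0" "n \<ge> n0"
    have "sqnorm M (\<lambda>x. f m x - f n x) \<le> ennreal C * (2 * (s m + s n))"
      unfolding s_def using sqnorm_triangle[of "F m" N G "F n"] sqnorm_minus_commute[of N G "F n"]
      by (intro order_trans[OF bound] mult_left_mono) auto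
    also have "\<dots> \<le> ennreal C * (2 * (2 * max (s m) (s n)))"
      by (intro mult_left_mono) (auto simp: mult_2 intro!: add_mono)
    also have "\<dots> \<le> ennreal e"
      using n0[OF mn(1)] n0[OF mn(2)] by (auto simp: max_def)
    finally show "sqnorm M (\<lambda>x. f m x - f n x) \<le> ennreal e" .
  qed
qed (use that in auto)

lemma sqnorm_truncate_tendsto:
  assumes [measurable]: "F \<in> borel_measurable N" "\<And>n. S n \<in> sets N"
    and fin: "sqnorm N F < \<infinity>" and ev: "\<And>z. z \<in> space N \<Longrightarrow> eventually (\<lambda>n. z \<in> S n) sequentially"
  shows "(\<lambda>n. sqnorm N (\<lambda>z. indicator (S n) z * F z - F z)) \<longlonglongrightarrow> 0"
proof -
  have "(\<lambda>n. \<integral>\<^sup>+z. ennreal ((cmod (indicator (S n) z * F z - F z))\<^sup>2) \<partial>N) \<longlonglongrightarrow> (\<integral>\<^sup>+z. 0 \<partial>N)"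
  proof (rule nn_integral_dominated_convergence[where w = "\<lambda>z. ennreal ((cmod (F z))\<^sup>2)"])
    show "AE z in N. (\<lambda>n. ennreal ((cmod (indicator (S n) z * F z - F z))\<^sup>2)) \<longlonglongrightarrow> 0"
    proof (rule AE_I2)
      fix z assume "z \<in> space N"
      from ev[OF this] show "(\<lambda>n. ennreal ((cmod (indicator (S n) z * F z - F z))\<^sup>2)) \<longlonglongrightarrow> 0"
        by (intro tendsto_eventually, eventually_elim) simp
    qed
    show "AE z in N. ennreal ((cmod (indicator (S n) z * F z - F z))\<^sup>2) \<le> ennreal ((cmod (F z))\<^sup>2)" for n
      by (auto simp: indicator_def)
  qed (use fin in \<open>auto simp: sqnorm_def\<close>)
  then show ?thesis by (simp add: sqnorm_def)
qed

lemma sqnorm_truncate_le: "sqnorm N (\<lambda>z. indicator S z * F z) \<le> sqnorm N F"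
  unfolding sqnorm_def by (intro nn_integral_mono) (auto simp: indicator_def)

lemma integrable_truncate:
  assumes [measurable]: "F \<in> borel_measurable N" "S \<in> sets N"
    and "sqnorm N F < \<infinity>" "emeasure N S < \<infinity>"
  shows "integrable N (\<lambda>z. indicator S z * F z)"
proof (rule integrable_mult_sqnorm)
  have "sqnorm N (indicator S) = emeasure N S"
    unfolding sqnorm_def by (subst nn_integral_indicator[symmetric], simp)
      (intro nn_integral_cong, auto simp: indicator_def)
  then show "sqnorm N (indicator S) < \<infinity>" using assms by simp
qed (use assms in auto)

subsection \<open>Kernels satisfying Schur's test\<close>

lemma borel_measurable_cnj [measurable (raw)]:
  "f \<in> borel_measurable M \<Longrightarrow> (\<lambda>x. cnj (f x)) \<in> borel_measurable M"
  by (rule measurable_compose[of f M borel cnj]) (auto intro!: borel_measurable_continuous_onI continuous_intros)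

text \<open>The kernel of the analysis map sending \<open>f\<close> to
  \<open>LINT x|lborel. A z x * f x\<close>. The bound \<open>b\<close> makes the adjoint integral
  converge on integrable functions, \<open>c\<close> puts every row \<open>A z\<close> into L^2
  uniformly, and \<open>C\<close> is the Schur bound for analysis composed with its adjoint. A bound
  for rows suffices since that composition has a Hermitian kernel.\<close>

locale L2_kernel =
  fixes A :: "'z::euclidean_space \<Rightarrow> 'x::euclidean_space \<Rightarrow> complex" and b c C :: real
  assumes A_borel: "(\<lambda>p. A (fst p) (snd p)) \<in> borel_measurable borel"
    and A_bound: "cmod (A z x) \<le> b"
    and A_sqnorm: "sqnorm lborel (A z) \<le> ennreal c"
    and gram_bound: "(\<integral>\<^sup>+z'. ennreal (cmod (LINT x|lborel. A z x * cnj (A z' x))) \<partial>lborel) \<le> ennreal C"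
begin

lemma A_measurable [measurable (raw)]:
  assumes [measurable]: "f \<in> borel_measurable M" "g \<in> borel_measurable M"
  shows "(\<lambda>x. A (f x) (g x)) \<in> borel_measurable M"
proof -
  have "(\<lambda>x. (f x, g x)) \<in> borel_measurable M" by measurable
  from measurable_compose[OF this A_borel] show ?thesis by simp
qed

lemma A_sqnorm_finite: "sqnorm lborel (A z) < \<infinity>"
  using A_sqnorm[of z] by (rule le_less_trans) simp

definition gram :: "'z \<Rightarrow> 'z \<Rightarrow> complex" where
  "gram z z' = (LINT x|lborel. A z x * cnj (A z' x))"

text \<open>The adjoint of the analysis map; by \<open>analysis_synth\<close>, \<open>gram\<close>
  is the kernel of analysis after \<open>synth\<close>.\<close>

definition synth :: "('z \<Rightarrow> complex) \<Rightarrow> 'x \<Rightarrow> complex" where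
  "synth g x = (LINT z|lborel. g z * cnj (A z x))"

lemma gram_measurable [measurable (raw)]:
  assumes [measurable]: "f \<in> borel_measurable M" "g \<in> borel_measurable M"
  shows "(\<lambda>x. gram (f x) (g x)) \<in> borel_measurable M"
  unfolding gram_def by measurable

lemma gram_commute: "gram z' z = cnj (gram z z')"
  unfolding gram_def by (simp add: mult.commute flip: Bochner_Integration.integral_cnj)

lemma synth_measurable [measurable]:
  assumes [measurable]: "g \<in> borel_measurable borel"
  shows "synth g \<in> borel_measurable borel"
  unfolding synth_def[abs_def] by measurable

lemma synth_integrable:
  assumes "integrable lborel g"
  shows "integrable lborel (\<lambda>z. g z * cnj (A z x))"
proof (rule Bochner_Integration.integrable_bound)
  show "integrable lborel (\<lambda>z. of_real b * g z)" using assms by simp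
  have "0 \<le> b" using A_bound order_trans norm_ge_zero by blast
  then show "AE z in lborel. norm (g z * cnj (A z x)) \<le> norm (of_real b * g z)"
    by (auto simp: norm_mult mult.commute[of b] intro!: mult_left_mono A_bound AE_I2)
qed (use assms in measurable)

lemma synth_diff:
  assumes "integrable lborel g" "integrable lborel h"
  shows "synth (\<lambda>z. g z - h z) x = synth g x - synth h x"
  unfolding synth_def left_diff_distrib
  by (intro Bochner_Integration.integral_diff synth_integrable assms)

text \<open>A preliminary bound by the L^1 norm of \<open>g\<close>: Cauchy-Schwarz with weight
  \<open>cmod (g z)\<close>, then Tonelli. The L^2 bound in \<open>sqnorm_synth_le\<close> pairs
  \<open>synth g\<close> with its own conjugate and so has to start from finiteness.\<close>

lemma sqnorm_synth_finite:
  assumes g: "integrable lborel g"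
  shows "sqnorm lborel (synth g) < \<infinity>"
proof -
  have [measurable]: "g \<in> borel_measurable borel" using g by auto
  define G where "G = (\<integral>\<^sup>+z. ennreal (cmod (g z)) \<partial>lborel)"
  have G: "G < \<infinity>" using g by (simp add: G_def integrable_iff_bounded)
  have "ennreal ((cmod (synth g x))\<^sup>2) \<le> G * (\<integral>\<^sup>+z. ennreal ((cmod (A z x))\<^sup>2 * cmod (g z)) \<partial>lborel)" for x
  proof -
    have "ennreal (cmod (synth g x)) \<le> (\<integral>\<^sup>+z. ennreal (norm (g z * cnj (A z x))) \<partial>lborel)"
      unfolding synth_def by (rule integral_norm_bound_ennreal[OF synth_integrable[OF g]])
    also have "\<dots> = (\<integral>\<^sup>+z. ennreal (cmod (A z x) * cmod (g z)) \<partial>lborel)"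
      by (simp add: norm_mult mult.commute)
    finally have "(ennreal (cmod (synth g x)))\<^sup>2 \<le> (\<integral>\<^sup>+z. ennreal (cmod (A z x) * cmod (g z)) \<partial>lborel)\<^sup>2"
      by (rule power_mono_ennreal)
    also have "\<dots> \<le> G * (\<integral>\<^sup>+z. ennreal ((cmod (A z x))\<^sup>2 * cmod (g z)) \<partial>lborel)"
      unfolding G_def by (rule Cauchy_Schwarz_weighted) auto
    finally show ?thesis by (simp add: ennreal_power)
  qed
  then have "sqnorm lborel (synth g) \<le> (\<integral>\<^sup>+x. G * (\<integral>\<^sup>+z. ennreal ((cmod (A z x))\<^sup>2 * cmod (g z)) \<partial>lborel) \<partial>lborel)"
    unfolding sqnorm_def by (intro nn_integral_mono)
  also have "\<dots> = G * (\<integral>\<^sup>+x. \<integral>\<^sup>+z. ennreal ((cmod (A z x))\<^sup>2 * cmod (g z)) \<partial>lborel \<partial>lborel)"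
    by (rule nn_integral_cmult) measurable
  also have "(\<integral>\<^sup>+x. \<integral>\<^sup>+z. ennreal ((cmod (A z x))\<^sup>2 * cmod (g z)) \<partial>lborel \<partial>lborel)
      = (\<integral>\<^sup>+z. \<integral>\<^sup>+x. ennreal ((cmod (A z x))\<^sup>2 * cmod (g z)) \<partial>lborel \<partial>lborel)"
    by (rule lborel_pair.Fubini') measurable
  also have "\<dots> = (\<integral>\<^sup>+z. sqnorm lborel (A z) * ennreal (cmod (g z)) \<partial>lborel)"
    unfolding sqnorm_def by (subst nn_integral_multc[symmetric]) (auto simp: ennreal_mult)
  also have "\<dots> \<le> (\<integral>\<^sup>+z. ennreal c * ennreal (cmod (g z)) \<partial>lborel)"
    by (intro nn_integral_mono mult_right_mono A_sqnorm) auto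
  also have "\<dots> = ennreal c * G"
    unfolding G_def by (rule nn_integral_cmult) measurable
  finally have "sqnorm lborel (synth g) \<le> G * (ennreal c * G)"
    by (simp add: mult_left_mono)
  also have "\<dots> < \<infinity>" using G by (simp add: ennreal_mult_less_top)
  finally show ?thesis .
qed

text \<open>Fubini; convergence is absolute because the inner integral over \<open>x\<close> is at
  most \<open>sqnorm lborel h + ennreal c\<close> for every \<open>z\<close>. The pairing is
  bilinear, and \<open>h\<close> will be a row of the kernel, the conjugate of
  \<open>synth g\<close>, or a Gaussian.\<close>

lemma synth_dual:
  assumes g: "integrable lborel g" and h[measurable]: "h \<in> borel_measurable borel" "sqnorm lborel h < \<infinity>"
  shows "(LINT x|lborel. h x * synth g x) = (LINT z|lborel. g z * (LINT x|lborel. h x * cnj (A z x)))"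
proof -
  have [measurable]: "g \<in> borel_measurable borel" using g by auto
  define F where "F z x = g z * (h x * cnj (A z x))" for z x
  have Fm[measurable]: "(\<lambda>p. F (fst p) (snd p)) \<in> borel_measurable (lborel \<Otimes>\<^sub>M lborel)"
    unfolding F_def by measurable
  have "(\<integral>\<^sup>+p. ennreal (norm (F (fst p) (snd p))) \<partial>(lborel \<Otimes>\<^sub>M lborel))
     = (\<integral>\<^sup>+z. \<integral>\<^sup>+x. ennreal (norm (F z x)) \<partial>lborel \<partial>lborel)"
    by (subst lborel.nn_integral_fst[symmetric]) auto
  also have "\<dots> = (\<integral>\<^sup>+z. ennreal (cmod (g z)) * (\<integral>\<^sup>+x. ennreal (cmod (h x) * cmod (A z x)) \<partial>lborel) \<partial>lborel)"
    by (subst nn_integral_cmult[symmetric]) (auto simp: F_def norm_mult ennreal_mult)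
  also have "\<dots> \<le> (\<integral>\<^sup>+z. ennreal (cmod (g z)) * (sqnorm lborel h + ennreal c) \<partial>lborel)"
  proof (intro nn_integral_mono mult_left_mono)
    fix z
    have "(\<integral>\<^sup>+x. ennreal (cmod (h x) * cmod (A z x)) \<partial>lborel) \<le> sqnorm lborel h + sqnorm lborel (A z)"
      by (rule nn_integral_mult_le_sqnorm) measurable
    also have "\<dots> \<le> sqnorm lborel h + ennreal c"
      by (intro add_left_mono A_sqnorm)
    finally show "(\<integral>\<^sup>+x. ennreal (cmod (h x) * cmod (A z x)) \<partial>lborel) \<le> sqnorm lborel h + ennreal c" .
  qed auto
  also have "\<dots> = (\<integral>\<^sup>+z. ennreal (cmod (g z)) \<partial>lborel) * (sqnorm lborel h + ennreal c)"
    by (rule nn_integral_multc) measurable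
  also have "\<dots> < \<infinity>"
    using g h by (simp add: integrable_iff_bounded ennreal_mult_less_top)
  finally have "integrable (lborel \<Otimes>\<^sub>M lborel) (\<lambda>p. F (fst p) (snd p))"
    by (intro integrableI_bounded Fm)
  then have "(LINT x|lborel. LINT z|lborel. F z x) = (LINT z|lborel. LINT x|lborel. F z x)"
    by (intro lborel_pair.Fubini_integral) (simp add: case_prod_beta')
  moreover have "(LINT z|lborel. F z x) = h x * synth g x" for x
    unfolding synth_def by (subst integral_mult_right_zero[symmetric]) (simp add: F_def mult_ac)
  ultimately show ?thesis unfolding F_def by simp
qed

lemma analysis_synth:
  assumes "integrable lborel g"
  shows "(LINT x|lborel. A z x * synth g x) = (LINT z'|lborel. g z' * gram z z')"
  unfolding gram_def by (rule synth_dual[OF assms _ A_sqnorm_finite]) measurable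

text \<open>This covers every \<open>f\<close>: where \<open>f\<close> is not integrable, the
  Bochner integral is 0 by convention.\<close>

lemma cmod_integral_le: "ennreal (cmod (LINT z|M. f z)) \<le> (\<integral>\<^sup>+z. ennreal (cmod (f z)) \<partial>M)"
  by (cases "integrable M f") (auto simp: integral_norm_bound_ennreal not_integrable_integral_eq)

text \<open>Schur's test for the Gram kernel.\<close>

lemma gram_Schur:
  assumes [measurable]: "u \<in> borel_measurable borel" "v \<in> borel_measurable borel"
  shows "(\<integral>\<^sup>+z. \<integral>\<^sup>+z'. ennreal (cmod (u z) * cmod (v z') * cmod (gram z z')) \<partial>lborel \<partial>lborel)
    \<le> ennreal C * (sqnorm lborel u + sqnorm lborel v)"
proof -
  have row: "(\<integral>\<^sup>+z. \<integral>\<^sup>+z'. ennreal ((cmod (w z))\<^sup>2 * cmod (gram z z')) \<partial>lborel \<partial>lborel) \<le> ennreal C * sqnorm lborel w"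
    if [measurable]: "w \<in> borel_measurable borel" for w
  proof -
    have "(\<integral>\<^sup>+z'. ennreal ((cmod (w z))\<^sup>2 * cmod (gram z z')) \<partial>lborel) \<le> ennreal ((cmod (w z))\<^sup>2) * ennreal C" for z
    proof -
      have "(\<integral>\<^sup>+z'. ennreal ((cmod (w z))\<^sup>2 * cmod (gram z z')) \<partial>lborel) =
         ennreal ((cmod (w z))\<^sup>2) * (\<integral>\<^sup>+z'. ennreal (cmod (gram z z')) \<partial>lborel)"
        by (subst nn_integral_cmult[symmetric]) (simp_all flip: ennreal_mult')
      also have "\<dots> \<le> ennreal ((cmod (w z))\<^sup>2) * ennreal C"
        using gram_bound[of z] unfolding gram_def by (rule mult_left_mono) auto
      finally show ?thesis .
    qed
    then have "(\<integral>\<^sup>+z. \<integral>\<^sup>+z'. ennreal ((cmod (w z))\<^sup>2 * cmod (gram z z')) \<partial>lborel \<partial>lborel)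
        \<le> (\<integral>\<^sup>+z. ennreal ((cmod (w z))\<^sup>2) * ennreal C \<partial>lborel)"
      by (intro nn_integral_mono)
    also have "\<dots> = ennreal C * sqnorm lborel w"
      unfolding sqnorm_def by (subst nn_integral_multc) (auto simp: mult.commute)
    finally show ?thesis .
  qed
  have "(\<integral>\<^sup>+z. \<integral>\<^sup>+z'. ennreal (cmod (u z) * cmod (v z') * cmod (gram z z')) \<partial>lborel \<partial>lborel)
    \<le> (\<integral>\<^sup>+z. \<integral>\<^sup>+z'. ennreal ((cmod (u z))\<^sup>2 * cmod (gram z z')) + ennreal ((cmod (v z'))\<^sup>2 * cmod (gram z z')) \<partial>lborel \<partial>lborel)"
  proof (intro nn_integral_mono)
    fix z z'
    \<comment> \<open>Omitting the factor 1/2 of this inequality is the origin of the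
      \<open>2 * C\<close> in \<open>sqnorm_synth_le\<close>.\<close>
    have "cmod (u z) * cmod (v z') \<le> (cmod (u z))\<^sup>2 + (cmod (v z'))\<^sup>2"
      using sum_squares_bound[of "cmod (u z)" "cmod (v z')"]
        mult_nonneg_nonneg[OF norm_ge_zero[of "u z"] norm_ge_zero[of "v z'"]] by linarith
    from mult_right_mono[OF this norm_ge_zero[of "gram z z'"]]
    show "ennreal (cmod (u z) * cmod (v z') * cmod (gram z z'))
      \<le> ennreal ((cmod (u z))\<^sup>2 * cmod (gram z z')) + ennreal ((cmod (v z'))\<^sup>2 * cmod (gram z z'))"
      by (simp add: distrib_right flip: ennreal_plus)
  qed
  also have "\<dots> = (\<integral>\<^sup>+z. \<integral>\<^sup>+z'. ennreal ((cmod (u z))\<^sup>2 * cmod (gram z z')) \<partial>lborel \<partial>lborel)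
      + (\<integral>\<^sup>+z. \<integral>\<^sup>+z'. ennreal ((cmod (v z'))\<^sup>2 * cmod (gram z z')) \<partial>lborel \<partial>lborel)"
    by (subst nn_integral_add[symmetric]) (auto simp: nn_integral_add)
  also have "(\<integral>\<^sup>+z. \<integral>\<^sup>+z'. ennreal ((cmod (v z'))\<^sup>2 * cmod (gram z z')) \<partial>lborel \<partial>lborel)
     = (\<integral>\<^sup>+z'. \<integral>\<^sup>+z. ennreal ((cmod (v z'))\<^sup>2 * cmod (gram z z')) \<partial>lborel \<partial>lborel)"
    by (rule lborel_pair.Fubini') measurable
  also have "\<dots> = (\<integral>\<^sup>+z. \<integral>\<^sup>+z'. ennreal ((cmod (v z))\<^sup>2 * cmod (gram z z')) \<partial>lborel \<partial>lborel)"
    by (subst gram_commute) simp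
  finally show ?thesis
    using add_mono[OF row[of u] row[of v]] by (simp add: distrib_left order_trans)
qed

text \<open>The squared norm of the adjoint applied to \<open>g\<close> is the pairing of
  \<open>g\<close> with the Gram operator applied to \<open>g\<close>. Schur's test bounds that
  pairing by the L^2 norm of \<open>g\<close> alone, which is what limits of truncations
  require.\<close>

lemma sqnorm_synth_le:
  assumes g: "integrable lborel g" and fin: "sqnorm lborel g < \<infinity>"
  shows "sqnorm lborel (synth g) \<le> ennreal (2 * C) * sqnorm lborel g"
proof -
  have [measurable]: "g \<in> borel_measurable borel" using g by auto
  have fs: "sqnorm lborel (\<lambda>x. cnj (synth g x)) < \<infinity>" "sqnorm lborel (synth g) < \<infinity>"
    using sqnorm_synth_finite[OF g] by (simp_all add: sqnorm_def)
  have int: "integrable lborel (\<lambda>x. cnj (synth g x) * synth g x)"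
    by (intro integrable_mult_sqnorm fs) measurable
  define I where "I = (LINT x|lborel. cnj (synth g x) * synth g x)"
  have e: "cnj (synth g x) * synth g x = of_real ((cmod (synth g x))\<^sup>2)" for x
    by (metis complex_norm_square mult.commute)
  have "integrable lborel (\<lambda>x. (cmod (synth g x))\<^sup>2)"
    using int unfolding e complex_of_real_integrable_eq .
  then have "sqnorm lborel (synth g) = ennreal (LINT x|lborel. (cmod (synth g x))\<^sup>2)"
    unfolding sqnorm_def by (rule nn_integral_eq_integral) auto
  also have "\<dots> = ennreal (cmod I)"
    unfolding I_def e integral_complex_of_real by simp
  \<comment> \<open>Duality with the conjugate of \<open>synth g\<close> as the second function;
    \<open>analysis_synth\<close> then turns the inner integral into the Gram operator.\<close>
  also have "I = (LINT z|lborel. g z * (LINT x|lborel. cnj (synth g x) * cnj (A z x)))"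
    unfolding I_def by (rule synth_dual[OF g _ fs(1)]) measurable
  also have "\<dots> = (LINT z|lborel. g z * cnj (LINT z'|lborel. g z' * gram z z'))"
    unfolding analysis_synth[OF g, symmetric] by (simp flip: Bochner_Integration.integral_cnj add: mult.commute)
  also have "ennreal (cmod \<dots>)
    \<le> (\<integral>\<^sup>+z. ennreal (cmod (g z)) * ennreal (cmod (LINT z'|lborel. g z' * gram z z')) \<partial>lborel)"
    by (rule order_trans[OF cmod_integral_le]) (simp add: norm_mult ennreal_mult)
  also have "\<dots> \<le> (\<integral>\<^sup>+z. ennreal (cmod (g z)) * (\<integral>\<^sup>+z'. ennreal (cmod (g z' * gram z z')) \<partial>lborel) \<partial>lborel)"
    by (intro nn_integral_mono mult_left_mono cmod_integral_le) auto
  also have "\<dots> = (\<integral>\<^sup>+z. \<integral>\<^sup>+z'. ennreal (cmod (g z) * cmod (g z') * cmod (gram z z')) \<partial>lborel \<partial>lborel)"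
    by (subst nn_integral_cmult[symmetric]) (auto simp: norm_mult ennreal_mult mult_ac)
  also have "\<dots> \<le> ennreal C * (sqnorm lborel g + sqnorm lborel g)"
    by (rule gram_Schur) measurable
  also have "\<dots> = ennreal (2 * C) * sqnorm lborel g"
    by (subst ennreal_mult') (auto simp: mult_ac simp flip: mult_2)
  finally show ?thesis .
qed

lemma gram_norm_le: "ennreal (cmod (gram z z')) \<le> ennreal c + ennreal c"
proof -
  have "ennreal (cmod (gram z z')) \<le> (\<integral>\<^sup>+x. ennreal (cmod (A z x) * cmod (A z' x)) \<partial>lborel)"
    unfolding gram_def by (rule order_trans[OF cmod_integral_le]) (simp add: norm_mult)
  also have "\<dots> \<le> sqnorm lborel (A z) + sqnorm lborel (A z')"
    by (rule nn_integral_mult_le_sqnorm) measurable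
  also have "\<dots> \<le> ennreal c + ennreal c"
    by (intro add_mono A_sqnorm)
  finally show ?thesis .
qed

text \<open>A row of \<open>gram\<close> is bounded and integrable, hence square integrable.\<close>

lemma sqnorm_gram_finite: "sqnorm lborel (gram z) < \<infinity>"
proof -
  have "sqnorm lborel (gram z) = (\<integral>\<^sup>+z'. ennreal (cmod (gram z z')) * ennreal (cmod (gram z z')) \<partial>lborel)"
    unfolding sqnorm_def by (simp add: ennreal_mult power2_eq_square)
  also have "\<dots> \<le> (\<integral>\<^sup>+z'. (ennreal c + ennreal c) * ennreal (cmod (gram z z')) \<partial>lborel)"
    by (intro nn_integral_mono mult_right_mono gram_norm_le) auto
  also have "\<dots> = (ennreal c + ennreal c) * (\<integral>\<^sup>+z'. ennreal (cmod (gram z z')) \<partial>lborel)"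
    by (rule nn_integral_cmult) measurable
  also have "\<dots> \<le> (ennreal c + ennreal c) * ennreal C"
    using gram_bound[of z] unfolding gram_def by (rule mult_left_mono) auto
  also have "\<dots> < \<infinity>" by (simp add: ennreal_mult_less_top)
  finally show ?thesis .
qed

lemma integrable_gram:
  assumes [measurable]: "u \<in> borel_measurable borel" and "sqnorm lborel u < \<infinity>"
  shows "integrable lborel (\<lambda>z'. u z' * gram z z')"
  by (intro integrable_mult_sqnorm sqnorm_gram_finite assms) measurable

text \<open>Schur's test for \<open>u\<close> that need not be integrable: Cauchy-Schwarz along
  rows, then Tonelli and Hermitian symmetry for the columns. For the Fock kernel this operator will
  be the Bergman projection.\<close>

lemma sqnorm_gram_op_finite:
  assumes [measurable]: "u \<in> borel_measurable borel" and "sqnorm lborel u < \<infinity>"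
  shows "sqnorm lborel (\<lambda>z. LINT z'|lborel. u z' * gram z z') < \<infinity>"
proof -
  have "ennreal ((cmod (LINT z'|lborel. u z' * gram z z'))\<^sup>2)
      \<le> ennreal C * (\<integral>\<^sup>+z'. ennreal ((cmod (u z'))\<^sup>2 * cmod (gram z z')) \<partial>lborel)" for z
  proof -
    have "(ennreal (cmod (LINT z'|lborel. u z' * gram z z')))\<^sup>2
      \<le> (\<integral>\<^sup>+z'. ennreal (cmod (u z' * gram z z')) \<partial>lborel)\<^sup>2"
      by (intro power_mono_ennreal cmod_integral_le)
    also have "\<dots> = (\<integral>\<^sup>+z'. ennreal (cmod (u z') * cmod (gram z z')) \<partial>lborel)\<^sup>2"
      by (simp add: norm_mult)
    also have "\<dots> \<le> (\<integral>\<^sup>+z'. ennreal (cmod (gram z z')) \<partial>lborel) *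
        (\<integral>\<^sup>+z'. ennreal ((cmod (u z'))\<^sup>2 * cmod (gram z z')) \<partial>lborel)"
      by (rule Cauchy_Schwarz_weighted) auto
    also have "\<dots> \<le> ennreal C * (\<integral>\<^sup>+z'. ennreal ((cmod (u z'))\<^sup>2 * cmod (gram z z')) \<partial>lborel)"
      using gram_bound[of z] unfolding gram_def by (rule mult_right_mono) auto
    finally show ?thesis by (simp add: ennreal_power)
  qed
  then have "sqnorm lborel (\<lambda>z. LINT z'|lborel. u z' * gram z z')
      \<le> (\<integral>\<^sup>+z. ennreal C * (\<integral>\<^sup>+z'. ennreal ((cmod (u z'))\<^sup>2 * cmod (gram z z')) \<partial>lborel) \<partial>lborel)"
    unfolding sqnorm_def by (intro nn_integral_mono)
  also have "\<dots> = ennreal C * (\<integral>\<^sup>+z. \<integral>\<^sup>+z'. ennreal ((cmod (u z'))\<^sup>2 * cmod (gram z z')) \<partial>lborel \<partial>lborel)"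
    by (rule nn_integral_cmult) measurable
  also have "(\<integral>\<^sup>+z. \<integral>\<^sup>+z'. ennreal ((cmod (u z'))\<^sup>2 * cmod (gram z z')) \<partial>lborel \<partial>lborel)
      = (\<integral>\<^sup>+z'. \<integral>\<^sup>+z. ennreal ((cmod (u z'))\<^sup>2 * cmod (gram z z')) \<partial>lborel \<partial>lborel)"
    by (rule lborel_pair.Fubini') measurable
  also have "\<dots> = (\<integral>\<^sup>+z'. ennreal ((cmod (u z'))\<^sup>2) * (\<integral>\<^sup>+z. ennreal (cmod (gram z' z)) \<partial>lborel) \<partial>lborel)"
    by (subst gram_commute, subst nn_integral_cmult[symmetric]) (auto simp: ennreal_mult)
  also have "\<dots> \<le> (\<integral>\<^sup>+z'. ennreal ((cmod (u z'))\<^sup>2) * ennreal C \<partial>lborel)"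
    using gram_bound unfolding gram_def by (intro nn_integral_mono mult_left_mono) auto
  also have "\<dots> = sqnorm lborel u * ennreal C"
    unfolding sqnorm_def by (rule nn_integral_multc) measurable
  finally have "sqnorm lborel (\<lambda>z. LINT z'|lborel. u z' * gram z z') \<le> ennreal C * (sqnorm lborel u * ennreal C)"
    by (simp add: mult_left_mono)
  also have "\<dots> < \<infinity>" using assms by (simp add: ennreal_mult_less_top)
  finally show ?thesis .
qed

text \<open>Fubini for a Hermitian kernel, with \<open>gram_Schur\<close> supplying absolute
  convergence. It will yield the orthogonality that characterises the projection.\<close>

lemma gram_op_self_adjoint:
  assumes [measurable]: "u \<in> borel_measurable borel" "v \<in> borel_measurable borel"
    and fin: "sqnorm lborel u < \<infinity>" "sqnorm lborel v < \<infinity>"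
  shows "(LINT z|lborel. (LINT z'|lborel. u z' * gram z z') * cnj (v z))
    = (LINT z'|lborel. u z' * cnj (LINT z|lborel. v z * gram z' z))"
proof -
  define F where "F z z' = u z' * gram z z' * cnj (v z)" for z z'
  have Fm[measurable]: "(\<lambda>p. F (fst p) (snd p)) \<in> borel_measurable (lborel \<Otimes>\<^sub>M lborel)"
    unfolding F_def by measurable
  have "(\<integral>\<^sup>+p. ennreal (norm (F (fst p) (snd p))) \<partial>(lborel \<Otimes>\<^sub>M lborel))
     = (\<integral>\<^sup>+z. \<integral>\<^sup>+z'. ennreal (cmod (v z) * cmod (u z') * cmod (gram z z')) \<partial>lborel \<partial>lborel)"
    by (subst lborel.nn_integral_fst[symmetric]) (auto simp: F_def norm_mult mult_ac)
  also have "\<dots> \<le> ennreal C * (sqnorm lborel v + sqnorm lborel u)"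
    by (rule gram_Schur) measurable
  also have "\<dots> < \<infinity>"
    using fin by (simp add: ennreal_mult_less_top)
  finally have "integrable (lborel \<Otimes>\<^sub>M lborel) (\<lambda>p. F (fst p) (snd p))"
    by (intro integrableI_bounded Fm)
  then have "(LINT z'|lborel. LINT z|lborel. F z z') = (LINT z|lborel. LINT z'|lborel. F z z')"
    by (intro lborel_pair.Fubini_integral) (simp add: case_prod_beta')
  moreover have "(LINT z'|lborel. F z z') = (LINT z'|lborel. u z' * gram z z') * cnj (v z)" for z
    unfolding F_def by simp
  moreover have "(LINT z|lborel. F z z') = u z' * cnj (LINT z|lborel. v z * gram z' z)" for z'
    unfolding F_def gram_commute[of _ z']
    by (simp flip: Bochner_Integration.integral_cnj integral_mult_right_zero add: mult_ac)
  ultimately show ?thesis by simp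
qed

text \<open>The assumption \<open>rep\<close> says that the Gram operator fixes \<open>F\<close>, so
  that \<open>F\<close> is formally the analysis of \<open>synth F\<close>. The conclusion holds at
  every \<open>z\<close>, not just almost everywhere, because both limits at the end are taken with
  \<open>z\<close> fixed.\<close>

lemma analysis_surj:
  assumes F[measurable]: "F \<in> borel_measurable borel" and fin: "sqnorm lborel F < \<infinity>"
    and rep: "\<And>z. (LINT z'|lborel. F z' * gram z z') = F z"
  obtains f where "f \<in> borel_measurable borel" "sqnorm lborel f < \<infinity>"
    "\<And>z. F z = (LINT x|lborel. A z x * f x)"
proof -
  define S :: "nat \<Rightarrow> 'z set" where "S n = cball 0 (real n)" for n
  have S_sets[measurable]: "S n \<in> sets borel" for n by (simp add: S_def)
  have S_fin: "emeasure lborel (S n) < \<infinity>" for n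
    unfolding S_def by (rule emeasure_lborel_cball_finite)
  have S_ev: "eventually (\<lambda>n. z \<in> S n) sequentially" for z
  proof -
    obtain n0 where "norm z \<le> real n0" using real_arch_simple by blast
    then show ?thesis by (auto simp: S_def eventually_sequentially intro!: exI[of _ n0])
  qed
  define G where "G n z = indicator (S n) z * F z" for n z
  have G[measurable]: "G n \<in> borel_measurable borel" for n unfolding G_def[abs_def] by measurable
  have Gi: "integrable lborel (G n)" for n
    unfolding G_def[abs_def] using fin S_fin by (intro integrable_truncate) auto
  have Gf: "sqnorm lborel (G n) < \<infinity>" for n
    unfolding G_def[abs_def] using sqnorm_truncate_le fin le_less_trans by blast
  have Glim: "(\<lambda>n. sqnorm lborel (\<lambda>z. G n z - F z)) \<longlonglongrightarrow> 0"
    unfolding G_def[abs_def] by (rule sqnorm_truncate_tendsto) (use fin S_ev in auto)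
  have bound: "sqnorm lborel (\<lambda>x. synth (G m) x - synth (G n) x) \<le> ennreal (2 * C) * sqnorm lborel (\<lambda>z. G m z - G n z)" for m n
    unfolding synth_diff[OF Gi Gi, symmetric]
    by (rule sqnorm_synth_le) (auto intro!: Bochner_Integration.integrable_diff Gi sqnorm_diff_finite[unfolded infinity_ennreal_def] Gf[unfolded infinity_ennreal_def])
  obtain f where f[measurable]: "f \<in> borel_measurable lborel" and flim: "(\<lambda>n. sqnorm lborel (\<lambda>x. synth (G n) x - f x)) \<longlonglongrightarrow> 0"
    by (rule L2_bounded_image_limit[of "\<lambda>n. synth (G n)" lborel G lborel F, OF _ _ _ bound Glim]) auto
  have ffin: "sqnorm lborel f < \<infinity>"
    by (rule sqnorm_limit_finite[OF _ f sqnorm_synth_finite[OF Gi] flim]) measurable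
  have "F z = (LINT x|lborel. A z x * f x)" for z
  proof (rule LIMSEQ_unique)
    show "(\<lambda>n. LINT x|lborel. A z x * synth (G n) x) \<longlonglongrightarrow> (LINT x|lborel. A z x * f x)"
      by (rule L2_inner_tendsto[OF _ f _ sqnorm_synth_finite[OF Gi] ffin A_sqnorm_finite flim]) measurable
    have "(\<lambda>n. LINT z'|lborel. G n z' * gram z z') \<longlonglongrightarrow> (LINT z'|lborel. F z' * gram z z')"
    proof (rule integral_dominated_convergence[where w = "\<lambda>z'. cmod (F z' * gram z z')"])
      show "integrable lborel (\<lambda>z'. cmod (F z' * gram z z'))"
        by (intro integrable_norm integrable_gram fin) measurable
      show "AE z' in lborel. (\<lambda>n. G n z' * gram z z') \<longlonglongrightarrow> F z' * gram z z'"
      proof (rule AE_I2)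
        fix z' show "(\<lambda>n. G n z' * gram z z') \<longlonglongrightarrow> F z' * gram z z'"
          using S_ev[of z'] by (intro tendsto_eventually, eventually_elim) (simp add: G_def)
      qed
      show "AE z' in lborel. norm (G n z' * gram z z') \<le> cmod (F z' * gram z z')" for n
        by (auto simp: G_def indicator_def)
    qed measurable
    then show "(\<lambda>n. LINT x|lborel. A z x * synth (G n) x) \<longlonglongrightarrow> F z"
      unfolding analysis_synth[OF Gi] rep .
  qed
  then show ?thesis using ffin by (intro that[of f]) auto
qed

end

subsection \<open>The reproducing kernel and the Segal-Bargmann kernel\<close>

text \<open>The Gaussian is rotation invariant, so replacing \<open>K z\<close> by its mean over the
  circle through \<open>z\<close> leaves the integral unchanged, and that mean is
  \<open>K 0\<close>. The factor \<open>pi / \<nu>\<close> is the mass of the Gaussian.\<close>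

lemma gaussian_mean_value:
  assumes \<nu>: "\<nu> > 0" and K: "K holomorphic_on UNIV"
    and int: "integrable lborel (\<lambda>z. K z * of_real (exp (- \<nu> * (cmod z)\<^sup>2)))"
  shows "(LINT z|lborel. K z * of_real (exp (- \<nu> * (cmod z)\<^sup>2))) = of_real (pi / \<nu>) * K 0"
proof -
  have Km[measurable]: "K \<in> borel_measurable borel"
    using K by (intro borel_measurable_continuous_onI holomorphic_on_imp_continuous_on)
  define e where "e t = exp (2 * of_real pi * \<i> * complex_of_real t)" for t
  have e[measurable]: "e \<in> borel_measurable borel"
    unfolding e_def[abs_def] by (intro borel_measurable_continuous_onI continuous_intros)
  have e1: "cmod (e t) = 1" for t
    unfolding e_def norm_exp_eq_Re by simp
  define w where "w z = exp (- \<nu> * (cmod z)\<^sup>2)" for z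
  have w[measurable]: "w \<in> borel_measurable borel" unfolding w_def[abs_def] by measurable
  have we: "w (e t * z) = w z" for t z by (simp add: w_def norm_mult e1)
  have rot: "(LINT z|lborel. K (e t * z) * of_real (w z)) = (LINT z|lborel. K z * of_real (w z))" for t
    by (subst (2) lborel_distr_rotate[OF e1[of t], symmetric], subst integral_distr) (auto simp: we)
  \<comment> \<open>The angle runs over an interval of length one, so averaging becomes a double
    integral; rotation invariance for nonnegative functions shows that it converges
    absolutely.\<close>
  define F where "F t z = indicat_real {0..1} t *\<^sub>R (K (e t * z) * of_real (w z))" for t z
  have Fm[measurable]: "(\<lambda>p. F (fst p) (snd p)) \<in> borel_measurable (lborel \<Otimes>\<^sub>M lborel)"
    unfolding F_def by measurable
  have "(\<integral>\<^sup>+p. ennreal (norm (F (fst p) (snd p))) \<partial>(lborel \<Otimes>\<^sub>M lborel))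
     = (\<integral>\<^sup>+t. indicator {0..1} t * (\<integral>\<^sup>+z. ennreal (cmod (K (e t * z)) * w (e t * z)) \<partial>lborel) \<partial>lborel)"
    by (subst lborel.nn_integral_fst[symmetric], measurable, subst nn_integral_cmult[symmetric])
       (auto intro!: nn_integral_cong simp: F_def norm_mult w_def indicator_def e1)
  also have "\<dots> = (\<integral>\<^sup>+t. indicator {0..1::real} t * (\<integral>\<^sup>+z. ennreal (cmod (K z) * w z) \<partial>lborel) \<partial>lborel)"
    by (intro nn_integral_cong arg_cong2[where f = "(*)"] refl nn_integral_rotate e1) measurable
  also have "\<dots> = (\<integral>\<^sup>+z. ennreal (cmod (K z) * w z) \<partial>lborel)"
    by (subst nn_integral_multc) auto
  also have "\<dots> < \<infinity>"
    using int by (simp add: integrable_iff_bounded norm_mult w_def)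
  finally have "integrable (lborel \<Otimes>\<^sub>M lborel) (\<lambda>p. F (fst p) (snd p))"
    by (intro integrableI_bounded Fm)
  then have "(LINT z|lborel. LINT t|lborel. F t z) = (LINT t|lborel. LINT z|lborel. F t z)"
    by (intro lborel_pair.Fubini_integral) (simp add: case_prod_beta')
  moreover have "(LINT z|lborel. F t z) = indicator {0..1} t *\<^sub>R (LINT z|lborel. K z * of_real (w z))" for t
    unfolding F_def integral_scaleR_right rot by simp
  moreover have "(LINT t|lborel. F t z) = K 0 * of_real (w z)" for z
  proof -
    have "(LINT t|lborel. F t z) = (LINT t:{0..1}|lborel. K (e t * z)) * of_real (w z)"
      unfolding F_def mult_scaleR_left[symmetric] set_lebesgue_integral_def integral_mult_left_zero ..
    then show ?thesis using circle_mean_value[OF K, of z] by (simp add: e_def)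
  qed
  moreover have "(LINT z|lborel. complex_of_real (w z)) = of_real (pi / \<nu>)"
  proof -
    have "(LINT z|lborel. w z) = enn2real (\<integral>\<^sup>+z. ennreal (w z) \<partial>lborel)"
      by (rule integral_eq_nn_integral) (auto simp: w_def)
    also have "\<dots> = pi / \<nu>"
      using \<nu> unfolding w_def nn_integral_gaussian_complex[OF \<nu>] by simp
    finally show ?thesis by (simp add: integral_complex_of_real)
  qed
  ultimately show ?thesis
    unfolding w_def by (simp add: mult.commute)
qed

text \<open>The square root of the Gaussian weight: multiplication by it maps \<open>L2w \<nu>\<close> to \<open>L\<^sup>2\<close>.\<close>

definition wt :: "real \<Rightarrow> 'a::euclidean_space \<Rightarrow> complex" where
  "wt \<nu> x = of_real (exp (- (\<nu> / 2) * (norm x)\<^sup>2))"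

lemma wt_measurable [measurable]: "wt \<nu> \<in> borel_measurable borel"
  unfolding wt_def[abs_def] by measurable

lemma wt_Pair: "wt \<nu> p = wt \<nu> (fst p) * wt \<nu> (snd p)"
  unfolding wt_def by (cases p) (simp add: norm_Pair algebra_simps flip: of_real_mult exp_add)

lemma wt_nonzero [simp]: "wt \<nu> x \<noteq> 0"
  by (simp add: wt_def)

lemma wt_squared: "(cmod (f x * wt \<nu> x))\<^sup>2 = (cmod (f x))\<^sup>2 * exp (- \<nu> * (norm x)\<^sup>2)"
  by (simp add: wt_def norm_mult power_mult_distrib power2_eq_square[of "exp _"] flip: exp_add)

lemma L2w_iff:
  "f \<in> L2w \<nu> \<longleftrightarrow> f \<in> borel_measurable borel \<and> sqnorm lborel (\<lambda>x. f x * wt \<nu> x) < \<infinity>"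
proof -
  have "integrable lborel (\<lambda>x. (cmod (f x))\<^sup>2 * exp (- \<nu> * (norm x)\<^sup>2)) \<longleftrightarrow> sqnorm lborel (\<lambda>x. f x * wt \<nu> x) < \<infinity>"
    if [measurable]: "f \<in> borel_measurable borel"
    unfolding integrable_iff_bounded sqnorm_def wt_squared by auto
  then show ?thesis unfolding L2w_def by auto
qed

lemma L2w_I:
  assumes "u \<in> borel_measurable borel" "sqnorm lborel u < \<infinity>" "\<And>x. u x = f x * wt \<nu> x"
  shows "f \<in> L2w \<nu>"
proof -
  have "f = (\<lambda>x. u x / wt \<nu> x)" using assms(3) by (auto simp: fun_eq_iff)
  then have "f \<in> borel_measurable borel" using assms(1) by simp
  moreover have "u = (\<lambda>x. f x * wt \<nu> x)" using assms(3) by auto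
  ultimately show ?thesis using assms(2) by (simp add: L2w_iff)
qed

text \<open>The Bergman kernel of the Fock space with half of the weight attached to each variable;
  it reproduces \<open>F z * wt \<nu> z\<close> instead of \<open>F z\<close>.\<close>

definition fock_kernel :: "real \<Rightarrow> complex \<Rightarrow> complex \<Rightarrow> complex" where
  "fock_kernel \<nu> z z' = of_real (\<nu> / pi) * exp (of_real \<nu> * z * cnj z') * wt \<nu> z * wt \<nu> z'"

lemma cnj_mult_self: "z * cnj z = of_real ((cmod z)\<^sup>2)"
  by (metis complex_norm_square)

text \<open>\<open>Re (z * cnj z')\<close> minus half of both squared moduli is minus half of the
  squared distance. The modulus is therefore translation invariant, which is why Schur's test
  succeeds.\<close>

lemma cmod_fock_kernel:
  assumes "\<nu> > 0"
  shows "cmod (fock_kernel \<nu> z z') = \<nu> / pi * exp (- (\<nu> / 2) * (cmod (z - z'))\<^sup>2)"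
proof -
  have "\<nu> * Re (z * cnj z') + - (\<nu> / 2) * (cmod z)\<^sup>2 + - (\<nu> / 2) * (cmod z')\<^sup>2 = - (\<nu> / 2) * (cmod (z - z'))\<^sup>2"
    unfolding cmod_power2 by (simp add: algebra_simps power2_eq_square)
  moreover have "Re (of_real \<nu> * z * cnj z') = \<nu> * Re (z * cnj z')" by (simp add: algebra_simps)
  ultimately show ?thesis
    using assms unfolding fock_kernel_def wt_def norm_mult norm_exp_eq_Re norm_of_real abs_exp_cancel mult.assoc mult_exp_exp
    by (simp add: add.assoc)
qed

lemma nn_integral_lborel_translate:
  fixes a :: "'a::euclidean_space"
  assumes [measurable]: "f \<in> borel_measurable borel"
  shows "(\<integral>\<^sup>+z. f (a + z) \<partial>lborel) = (\<integral>\<^sup>+z. f z \<partial>lborel)"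
  by (subst (2) lborel_distr_plus[of a, symmetric], subst nn_integral_distr) auto

text \<open>The exponent carries \<open>\<nu> / 2\<close> while the prefactor is normalised for
  \<open>\<nu>\<close>; the quotient is the value 2.\<close>

lemma fock_kernel_row:
  assumes "\<nu> > 0"
  shows "(\<integral>\<^sup>+z'. ennreal (cmod (fock_kernel \<nu> z z')) \<partial>lborel) = 2"
proof -
  have "(\<integral>\<^sup>+z'. ennreal (cmod (fock_kernel \<nu> z z')) \<partial>lborel)
     = (\<integral>\<^sup>+z'. ennreal (\<nu> / pi) * ennreal (exp (- (\<nu> / 2) * (cmod (z - (z + z')))\<^sup>2)) \<partial>lborel)"
    unfolding cmod_fock_kernel[OF assms]
    using assms by (subst nn_integral_lborel_translate[of _ z, symmetric]) (measurable, simp only: ennreal_mult' zero_le_divide_iff less_imp_le pi_ge_zero simp_thms)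
  also have "\<dots> = ennreal (\<nu> / pi) * ennreal (pi / (\<nu> / 2))"
    using assms nn_integral_gaussian_complex[of "\<nu> / 2"] by (simp add: nn_integral_cmult)
  also have "\<dots> = 2"
    using assms by (simp flip: ennreal_mult')
  finally show ?thesis .
qed

lemma holomorphic_measurable:
  "F holomorphic_on UNIV \<Longrightarrow> F \<in> borel_measurable borel"
  by (intro borel_measurable_continuous_onI holomorphic_on_imp_continuous_on)

text \<open>Translation by \<open>a\<close> moves the claim to the origin, where
  \<open>gaussian_mean_value\<close> applies. Integrability of the product is assumed in place of
  membership in \<open>fock1 \<nu>\<close>, since the lemma must also serve slices of functions of
  two variables and Fock functions multiplied by an exponential.\<close>

lemma fock_reproducing:
  assumes \<nu>: "\<nu> > 0" and F: "F holomorphic_on UNIV"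
    and int: "integrable lborel (\<lambda>z. F z * wt \<nu> z * fock_kernel \<nu> a z)"
  shows "(LINT z|lborel. F z * wt \<nu> z * fock_kernel \<nu> a z) = F a * wt \<nu> a"
proof -
  note [measurable] = holomorphic_measurable[OF F]
  define c where "c = of_real (\<nu> / pi) * wt \<nu> a"
  \<comment> \<open>After the translation the terms with \<open>a * cnj z\<close> cancel: the
    weights and the kernel combine to the centred Gaussian times a holomorphic exponential.\<close>
  define K where "K z = c * (F (a + z) * exp (- of_real \<nu> * cnj a * z))" for z
  have e: "F (a + z) * wt \<nu> (a + z) * fock_kernel \<nu> a (a + z) = K z * of_real (exp (- \<nu> * (cmod z)\<^sup>2))" for z
  proof -
    have "wt \<nu> (a + z) * wt \<nu> (a + z) * exp (of_real \<nu> * a * cnj (a + z))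
       = exp (- of_real \<nu> * ((a + z) * cnj (a + z)) + of_real \<nu> * a * cnj (a + z))"
      unfolding wt_def cnj_mult_self exp_of_real[symmetric] mult_exp_exp
      by (rule arg_cong[where f = exp]) (simp add: field_simps)
    also have "\<dots> = exp (- of_real \<nu> * cnj a * z) * exp (- of_real \<nu> * (z * cnj z))"
      unfolding mult_exp_exp by (rule arg_cong[where f = exp]) (simp add: algebra_simps)
    also have "exp (- of_real \<nu> * (z * cnj z)) = of_real (exp (- \<nu> * (cmod z)\<^sup>2))"
      unfolding cnj_mult_self by (simp flip: exp_of_real)
    finally show ?thesis
      unfolding K_def c_def fock_kernel_def by (simp add: mult_ac)
  qed
  have Kh: "K holomorphic_on UNIV"
    unfolding K_def[abs_def]
    by (intro holomorphic_intros holomorphic_on_compose_gen[OF _ F, unfolded o_def]) auto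
  have wtm: "(\<lambda>z. F z * wt \<nu> z * fock_kernel \<nu> a z) \<in> borel_measurable borel"
    using int by auto
  have "integrable lborel (\<lambda>z. F (a + z) * wt \<nu> (a + z) * fock_kernel \<nu> a (a + z))"
    using int wtm by (subst (asm) lborel_distr_plus[of a, symmetric], subst (asm) integrable_distr_eq) auto
  then have "(LINT z|lborel. K z * of_real (exp (- \<nu> * (cmod z)\<^sup>2))) = of_real (pi / \<nu>) * K 0"
    unfolding e by (rule gaussian_mean_value[OF \<nu> Kh])
  moreover have "(LINT z|lborel. F z * wt \<nu> z * fock_kernel \<nu> a z)
    = (LINT z|lborel. F (a + z) * wt \<nu> (a + z) * fock_kernel \<nu> a (a + z))"
    using wtm by (subst lborel_distr_plus[of a, symmetric], subst integral_distr) auto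
  ultimately have "(LINT z|lborel. F z * wt \<nu> z * fock_kernel \<nu> a z) = of_real (pi / \<nu>) * K 0"
    unfolding e by simp
  also have "\<dots> = of_real (pi / \<nu> * (\<nu> / pi)) * (F a * wt \<nu> a)"
    unfolding K_def c_def of_real_mult by simp
  also have "pi / \<nu> * (\<nu> / pi) = 1" using \<nu> by simp
  finally show ?thesis by simp
qed

section \<open>Product integrals and the Segal-Bargmann kernel\<close>

lemma has_bochner_integral_lborel_prod:
  fixes f :: "'a::euclidean_space \<Rightarrow> complex" and g :: "'b::euclidean_space \<Rightarrow> complex"
  assumes "has_bochner_integral lborel f a" "has_bochner_integral lborel g b"
  shows "has_bochner_integral lborel (\<lambda>p. f (fst p) * g (snd p)) (a * b)"
proof -
  have [measurable]: "f \<in> borel_measurable borel" "g \<in> borel_measurable borel"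
    using assms by (auto simp: has_bochner_integral_iff)
  have "(\<integral>\<^sup>+p. ennreal (norm (f (fst p) * g (snd p))) \<partial>(lborel \<Otimes>\<^sub>M lborel))
     = (\<integral>\<^sup>+x. ennreal (norm (f x)) * (\<integral>\<^sup>+y. ennreal (norm (g y)) \<partial>lborel) \<partial>lborel)"
    by (subst lborel.nn_integral_fst[symmetric], measurable, subst nn_integral_cmult[symmetric])
       (auto simp: norm_mult ennreal_mult)
  also have "\<dots> = (\<integral>\<^sup>+x. ennreal (norm (f x)) \<partial>lborel) * (\<integral>\<^sup>+y. ennreal (norm (g y)) \<partial>lborel)"
    by (rule nn_integral_multc) measurable
  also have "\<dots> < \<infinity>"
    using assms by (simp add: has_bochner_integral_iff integrable_iff_bounded ennreal_mult_less_top)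
  finally have i: "integrable (lborel \<Otimes>\<^sub>M lborel) (\<lambda>p. f (fst p) * g (snd p))"
    by (intro integrableI_bounded) measurable
  have "(LINT p|(lborel \<Otimes>\<^sub>M lborel). f (fst p) * g (snd p)) = (LINT x|lborel. LINT y|lborel. f x * g y)"
    using lborel_pair.integral_fst'[OF i] by simp
  also have "\<dots> = a * b"
    using assms by (simp add: has_bochner_integral_iff)
  finally show ?thesis using i by (simp add: has_bochner_integral_iff lborel_prod)
qed

lemma nn_integral_lborel_prod_mult:
  fixes f :: "'a::euclidean_space \<Rightarrow> ennreal" and g :: "'b::euclidean_space \<Rightarrow> ennreal"
  assumes [measurable]: "f \<in> borel_measurable borel" "g \<in> borel_measurable borel"
  shows "(\<integral>\<^sup>+p. f (fst p) * g (snd p) \<partial>lborel) = (\<integral>\<^sup>+x. f x \<partial>lborel) * (\<integral>\<^sup>+y. g y \<partial>lborel)"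
proof -
  have "(\<integral>\<^sup>+p. f (fst p) * g (snd p) \<partial>lborel) = (\<integral>\<^sup>+p. f (fst p) * g (snd p) \<partial>(lborel \<Otimes>\<^sub>M lborel))"
    by (simp add: lborel_prod)
  also have "\<dots> = (\<integral>\<^sup>+x. \<integral>\<^sup>+y. f x * g y \<partial>lborel \<partial>lborel)"
    by (subst lborel.nn_integral_fst[symmetric]) auto
  also have "\<dots> = (\<integral>\<^sup>+x. f x \<partial>lborel) * (\<integral>\<^sup>+y. g y \<partial>lborel)"
    by (simp add: nn_integral_cmult nn_integral_multc)
  finally show ?thesis .
qed

lemma sqnorm_eq_integral:
  assumes "has_bochner_integral M (\<lambda>x. f x * cnj (f x)) (of_real c)"
  shows "sqnorm M f = ennreal c"
proof -
  have "has_bochner_integral M (\<lambda>x. (cmod (f x))\<^sup>2) c"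
    using assms unfolding cnj_mult_self has_bochner_integral_iff complex_of_real_integrable_eq integral_complex_of_real
    by simp
  then show ?thesis
    unfolding sqnorm_def has_bochner_integral_iff by (subst nn_integral_eq_integral) auto
qed

lemma complex_sqrt2_square: "complex_of_real (sqrt 2) * of_real (sqrt 2) = 2"
  unfolding of_real_mult[symmetric] by simp

text \<open>
  One of the two factors \<open>wt \<nu> x\<close> of the Gaussian weight is split off from the kernel of the
  Segal-Bargmann transform, see \<open>sb_kernel_eq\<close>; it belongs to the function \<open>f\<close>.
\<close>

definition sb_kernel :: "real \<Rightarrow> complex \<Rightarrow> real \<Rightarrow> complex" where
  "sb_kernel \<nu> z x = exp (of_real \<nu> * (of_real (sqrt 2) * z * of_real x - (of_real x)\<^sup>2 / 2 - z\<^sup>2 / 2))"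

lemma continuous_sb_kernel: "continuous_on UNIV (\<lambda>p. sb_kernel \<nu> (fst p) (snd p))"
  unfolding sb_kernel_def by (auto intro!: continuous_intros)

lemma sb_kernel_measurable [measurable]: "sb_kernel \<nu> z \<in> borel_measurable borel"
  unfolding sb_kernel_def[abs_def] by (auto intro!: borel_measurable_continuous_onI continuous_intros)

lemma sb_kernel_eq:
  "exp (- of_real \<nu> * (of_real x - z / of_real (sqrt 2))\<^sup>2) = wt \<nu> x * sb_kernel \<nu> z x"
proof -
  have "z / of_real (sqrt 2) = of_real (sqrt 2) * z / (of_real (sqrt 2) * of_real (sqrt 2))"
    by simp
  also have "\<dots> = of_real (sqrt 2) * z / 2" unfolding complex_sqrt2_square ..
  finally have zz: "z / of_real (sqrt 2) = of_real (sqrt 2) * z / 2" .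
  have "(of_real x - z / of_real (sqrt 2))\<^sup>2
     = (of_real x)\<^sup>2 - of_real (sqrt 2) * z * of_real x + (of_real (sqrt 2) * of_real (sqrt 2)) * z\<^sup>2 / 4"
    unfolding zz by (simp add: power2_eq_square algebra_simps)
  then have q: "(of_real x - z / of_real (sqrt 2))\<^sup>2 = (of_real x)\<^sup>2 - of_real (sqrt 2) * z * of_real x + z\<^sup>2 / 2"
    unfolding complex_sqrt2_square by simp
  show ?thesis
    unfolding q wt_def sb_kernel_def exp_of_real[symmetric] mult_exp_exp
    by (intro arg_cong[where f = exp]) (simp add: algebra_simps)
qed

lemma segal_bargmann1_eq:
  "segal_bargmann1 \<nu> f z =
     of_real ((\<nu> / pi) powr (3 / 4)) * (LINT x|lborel. f x * wt \<nu> x * sb_kernel \<nu> z x)"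
  unfolding segal_bargmann1_def sb_kernel_eq by (simp add: mult.assoc)

lemma segal_bargmann2_eq:
  "segal_bargmann2 \<nu> f p =
     of_real ((\<nu> / pi) powr (3 / 2)) *
       (LINT x|lborel. f x * wt \<nu> x * (sb_kernel \<nu> (fst p) (fst x) * sb_kernel \<nu> (snd p) (snd x)))"
  unfolding segal_bargmann2_def distrib_left exp_add sb_kernel_eq wt_Pair by (simp add: mult_ac)

definition weighted_sb_kernel :: "real \<Rightarrow> complex \<Rightarrow> real \<Rightarrow> complex" where
  "weighted_sb_kernel \<nu> z x = of_real ((\<nu> / pi) powr (3 / 4)) * sb_kernel \<nu> z x * wt \<nu> z"

text \<open>The Gaussian integral over \<open>x\<close> contributes
  \<open>\<nu> / 2 * (z + cnj z')^2\<close> to the exponent; the factors free of \<open>x\<close>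
  remove the two squares and leave the cross term \<open>\<nu> * z * cnj z'\<close>. The exponent
  3/4 fits because the square of that power times \<open>sqrt (pi / \<nu>)\<close> is
  \<open>\<nu> / pi\<close>.\<close>

lemma weighted_sb_kernel_gram:
  assumes \<nu>: "\<nu> > 0"
  shows "has_bochner_integral lborel (\<lambda>x. weighted_sb_kernel \<nu> z x * cnj (weighted_sb_kernel \<nu> z' x)) (fock_kernel \<nu> z z')"
proof -
  define c where "c = ((\<nu> / pi) powr (3 / 4))\<^sup>2"
  have c: "c * sqrt (pi / \<nu>) = \<nu> / pi"
  proof -
    have c1: "c = (\<nu> / pi) powr (3 / 2)"
      unfolding c_def using \<nu> by (simp add: powr_powr flip: powr_numeral)
    have c2: "sqrt (pi / \<nu>) = (\<nu> / pi) powr (- (1 / 2))"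
      using \<nu> by (simp add: powr_minus powr_half_sqrt real_sqrt_divide)
    show ?thesis
      unfolding c1 c2 using \<nu> by (simp flip: powr_add)
  qed
  define d where "d = of_real c * exp (- of_real (\<nu> / 2) * (z\<^sup>2 + (cnj z')\<^sup>2)) * wt \<nu> z * wt \<nu> z'"
  have "has_bochner_integral lborel
     (\<lambda>x. d * exp (of_real \<nu> * of_real (sqrt 2) * (z + cnj z') * of_real x - of_real \<nu> * (of_real x)\<^sup>2))
     (d * (of_real (sqrt (pi / \<nu>)) * exp ((of_real \<nu> * of_real (sqrt 2) * (z + cnj z'))\<^sup>2 / (4 * of_real \<nu>))))"
    by (intro has_bochner_integral_mult_right gaussian_integral \<nu>)
  also have "(\<lambda>x. d * exp (of_real \<nu> * of_real (sqrt 2) * (z + cnj z') * of_real x - of_real \<nu> * (of_real x)\<^sup>2))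
     = (\<lambda>x. weighted_sb_kernel \<nu> z x * cnj (weighted_sb_kernel \<nu> z' x))"
  proof
    fix x
    have cw: "cnj (wt \<nu> z') = wt \<nu> z'" by (simp add: wt_def)
    have "sb_kernel \<nu> z x * cnj (sb_kernel \<nu> z' x) = exp (- of_real (\<nu> / 2) * (z\<^sup>2 + (cnj z')\<^sup>2)) *
        exp (of_real \<nu> * of_real (sqrt 2) * (z + cnj z') * of_real x - of_real \<nu> * (of_real x)\<^sup>2)"
      unfolding sb_kernel_def exp_cnj mult_exp_exp
      by (rule arg_cong[where f = exp]) (simp add: field_simps)
    then show "d * exp (of_real \<nu> * of_real (sqrt 2) * (z + cnj z') * of_real x - of_real \<nu> * (of_real x)\<^sup>2)
      = weighted_sb_kernel \<nu> z x * cnj (weighted_sb_kernel \<nu> z' x)"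
      unfolding weighted_sb_kernel_def d_def c_def by (simp add: cw power2_eq_square mult_ac)
  qed
  also have "d * (of_real (sqrt (pi / \<nu>)) * exp ((of_real \<nu> * of_real (sqrt 2) * (z + cnj z'))\<^sup>2 / (4 * of_real \<nu>)))
     = of_real (c * sqrt (pi / \<nu>)) * (exp (- of_real (\<nu> / 2) * (z\<^sup>2 + (cnj z')\<^sup>2)) *
        exp ((of_real \<nu> * of_real (sqrt 2) * (z + cnj z'))\<^sup>2 / (4 * of_real \<nu>))) * wt \<nu> z * wt \<nu> z'"
    unfolding d_def by (simp add: mult_ac)
  also have "exp (- of_real (\<nu> / 2) * (z\<^sup>2 + (cnj z')\<^sup>2)) *
        exp ((of_real \<nu> * of_real (sqrt 2) * (z + cnj z'))\<^sup>2 / (4 * of_real \<nu>)) = exp (of_real \<nu> * z * cnj z')"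
  proof -
    have "(of_real \<nu> * of_real (sqrt 2) * (z + cnj z'))\<^sup>2 / (4 * of_real \<nu>)
      = of_real \<nu> * (of_real (sqrt 2) * of_real (sqrt 2)) * (z + cnj z')\<^sup>2 / 4"
      using \<nu> by (simp add: power2_eq_square)
    also have "\<dots> = of_real (\<nu> / 2) * (z + cnj z')\<^sup>2"
      unfolding complex_sqrt2_square by simp
    finally show ?thesis
      unfolding mult_exp_exp by (intro arg_cong[where f = exp]) (simp add: field_simps power2_eq_square)
  qed
  finally show ?thesis
    unfolding c fock_kernel_def .
qed

text \<open>The weight of \<open>z\<close> cancels the growth in \<open>Im z\<close> and completes
  the square, leaving a Gaussian in \<open>x - sqrt 2 * Re z\<close>.\<close>

lemma cmod_weighted_sb_kernel_le:
  assumes \<nu>: "\<nu> > 0"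
  shows "cmod (weighted_sb_kernel \<nu> z x) \<le> (\<nu> / pi) powr (3 / 4)"
proof -
  have "cmod (sb_kernel \<nu> z x * wt \<nu> z) = exp (- (\<nu> / 2) * (x - sqrt 2 * Re z)\<^sup>2)"
    unfolding sb_kernel_def wt_def norm_mult norm_exp_eq_Re norm_of_real abs_exp_cancel mult_exp_exp cmod_power2
    by (rule arg_cong[where f = exp]) (simp add: power2_eq_square field_simps)
  also have "\<dots> \<le> 1" using \<nu> by simp
  finally have "(\<nu> / pi) powr (3 / 4) * cmod (sb_kernel \<nu> z x * wt \<nu> z) \<le> (\<nu> / pi) powr (3 / 4) * 1"
    by (rule mult_left_mono) simp
  then show ?thesis unfolding weighted_sb_kernel_def by (simp add: norm_mult mult.assoc)
qed

text \<open>The constant \<open>\<nu> / pi\<close> is the Fock kernel on the diagonal, and 2 is its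
  row integral.\<close>

lemma L2_kernel_weighted_sb_kernel:
  assumes \<nu>: "\<nu> > 0"
  shows "L2_kernel (weighted_sb_kernel \<nu>) ((\<nu> / pi) powr (3 / 4)) (\<nu> / pi) 2"
proof
  show "(\<lambda>p. weighted_sb_kernel \<nu> (fst p) (snd p)) \<in> borel_measurable borel"
    unfolding weighted_sb_kernel_def
    by (intro borel_measurable_continuous_onI continuous_intros continuous_sb_kernel) (auto simp: wt_def intro!: continuous_intros)
  show "sqnorm lborel (weighted_sb_kernel \<nu> z) \<le> ennreal (\<nu> / pi)" for z
  proof -
    have "exp (of_real \<nu> * z * cnj z) * (wt \<nu> z * wt \<nu> z)
       = of_real (exp (\<nu> * (cmod z)\<^sup>2 + (- (\<nu> / 2) * (cmod z)\<^sup>2 + - (\<nu> / 2) * (cmod z)\<^sup>2)))"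
      unfolding wt_def mult.assoc[of _ z] cnj_mult_self exp_add of_real_mult by (simp only: of_real_mult[symmetric] exp_of_real)
    also have "\<nu> * (cmod z)\<^sup>2 + (- (\<nu> / 2) * (cmod z)\<^sup>2 + - (\<nu> / 2) * (cmod z)\<^sup>2) = 0"
      by simp
    finally have "exp (of_real \<nu> * z * cnj z) * (wt \<nu> z * wt \<nu> z) = 1" by simp
    then have "fock_kernel \<nu> z z = of_real (\<nu> / pi)"
      unfolding fock_kernel_def mult.assoc by simp
    then have "sqnorm lborel (weighted_sb_kernel \<nu> z) = ennreal (\<nu> / pi)"
      using weighted_sb_kernel_gram[OF \<nu>, of z z] by (intro sqnorm_eq_integral) (simp only:)
    then show ?thesis by simp
  qed
  show "(\<integral>\<^sup>+z'. ennreal (cmod (LINT x|lborel. weighted_sb_kernel \<nu> z x * cnj (weighted_sb_kernel \<nu> z' x))) \<partial>lborel) \<le> ennreal 2" for z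
    unfolding has_bochner_integral_integral_eq[OF weighted_sb_kernel_gram[OF \<nu>]] fock_kernel_row[OF \<nu>] by simp
qed (rule cmod_weighted_sb_kernel_le[OF \<nu>])

text \<open>Gram integrals and bounds of a product kernel factor, so the transform in dimension two
  inherits its estimates from dimension one.\<close>

lemma L2_kernel_tensor:
  assumes "L2_kernel A b c C" "L2_kernel A' b' c' C'" "0 \<le> c" "0 \<le> C"
  shows "L2_kernel (\<lambda>p x. A (fst p) (fst x) * A' (snd p) (snd x)) (b * b') (c * c') (C * C')"
    and "(LINT x|lborel. (A (fst p) (fst x) * A' (snd p) (snd x)) * cnj (A (fst q) (fst x) * A' (snd q) (snd x)))
      = L2_kernel.gram A (fst p) (fst q) * L2_kernel.gram A' (snd p) (snd q)"
proof -
  interpret A: L2_kernel A b c C by fact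
  interpret A': L2_kernel A' b' c' C' by fact
  have gram: "(LINT x|lborel. (A (fst p) (fst x) * A' (snd p) (snd x)) * cnj (A (fst q) (fst x) * A' (snd q) (snd x)))
      = A.gram (fst p) (fst q) * A'.gram (snd p) (snd q)" for p q
  proof -
    have "has_bochner_integral lborel (\<lambda>x. A (fst p) x * cnj (A (fst q) x)) (A.gram (fst p) (fst q))"
      unfolding has_bochner_integral_iff A.gram_def using A.A_sqnorm_finite
      by (auto intro!: integrable_mult_sqnorm simp: sqnorm_def)
    moreover have "has_bochner_integral lborel (\<lambda>x. A' (snd p) x * cnj (A' (snd q) x)) (A'.gram (snd p) (snd q))"
      unfolding has_bochner_integral_iff A'.gram_def using A'.A_sqnorm_finite
      by (auto intro!: integrable_mult_sqnorm simp: sqnorm_def)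
    ultimately have "has_bochner_integral lborel
      (\<lambda>x. A (fst p) (fst x) * cnj (A (fst q) (fst x)) * (A' (snd p) (snd x) * cnj (A' (snd q) (snd x))))
      (A.gram (fst p) (fst q) * A'.gram (snd p) (snd q))"
      by (rule has_bochner_integral_lborel_prod)
    then show ?thesis by (simp add: has_bochner_integral_iff mult_ac)
  qed
  then show "(LINT x|lborel. (A (fst p) (fst x) * A' (snd p) (snd x)) * cnj (A (fst q) (fst x) * A' (snd q) (snd x)))
      = A.gram (fst p) (fst q) * A'.gram (snd p) (snd q)" .
  show "L2_kernel (\<lambda>p x. A (fst p) (fst x) * A' (snd p) (snd x)) (b * b') (c * c') (C * C')"
  proof
    show "(\<lambda>p. A (fst (fst p)) (fst (snd p)) * A' (snd (fst p)) (snd (snd p))) \<in> borel_measurable borel"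
      by (intro borel_measurable_times A.A_measurable A'.A_measurable borel_measurable_continuous_onI continuous_intros)
    show "cmod (A (fst p) (fst x) * A' (snd p) (snd x)) \<le> b * b'" for p x
      unfolding norm_mult
      by (intro mult_mono A.A_bound A'.A_bound norm_ge_zero order_trans[OF norm_ge_zero A.A_bound])
    show "sqnorm lborel (\<lambda>x. A (fst p) (fst x) * A' (snd p) (snd x)) \<le> ennreal (c * c')" for p
    proof -
      have "sqnorm lborel (\<lambda>x. A (fst p) (fst x) * A' (snd p) (snd x)) = sqnorm lborel (A (fst p)) * sqnorm lborel (A' (snd p))"
        unfolding sqnorm_def by (subst nn_integral_lborel_prod_mult[symmetric])
          (auto simp: norm_mult power_mult_distrib ennreal_mult)
      also have "\<dots> \<le> ennreal c * ennreal c'"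
        by (intro mult_mono A.A_sqnorm A'.A_sqnorm) auto
      finally show ?thesis using \<open>0 \<le> c\<close> by (simp add: ennreal_mult')
    qed
    show "(\<integral>\<^sup>+q. ennreal (cmod (LINT x|lborel. (A (fst p) (fst x) * A' (snd p) (snd x)) *
        cnj (A (fst q) (fst x) * A' (snd q) (snd x)))) \<partial>lborel) \<le> ennreal (C * C')" for p
    proof -
      have "(\<integral>\<^sup>+q. ennreal (cmod (A.gram (fst p) (fst q) * A'.gram (snd p) (snd q))) \<partial>lborel)
        = (\<integral>\<^sup>+q. ennreal (cmod (A.gram (fst p) q)) \<partial>lborel) * (\<integral>\<^sup>+q. ennreal (cmod (A'.gram (snd p) q)) \<partial>lborel)"
        by (subst nn_integral_lborel_prod_mult[symmetric]) (auto simp: norm_mult ennreal_mult)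
      also have "\<dots> \<le> ennreal C * ennreal C'"
        using A.gram_bound A'.gram_bound unfolding A.gram_def A'.gram_def by (intro mult_mono) auto
      finally show ?thesis unfolding gram using \<open>0 \<le> C\<close> by (simp add: ennreal_mult')
    qed
  qed
qed

subsection \<open>Surjectivity and the Bergman projection\<close>

lemma fock1_iff:
  "F \<in> fock1 \<nu> \<longleftrightarrow> F holomorphic_on UNIV \<and> sqnorm lborel (\<lambda>z. F z * wt \<nu> z) < \<infinity>"
  unfolding fock1_def L2w_iff by (auto dest: holomorphic_measurable)

lemma L2_kernel_gram_weighted_sb_kernel:
  assumes "\<nu> > 0"
  shows "L2_kernel.gram (weighted_sb_kernel \<nu>) = fock_kernel \<nu>"
proof -
  interpret L2_kernel "weighted_sb_kernel \<nu>" "(\<nu> / pi) powr (3 / 4)" "\<nu> / pi" 2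
    by (rule L2_kernel_weighted_sb_kernel[OF assms])
  show ?thesis
    by (intro ext) (simp only: gram_def has_bochner_integral_integral_eq[OF weighted_sb_kernel_gram[OF assms]])
qed

lemma L2w_integrable_fock_kernel:
  assumes \<nu>: "\<nu> > 0" and f: "f \<in> L2w \<nu>"
  shows "integrable lborel (\<lambda>z. f z * wt \<nu> z * fock_kernel \<nu> a z)"
proof -
  interpret L2_kernel "weighted_sb_kernel \<nu>" "(\<nu> / pi) powr (3 / 4)" "\<nu> / pi" 2
    by (rule L2_kernel_weighted_sb_kernel[OF \<nu>])
  show ?thesis
    using f integrable_gram[of "\<lambda>z. f z * wt \<nu> z" a] unfolding L2_kernel_gram_weighted_sb_kernel[OF \<nu>] L2w_iff
    by (auto simp del: sets_lborel)
qed

lemma fock1_reproducing: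
  assumes "\<nu> > 0" "F \<in> fock1 \<nu>"
  shows "(LINT z|lborel. F z * wt \<nu> z * fock_kernel \<nu> a z) = F a * wt \<nu> a"
  using assms by (intro fock_reproducing L2w_integrable_fock_kernel) (auto simp: fock1_def)

lemma segal_bargmann1_surj:
  assumes \<nu>: "\<nu> > 0" and F: "F \<in> fock1 \<nu>"
  shows "F \<in> segal_bargmann1 \<nu> ` L2w \<nu>"
proof -
  interpret K: L2_kernel "weighted_sb_kernel \<nu>" "(\<nu> / pi) powr (3 / 4)" "\<nu> / pi" 2
    by (rule L2_kernel_weighted_sb_kernel[OF \<nu>])
  note gram = L2_kernel_gram_weighted_sb_kernel[OF \<nu>]
  have "F \<in> L2w \<nu>" using F by (simp add: fock1_def)
  then have Fm: "(\<lambda>z. F z * wt \<nu> z) \<in> borel_measurable borel" and fin: "sqnorm lborel (\<lambda>z. F z * wt \<nu> z) < \<infinity>"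
    by (auto simp: L2w_iff)
  obtain u where u: "u \<in> borel_measurable borel" "sqnorm lborel u < \<infinity>"
    and rep: "\<And>z. F z * wt \<nu> z = (LINT x|lborel. weighted_sb_kernel \<nu> z x * u x)"
    using K.analysis_surj[OF Fm fin] fock1_reproducing[OF \<nu> F] unfolding gram by blast
  define f where "f x = u x / wt \<nu> x" for x
  have fu: "f x * wt \<nu> x = u x" for x by (simp add: f_def)
  have "f \<in> L2w \<nu>" by (rule L2w_I[OF u]) (simp add: fu)
  moreover have "segal_bargmann1 \<nu> f z = F z" for z
  proof -
    have "weighted_sb_kernel \<nu> z x * u x = of_real ((\<nu> / pi) powr (3 / 4)) * wt \<nu> z * (u x * sb_kernel \<nu> z x)" for x
      by (simp add: weighted_sb_kernel_def)
    then have "F z * wt \<nu> z = of_real ((\<nu> / pi) powr (3 / 4)) * wt \<nu> z * (LINT x|lborel. u x * sb_kernel \<nu> z x)"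
      unfolding rep by (simp only: integral_mult_right_zero)
    also have "\<dots> = segal_bargmann1 \<nu> f z * wt \<nu> z"
      unfolding segal_bargmann1_eq fu by (simp only: mult_ac)
    finally have "F z * wt \<nu> z = segal_bargmann1 \<nu> f z * wt \<nu> z" .
    then show ?thesis by simp
  qed
  ultimately show ?thesis by (intro image_eqI[of _ _ f]) auto
qed

text \<open>Surjectivity is what gives \<open>inv_into\<close> a meaning here: whichever preimage it
  picks, the transform of that preimage is \<open>F\<close>.\<close>

lemma segal_bargmann1_inv:
  assumes "\<nu> > 0" "F \<in> fock1 \<nu>"
  shows "segal_bargmann1_inv \<nu> F \<in> L2w \<nu>" "segal_bargmann1 \<nu> (segal_bargmann1_inv \<nu> F) = F"
  unfolding segal_bargmann1_inv_def
  by (rule inv_into_into[OF segal_bargmann1_surj[OF assms]], rule f_inv_into_f[OF segal_bargmann1_surj[OF assms]])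

text \<open>Along a complex line the derivative acts on multiples of one direction, and complex
  linearity makes it multiplication by \<open>D (b, d)\<close>. Besides coordinate slices, the line
  traced by \<open>psi2\<close> is needed.\<close>

lemma entire2_holomorphic_line:
  assumes "entire2 F"
  shows "(\<lambda>t. F (a + t * b, c + t * d)) holomorphic_on UNIV"
  unfolding holomorphic_on_def
proof
  fix t
  obtain D where D: "(F has_derivative D) (at (a + t * b, c + t * d))" "\<And>c v. D (cscale2 c v) = c * D v"
    using assms unfolding entire2_def by blast
  have "((\<lambda>t. (a + t * b, c + t * d)) has_derivative (\<lambda>h. (h * b, h * d))) (at t)"
    by (auto intro!: derivative_eq_intros)
  from has_derivative_compose[OF this D(1)]
  have "((\<lambda>t. F (a + t * b, c + t * d)) has_derivative (\<lambda>h. D (h * b, h * d))) (at t)" .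
  also have "(\<lambda>h. D (h * b, h * d)) = (*) (D (b, d))"
  proof
    fix h show "D (h * b, h * d) = D (b, d) * h"
      using D(2)[of h "(b, d)"] by (simp add: cscale2_def mult.commute)
  qed
  finally show "(\<lambda>t. F (a + t * b, c + t * d)) field_differentiable at t within UNIV"
    unfolding field_differentiable_def has_field_derivative_def by auto
qed

lemma entire2_slices:
  assumes "entire2 F"
  shows "(\<lambda>z. F (z, w)) holomorphic_on UNIV" "(\<lambda>w. F (z, w)) holomorphic_on UNIV"
  using entire2_holomorphic_line[OF assms, of 0 1 w 0] entire2_holomorphic_line[OF assms, of z 0 0 1] by auto

text \<open>Reproduction in the second variable, then in the first. Fubini supplies integrable
  slices only for almost every \<open>z'\<close>; hence the inner identity holds almost everywhere,
  and the integrability of \<open>J\<close> is transferred through it.\<close>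

lemma fock2_reproducing:
  assumes \<nu>: "\<nu> > 0" and F: "entire2 F"
    and int: "integrable lborel (\<lambda>q. F q * wt \<nu> q * (fock_kernel \<nu> (fst p) (fst q) * fock_kernel \<nu> (snd p) (snd q)))"
  shows "(LINT q|lborel. F q * wt \<nu> q * (fock_kernel \<nu> (fst p) (fst q) * fock_kernel \<nu> (snd p) (snd q))) = F p * wt \<nu> p"
proof -
  define z w where "z = fst p" and "w = snd p"
  define I where "I q = F q * wt \<nu> q * (fock_kernel \<nu> z (fst q) * fock_kernel \<nu> w (snd q))" for q
  define J where "J z' = F (z', w) * wt \<nu> w * wt \<nu> z' * fock_kernel \<nu> z z'" for z'
  have Ii: "integrable (lborel \<Otimes>\<^sub>M lborel) I"
    using int unfolding I_def[abs_def] z_def w_def lborel_prod .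
  note [measurable] = holomorphic_measurable[OF entire2_slices(1)[OF F]]
  have [measurable]: "fock_kernel \<nu> z \<in> borel_measurable borel" for z
    unfolding fock_kernel_def[abs_def] by measurable
  have Jm: "J \<in> borel_measurable lborel"
    unfolding J_def[abs_def] by measurable
  have inner: "AE z' in lborel. (LINT w'|lborel. I (z', w')) = J z'"
    using lborel_pair.AE_integrable_fst'[OF Ii]
  proof eventually_elim
    fix z' assume i: "integrable lborel (\<lambda>w'. I (z', w'))"
    define G where "G w' = F (z', w') * (wt \<nu> z' * fock_kernel \<nu> z z')" for w'
    have e: "I (z', w') = G w' * wt \<nu> w' * fock_kernel \<nu> w w'" for w'
      by (simp add: I_def G_def wt_Pair[of \<nu> "(z', w')"] mult_ac)
    have "G holomorphic_on UNIV"
      unfolding G_def[abs_def] by (intro holomorphic_intros entire2_slices(2)[OF F])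
    from fock_reproducing[OF \<nu> this i[unfolded e]]
    show "(LINT w'|lborel. I (z', w')) = J z'"
      unfolding e by (simp add: G_def J_def mult_ac)
  qed
  have outer: "integrable lborel (\<lambda>z'. LINT w'|lborel. I (z', w'))"
    by (rule lborel_pair.integrable_fst'[OF Ii])
  then have outer_m: "(\<lambda>z'. LINT w'|lborel. I (z', w')) \<in> borel_measurable lborel" by auto
  have Ji: "integrable lborel J"
    using integrable_cong_AE[OF outer_m Jm inner] outer by simp
  have "(LINT q|lborel. I q) = (LINT z'|lborel. LINT w'|lborel. I (z', w'))"
    using lborel_pair.integral_fst'[OF Ii] by (simp add: lborel_prod)
  also have "\<dots> = (LINT z'|lborel. J z')"
    by (rule integral_cong_AE[OF outer_m Jm inner])
  also have "\<dots> = F (z, w) * wt \<nu> w * wt \<nu> z"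
    unfolding J_def
    by (rule fock_reproducing[OF \<nu> _ Ji[unfolded J_def[abs_def]]]) (intro holomorphic_intros entire2_slices(1)[OF F])
  finally show ?thesis
    by (simp add: I_def z_def w_def wt_Pair[of \<nu> p] mult_ac)
qed

lemma segal_bargmann2_surj:
  assumes \<nu>: "\<nu> > 0" and F: "F \<in> fock2 \<nu>"
  shows "F \<in> segal_bargmann2 \<nu> ` L2w \<nu>"
proof -
  let ?A = "\<lambda>p x. weighted_sb_kernel \<nu> (fst p) (fst x) * weighted_sb_kernel \<nu> (snd p) (snd x)"
  let ?b = "(\<nu> / pi) powr (3 / 4)"
  note K1 = L2_kernel_weighted_sb_kernel[OF \<nu>]
  have nn: "0 \<le> \<nu> / pi" "0 \<le> (2 :: real)" using \<nu> by auto
  interpret K: L2_kernel ?A "?b * ?b" "\<nu> / pi * (\<nu> / pi)" "2 * 2"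
    by (rule L2_kernel_tensor(1)[OF K1 K1 nn])
  have gram: "K.gram p q = fock_kernel \<nu> (fst p) (fst q) * fock_kernel \<nu> (snd p) (snd q)" for p q
    unfolding K.gram_def L2_kernel_tensor(2)[OF K1 K1 nn] L2_kernel_gram_weighted_sb_kernel[OF \<nu>] ..
  have ent: "entire2 F" and F': "F \<in> L2w \<nu>" using F by (auto simp: fock2_def)
  have Fm: "(\<lambda>p. F p * wt \<nu> p) \<in> borel_measurable borel" and fin: "sqnorm lborel (\<lambda>p. F p * wt \<nu> p) < \<infinity>"
    using F' by (auto simp: L2w_iff)
  have "(LINT q|lborel. F q * wt \<nu> q * K.gram p q) = F p * wt \<nu> p" for p
    using K.integrable_gram[OF Fm fin, of p] unfolding gram by (rule fock2_reproducing[OF \<nu> ent])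
  then obtain u where u: "u \<in> borel_measurable borel" "sqnorm lborel u < \<infinity>"
    and rep: "\<And>p. F p * wt \<nu> p = (LINT x|lborel. ?A p x * u x)"
    using K.analysis_surj[OF Fm fin] by blast
  define f where "f x = u x / wt \<nu> x" for x
  have fu: "f x * wt \<nu> x = u x" for x by (simp add: f_def)
  have "f \<in> L2w \<nu>" by (rule L2w_I[OF u]) (simp add: fu)
  moreover have "segal_bargmann2 \<nu> f p = F p" for p
  proof -
    have c: "?b * ?b = (\<nu> / pi) powr (3 / 2)" by (simp flip: powr_add)
    have "?A p x * u x = of_real (?b * ?b) * wt \<nu> p *
        (u x * (sb_kernel \<nu> (fst p) (fst x) * sb_kernel \<nu> (snd p) (snd x)))" for x
      by (simp add: weighted_sb_kernel_def wt_Pair[of \<nu> p] mult_ac)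
    then have "F p * wt \<nu> p = of_real (?b * ?b) * wt \<nu> p *
        (LINT x|lborel. u x * (sb_kernel \<nu> (fst p) (fst x) * sb_kernel \<nu> (snd p) (snd x)))"
      unfolding rep by (simp only: integral_mult_right_zero)
    also have "\<dots> = segal_bargmann2 \<nu> f p * wt \<nu> p"
      unfolding segal_bargmann2_eq fu c by (simp only: mult_ac)
    finally have "F p * wt \<nu> p = segal_bargmann2 \<nu> f p * wt \<nu> p" .
    then show ?thesis by simp
  qed
  ultimately show ?thesis by (intro image_eqI[of _ _ f]) auto
qed

lemma segal_bargmann2_inv:
  assumes "\<nu> > 0" "F \<in> fock2 \<nu>"
  shows "segal_bargmann2_inv \<nu> F \<in> L2w \<nu>" "segal_bargmann2 \<nu> (segal_bargmann2_inv \<nu> F) = F"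
  unfolding segal_bargmann2_inv_def
  by (rule inv_into_into[OF segal_bargmann2_surj[OF assms]], rule f_inv_into_f[OF segal_bargmann2_surj[OF assms]])

section \<open>The Bergman projection, and the transform of Fock functions\<close>

lemma integral_complex_R2:
  fixes h :: "complex \<Rightarrow> complex"
  assumes [measurable]: "h \<in> borel_measurable borel"
  shows "(LINT z|lborel. h z) = (LINT x|lborel. h (Complex (fst x) (snd x)))"
  by (subst lborel_complex, subst integral_distr) auto

lemma sqnorm_complex_R2:
  assumes [measurable]: "h \<in> borel_measurable borel"
  shows "sqnorm lborel h = sqnorm lborel (\<lambda>x. h (Complex (fst x) (snd x)))"
  unfolding sqnorm_def by (subst lborel_complex, subst nn_integral_distr) auto

lemma wt_Complex: "wt \<nu> (Complex (fst x) (snd x)) = wt \<nu> x"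
  unfolding wt_def cmod_power2 by (cases x) (simp add: norm_Pair)

lemma of_R2_L2w:
  assumes g: "g \<in> L2w \<nu>"
  shows "of_R2 g \<in> L2w \<nu>"
proof -
  have [measurable]: "g \<in> borel_measurable borel" using g by (simp add: L2w_iff)
  have "(\<lambda>z. (Re z, Im z)) \<in> borel_measurable borel"
    by (intro borel_measurable_continuous_onI continuous_intros)
  from measurable_compose[OF this, of g borel]
  have [measurable]: "of_R2 g \<in> borel_measurable borel" unfolding of_R2_def by simp
  have "sqnorm lborel (\<lambda>z. of_R2 g z * wt \<nu> z) = sqnorm lborel (\<lambda>x. g x * wt \<nu> x)"
    by (subst sqnorm_complex_R2, measurable) (simp add: wt_Complex of_R2_def)
  then show ?thesis using g by (simp add: L2w_iff)
qed

lemma sb_kernel_mult: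
  "sb_kernel \<nu> z (fst x) * sb_kernel \<nu> w (snd x) =
     exp (of_real \<nu> * (of_real (sqrt 2) * (z * of_real (fst x) + w * of_real (snd x)) - (z\<^sup>2 + w\<^sup>2) / 2)) * wt \<nu> x"
  unfolding sb_kernel_def wt_def exp_of_real[symmetric] mult_exp_exp
  by (cases x, rule arg_cong[where f = exp]) (simp add: norm_Pair field_simps)

text \<open>The squares of the coordinates of \<open>psi2 a\<close> sum to 0, so the quadratic term
  of the kernel drops out, and \<open>sqrt 2\<close> times its linear form at \<open>(x, y)\<close>
  is \<open>a * cnj (Complex x y)\<close>. What remains is the Bergman kernel at \<open>a\<close>,
  with \<open>sqrt (pi / \<nu>) * (\<nu> / pi) powr (3 / 2) = \<nu> / pi\<close> as its
  constant.\<close>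

lemma bergman_psi2:
  assumes \<nu>: "\<nu> > 0" and g: "g \<in> L2w \<nu>"
  shows "of_real (sqrt (pi / \<nu>)) * segal_bargmann2 \<nu> g (psi2 a) * wt \<nu> a
    = (LINT z|lborel. of_R2 g z * wt \<nu> z * fock_kernel \<nu> a z)"
proof -
  have [measurable]: "of_R2 g \<in> borel_measurable borel"
    using of_R2_L2w[OF g] by (simp add: L2w_iff)
  have [measurable]: "fock_kernel \<nu> a \<in> borel_measurable borel"
    unfolding fock_kernel_def[abs_def] by measurable
  have psi2: "psi2 a = (a / of_real (sqrt 2), - \<i> * a / of_real (sqrt 2))"
    by (simp add: psi2_def cscale2_def)
  have sq: "(fst (psi2 a))\<^sup>2 + (snd (psi2 a))\<^sup>2 = 0"
    unfolding psi2 by (simp add: power_divide power_mult_distrib)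
  have lin: "of_real (sqrt 2) * (fst (psi2 a) * of_real (fst x) + snd (psi2 a) * of_real (snd x))
      = a * cnj (Complex (fst x) (snd x))" for x
    unfolding psi2 by (simp add: complex_eq_iff field_simps)
  have k: "sb_kernel \<nu> (fst (psi2 a)) (fst x) * sb_kernel \<nu> (snd (psi2 a)) (snd x) =
      exp (of_real \<nu> * a * cnj (Complex (fst x) (snd x))) * wt \<nu> x" for x
    unfolding sb_kernel_mult sq lin by (simp add: mult.assoc)
  have c: "sqrt (pi / \<nu>) * (\<nu> / pi) powr (3 / 2) = \<nu> / pi"
  proof -
    have c2: "sqrt (pi / \<nu>) = (\<nu> / pi) powr (- (1 / 2))"
      using \<nu> by (simp add: powr_minus powr_half_sqrt real_sqrt_divide)
    show ?thesis
      unfolding c2 using \<nu> by (simp flip: powr_add)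
  qed
  have "of_real (sqrt (pi / \<nu>)) * segal_bargmann2 \<nu> g (psi2 a) * wt \<nu> a
     = of_real (sqrt (pi / \<nu>) * (\<nu> / pi) powr (3 / 2)) * wt \<nu> a *
       (LINT x|lborel. g x * wt \<nu> x * (exp (of_real \<nu> * a * cnj (Complex (fst x) (snd x))) * wt \<nu> x))"
    unfolding segal_bargmann2_eq k of_real_mult by (simp add: mult_ac)
  also have "\<dots> = (LINT x|lborel. g x * wt \<nu> x * fock_kernel \<nu> a (Complex (fst x) (snd x)))"
    unfolding c integral_mult_right_zero[symmetric] fock_kernel_def wt_Complex by (simp add: mult_ac)
  also have "\<dots> = (LINT z|lborel. of_R2 g z * wt \<nu> z * fock_kernel \<nu> a z)"
    by (subst integral_complex_R2, measurable) (simp add: of_R2_def wt_Complex)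
  finally show ?thesis .
qed

lemma inner_w_eq: "inner_w \<nu> f g = (LINT x|lborel. f x * wt \<nu> x * cnj (g x * wt \<nu> x))"
proof -
  have "of_real (exp (- \<nu> * (norm x)\<^sup>2)) = wt \<nu> x * cnj (wt \<nu> x)" for x :: 'a
    unfolding wt_def complex_cnj_complex_of_real of_real_mult[symmetric] exp_add[symmetric] by simp
  then show ?thesis unfolding inner_w_def by (simp add: mult_ac)
qed

lemma L2w_integrable_mult:
  assumes "f \<in> L2w \<nu>" "g \<in> L2w \<nu>"
  shows "integrable lborel (\<lambda>x. f x * wt \<nu> x * cnj (g x * wt \<nu> x))"
proof -
  have [measurable]: "f \<in> borel_measurable borel" "g \<in> borel_measurable borel"
    using assms by (auto simp: L2w_iff)
  have "sqnorm lborel (\<lambda>x. cnj (g x * wt \<nu> x)) = sqnorm lborel (\<lambda>x. g x * wt \<nu> x)"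
    unfolding sqnorm_def complex_mod_cnj ..
  then show ?thesis
    using assms by (intro integrable_mult_sqnorm) (auto simp: L2w_iff simp del: complex_cnj_mult)
qed

lemma inner_w_diff:
  assumes "f \<in> L2w \<nu>" "g \<in> L2w \<nu>" "h \<in> L2w \<nu>"
  shows "inner_w \<nu> (\<lambda>x. f x - g x) h = inner_w \<nu> f h - inner_w \<nu> g h"
  unfolding inner_w_eq left_diff_distrib
  by (intro Bochner_Integration.integral_diff L2w_integrable_mult assms)

lemma L2w_diff:
  assumes "f \<in> L2w \<nu>" "g \<in> L2w \<nu>"
  shows "(\<lambda>x. f x - g x) \<in> L2w \<nu>"
proof -
  have [measurable]: "f \<in> borel_measurable borel" "g \<in> borel_measurable borel"
    using assms by (auto simp: L2w_iff)
  have "sqnorm lborel (\<lambda>x. f x * wt \<nu> x - g x * wt \<nu> x) < \<infinity>"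
    using assms by (intro sqnorm_diff_finite) (auto simp: L2w_iff)
  then show ?thesis by (simp add: L2w_iff left_diff_distrib)
qed

text \<open>By \<open>bergman_psi2\<close>, \<open>P\<close> is the Bergman integral of
  \<open>of_R2 g\<close>, whence its square integrability and the orthogonality. Its holomorphy is
  read off the other description: an entire function restricted to a complex line.\<close>

lemma fock_proj_psi2:
  assumes \<nu>: "\<nu> > 0" and g: "g \<in> L2w \<nu>" and ent: "entire2 (segal_bargmann2 \<nu> g)"
  defines "P \<equiv> \<lambda>a. of_real (sqrt (pi / \<nu>)) * segal_bargmann2 \<nu> g (psi2 a)"
  shows "P \<in> fock1 \<nu>" "fock_proj \<nu> (of_R2 g) = P"
proof -
  interpret K: L2_kernel "weighted_sb_kernel \<nu>" "(\<nu> / pi) powr (3 / 4)" "\<nu> / pi" 2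
    by (rule L2_kernel_weighted_sb_kernel[OF \<nu>])
  note gram = L2_kernel_gram_weighted_sb_kernel[OF \<nu>]
  define f where "f = of_R2 g"
  have f: "f \<in> L2w \<nu>" unfolding f_def by (rule of_R2_L2w[OF g])
  then have fm: "(\<lambda>z. f z * wt \<nu> z) \<in> borel_measurable borel" and ff: "sqnorm lborel (\<lambda>z. f z * wt \<nu> z) < \<infinity>"
    by (auto simp: L2w_iff)
  have P: "P a * wt \<nu> a = (LINT z|lborel. f z * wt \<nu> z * K.gram a z)" for a
    unfolding P_def gram f_def by (rule bergman_psi2[OF \<nu> g])
  have psi2: "psi2 a = (0 + a * (1 / of_real (sqrt 2)), 0 + a * (- \<i> / of_real (sqrt 2)))" for a
    by (simp add: psi2_def cscale2_def)
  have "P holomorphic_on UNIV"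
    unfolding P_def psi2 by (intro holomorphic_intros entire2_holomorphic_line[OF ent])
  then show PF: "P \<in> fock1 \<nu>"
    unfolding fock1_iff P using K.sqnorm_gram_op_finite[OF fm ff] by blast
  then have PL: "P \<in> L2w \<nu>" by (simp add: fock1_def)
  have orth: "inner_w \<nu> (\<lambda>z. f z - P z) H = 0" if H: "H \<in> fock1 \<nu>" for H
  proof -
    have HL: "H \<in> L2w \<nu>" using H by (simp add: fock1_def)
    then have Hm: "(\<lambda>z. H z * wt \<nu> z) \<in> borel_measurable borel" and Hf: "sqnorm lborel (\<lambda>z. H z * wt \<nu> z) < \<infinity>"
      by (auto simp: L2w_iff)
    \<comment> \<open>Self-adjointness moves the kernel onto \<open>H\<close>, which it
      reproduces.\<close>
    have "inner_w \<nu> P H = (LINT z'|lborel. f z' * wt \<nu> z' * cnj (LINT z|lborel. H z * wt \<nu> z * K.gram z' z))"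
      unfolding inner_w_eq P by (rule K.gram_op_self_adjoint[OF fm Hm ff Hf])
    also have "\<dots> = inner_w \<nu> f H"
      unfolding gram fock1_reproducing[OF \<nu> H] inner_w_eq ..
    finally show ?thesis by (simp add: inner_w_diff[OF f PL HL])
  qed
  show "fock_proj \<nu> (of_R2 g) = P"
    unfolding fock_proj_def f_def[symmetric]
  proof (rule the_equality)
    fix Q assume "Q \<in> fock1 \<nu> \<and> (\<forall>H\<in>fock1 \<nu>. inner_w \<nu> (\<lambda>z. f z - Q z) H = 0)"
    then have QF: "Q \<in> fock1 \<nu>" and Qo: "\<And>H. H \<in> fock1 \<nu> \<Longrightarrow> inner_w \<nu> (\<lambda>z. f z - Q z) H = 0" by auto
    have QL: "Q \<in> L2w \<nu>" using QF by (simp add: fock1_def)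
    define D where "D z = P z - Q z" for z
    have DL: "D \<in> L2w \<nu>" unfolding D_def[abs_def] by (rule L2w_diff[OF PL QL])
    have DF: "D \<in> fock1 \<nu>"
      using DL PF QF unfolding fock1_def D_def[abs_def] by (auto intro!: holomorphic_intros)
    \<comment> \<open>Both \<open>f - Q\<close> and \<open>f - P\<close> are orthogonal to
      \<open>D\<close>, and their difference is \<open>D\<close>.\<close>
    have "inner_w \<nu> D D = inner_w \<nu> (\<lambda>z. f z - Q z) D - inner_w \<nu> (\<lambda>z. f z - P z) D"
      unfolding inner_w_diff[OF f QL DL] inner_w_diff[OF f PL DL]
      using inner_w_diff[OF PL QL DL] by (simp add: D_def[abs_def])
    then have "inner_w \<nu> D D = 0" using Qo[OF DF] orth[OF DF] by simp
    then have "(LINT z|lborel. (cmod (D z * wt \<nu> z))\<^sup>2) = 0"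
      unfolding inner_w_eq cnj_mult_self integral_complex_of_real by simp
    moreover have "integrable lborel (\<lambda>z. (cmod (D z * wt \<nu> z))\<^sup>2)"
      using L2w_integrable_mult[OF DL DL] unfolding cnj_mult_self complex_of_real_integrable_eq .
    ultimately have "AE z in lborel. (cmod (D z * wt \<nu> z))\<^sup>2 = 0"
      by (subst (asm) integral_nonneg_eq_0_iff_AE) auto
    \<comment> \<open>The reproducing formula upgrades vanishing almost everywhere to vanishing at
      every point, which uniqueness under \<open>THE\<close> demands.\<close>
    then have "AE z in lborel. D z * wt \<nu> z * fock_kernel \<nu> a z = 0" for a
      by eventually_elim simp
    then have "(LINT z|lborel. D z * wt \<nu> z * fock_kernel \<nu> a z) = 0" for a
      by (rule integral_eq_zero_AE)
    then have "D a = 0" for a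
      using fock1_reproducing[OF \<nu> DF, of a] by simp
    then show "Q = P" by (auto simp: D_def fun_eq_iff)
  qed (use PF orth in auto)
qed

text \<open>In the coordinates \<open>a\<close>, \<open>b\<close> one has
  \<open>z^2 + w^2 = 2 * a * b\<close>, and with \<open>\<zeta> = Complex x y\<close> the linear
  form becomes \<open>b * \<zeta> + a * cnj \<zeta>\<close>. The kernel thus splits into a
  holomorphic exponential, absorbed in \<open>H\<close>, and the Bergman kernel at
  \<open>a = psi1 p\<close>; the exponential in \<open>H a\<close> cancels the constant
  \<open>exp (- \<nu> * a * b)\<close>.\<close>

lemma segal_bargmann2_fock1:
  assumes \<nu>: "\<nu> > 0" and F: "F \<in> fock1 \<nu>"
  shows "segal_bargmann2 \<nu> (to_R2 F) p = of_real (sqrt (\<nu> / pi)) * F (psi1 p)"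
proof -
  define z w where "z = fst p" and "w = snd p"
  define a b where "a = (z + \<i> * w) / of_real (sqrt 2)" and "b = (z - \<i> * w) / of_real (sqrt 2)"
  have hol: "F holomorphic_on UNIV" and FL: "F \<in> L2w \<nu>" using F by (auto simp: fock1_def)
  note [measurable] = holomorphic_measurable[OF hol]
  have fkm[measurable]: "fock_kernel \<nu> a \<in> borel_measurable borel" for a
    unfolding fock_kernel_def[abs_def] by measurable
  define H where "H \<zeta> = F \<zeta> * exp (of_real \<nu> * b * \<zeta>)" for \<zeta>
  have Hh: "H holomorphic_on UNIV"
    unfolding H_def[abs_def] by (intro holomorphic_intros hol)
  note [measurable] = holomorphic_measurable[OF Hh]
  \<comment> \<open>\<open>H\<close> is not known to lie in \<open>fock1 \<nu>\<close>. But
    \<open>exp (\<nu> * b * \<zeta>)\<close> has the modulus of its conjugate, and multiplying by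
    the conjugate only moves the kernel from \<open>a\<close> to \<open>a + cnj b\<close>, up to a
    constant.\<close>
  have Hi: "integrable lborel (\<lambda>\<zeta>. H \<zeta> * wt \<nu> \<zeta> * fock_kernel \<nu> a \<zeta>)"
  proof (rule Bochner_Integration.integrable_bound)
    show "integrable lborel (\<lambda>\<zeta>. wt \<nu> a / wt \<nu> (a + cnj b) * (F \<zeta> * wt \<nu> \<zeta> * fock_kernel \<nu> (a + cnj b) \<zeta>))"
      by (intro integrable_mult_right L2w_integrable_fock_kernel[OF \<nu> FL])
    have "cmod (exp (of_real \<nu> * b * \<zeta>) * fock_kernel \<nu> a \<zeta>)
        = cmod (wt \<nu> a / wt \<nu> (a + cnj b) * fock_kernel \<nu> (a + cnj b) \<zeta>)" for \<zeta>
    proof -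
      have "cmod (exp (of_real \<nu> * cnj b * cnj \<zeta>)) = cmod (exp (of_real \<nu> * b * \<zeta>))"
        by (simp add: algebra_simps)
      moreover have "wt \<nu> a / wt \<nu> (a + cnj b) * fock_kernel \<nu> (a + cnj b) \<zeta>
        = fock_kernel \<nu> a \<zeta> * exp (of_real \<nu> * cnj b * cnj \<zeta>)"
        by (simp add: fock_kernel_def distrib_left distrib_right exp_add mult_ac)
      ultimately show ?thesis by (simp only: norm_mult mult.commute)
    qed
    then show "AE \<zeta> in lborel. norm (H \<zeta> * wt \<nu> \<zeta> * fock_kernel \<nu> a \<zeta>)
       \<le> norm (wt \<nu> a / wt \<nu> (a + cnj b) * (F \<zeta> * wt \<nu> \<zeta> * fock_kernel \<nu> (a + cnj b) \<zeta>))"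
      by (simp add: H_def norm_mult norm_divide mult_ac)
  qed measurable
  have ab: "a * b = (z\<^sup>2 + w\<^sup>2) / 2"
  proof -
    have "a * b = (z + \<i> * w) * (z - \<i> * w) / (of_real (sqrt 2) * of_real (sqrt 2))"
      by (simp add: a_def b_def)
    then show ?thesis unfolding complex_sqrt2_square by (simp add: algebra_simps power2_eq_square)
  qed
  have lin: "of_real (sqrt 2) * (z * of_real (fst x) + w * of_real (snd x))
      = b * Complex (fst x) (snd x) + a * cnj (Complex (fst x) (snd x))" for x
  proof -
    have "of_real (sqrt 2) * (z * of_real (fst x) + w * of_real (snd x))
      = (of_real (sqrt 2) * of_real (sqrt 2)) * (z * of_real (fst x) + w * of_real (snd x)) / of_real (sqrt 2)"
      by simp
    also have "\<dots> = b * Complex (fst x) (snd x) + a * cnj (Complex (fst x) (snd x))"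
      unfolding complex_sqrt2_square a_def b_def Complex_eq by (simp add: field_simps)
    finally show ?thesis .
  qed
  have k: "sb_kernel \<nu> z (fst x) * sb_kernel \<nu> w (snd x) = exp (- of_real \<nu> * (a * b)) *
     (exp (of_real \<nu> * b * Complex (fst x) (snd x)) * exp (of_real \<nu> * a * cnj (Complex (fst x) (snd x))) * wt \<nu> x)" for x
    unfolding sb_kernel_mult lin ab mult.assoc[symmetric] mult_exp_exp
    by (intro arg_cong2[where f = "(*)"] arg_cong[where f = exp] refl) (simp add: field_simps)
  have c: "(\<nu> / pi) powr (3 / 2) * (pi / \<nu>) = sqrt (\<nu> / pi)"
  proof -
    have "pi / \<nu> = (\<nu> / pi) powr (- 1)" using \<nu> by (simp add: powr_minus)
    then have "(\<nu> / pi) powr (3 / 2) * (pi / \<nu>) = (\<nu> / pi) powr (3 / 2 + - 1)" by (simp only: powr_add)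
    then show ?thesis using \<nu> by (simp add: powr_half_sqrt)
  qed
  have "(LINT x|lborel. to_R2 F x * wt \<nu> x * (sb_kernel \<nu> z (fst x) * sb_kernel \<nu> w (snd x)))
    = (LINT x|lborel. exp (- of_real \<nu> * (a * b)) * of_real (pi / \<nu>) / wt \<nu> a *
       (H (Complex (fst x) (snd x)) * wt \<nu> (Complex (fst x) (snd x)) * fock_kernel \<nu> a (Complex (fst x) (snd x))))"
    unfolding k wt_Complex fock_kernel_def H_def to_R2_def using \<nu> by (simp add: case_prod_beta' mult_ac)
  also have "\<dots> = exp (- of_real \<nu> * (a * b)) * of_real (pi / \<nu>) / wt \<nu> a *
       (LINT \<zeta>|lborel. H \<zeta> * wt \<nu> \<zeta> * fock_kernel \<nu> a \<zeta>)"
    by (subst integral_complex_R2, measurable)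
  also have "\<dots> = exp (- of_real \<nu> * (a * b)) * of_real (pi / \<nu>) * H a"
    unfolding fock_reproducing[OF \<nu> Hh Hi] by simp
  also have "\<dots> = of_real (pi / \<nu>) * F a"
    by (simp add: H_def exp_minus field_simps)
  finally have "segal_bargmann2 \<nu> (to_R2 F) p = of_real ((\<nu> / pi) powr (3 / 2) * (pi / \<nu>)) * F a"
    unfolding segal_bargmann2_eq z_def[symmetric] w_def[symmetric] of_real_mult by simp
  then show ?thesis
    unfolding c by (simp add: a_def z_def w_def psi1_def case_prod_beta')
qed

section \<open>Membership in the Fock spaces\<close>

lemma rot_fock1:
  assumes c: "cmod c = 1" and F: "F \<in> fock1 \<nu>"
  shows "rot c F \<in> fock1 \<nu>"
proof -
  have hol: "F holomorphic_on UNIV" using F by (simp add: fock1_iff)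
  note [measurable] = holomorphic_measurable[OF hol]
  have "wt \<nu> (c * z) = wt \<nu> z" for z by (simp add: wt_def norm_mult c)
  then have "sqnorm lborel (\<lambda>z. rot c F z * wt \<nu> z) = sqnorm lborel (\<lambda>z. F (c * z) * wt \<nu> (c * z))"
    by (simp add: rot_def)
  also have "\<dots> = sqnorm lborel (\<lambda>z. F z * wt \<nu> z)"
    unfolding sqnorm_def by (rule nn_integral_rotate[OF _ c]) measurable
  finally have "sqnorm lborel (\<lambda>z. rot c F z * wt \<nu> z) < \<infinity>" using F by (simp add: fock1_iff)
  moreover have "rot c F holomorphic_on UNIV"
    unfolding rot_def by (rule holomorphic_on_compose_gen[OF _ hol, unfolded o_def]) (auto intro!: holomorphic_intros)
  ultimately show ?thesis by (simp add: fock1_iff)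
qed

lemma entire2_psi1:
  assumes "F holomorphic_on UNIV"
  shows "entire2 (\<lambda>p. F (psi1 p))"
  unfolding entire2_def
proof
  fix p
  obtain f' where "(F has_field_derivative f') (at (psi1 p))"
    using assms by (auto simp: holomorphic_on_def field_differentiable_def)
  then have F': "(F has_derivative (\<lambda>h. f' * h)) (at (psi1 p))"
    by (simp add: has_field_derivative_def)
  have "(psi1 has_derivative psi1) (at p)"
    unfolding psi1_def case_prod_beta' by (auto intro!: derivative_eq_intros)
  from has_derivative_compose[OF this F']
  have "((\<lambda>p. F (psi1 p)) has_derivative (\<lambda>h. f' * psi1 h)) (at p)" .
  moreover have "f' * psi1 (cscale2 c v) = c * (f' * psi1 v)" for c v
    by (simp add: psi1_def cscale2_def case_prod_beta' field_simps)
  ultimately show "\<exists>D. ((\<lambda>p. F (psi1 p)) has_derivative D) (at p) \<and> (\<forall>c v. D (cscale2 c v) = c * D v)"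
    by blast
qed

lemma nn_integral_complex_affine:
  fixes t :: complex
  assumes [measurable]: "f \<in> borel_measurable borel" and c: "c \<noteq> 0"
  shows "(\<integral>\<^sup>+z. f z \<partial>lborel) = ennreal (c\<^sup>2) * (\<integral>\<^sup>+z. f (t + c *\<^sub>R z) \<partial>lborel)"
  by (subst lborel_affine[OF c, of t])
     (simp add: nn_integral_density nn_integral_distr nn_integral_cmult)

text \<open>For fixed \<open>w\<close> the substitution \<open>z = - \<i> * w + sqrt 2 * a\<close>
  gives \<open>psi1 (z, w) = a\<close>, and by \<open>quad\<close> the weight splits into one in
  \<open>a\<close> and a Gaussian in \<open>\<i> * a + sqrt 2 * w\<close>. After Tonelli the
  integral over \<open>w\<close> is bounded independently of \<open>a\<close>.\<close>

lemma fock2_psi1: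
  assumes \<nu>: "\<nu> > 0" and F: "F \<in> fock1 \<nu>"
  shows "(\<lambda>p. of_real k * F (psi1 p)) \<in> fock2 \<nu>"
proof -
  have hol: "F holomorphic_on UNIV" using F by (simp add: fock1_iff)
  note Fm[measurable] = holomorphic_measurable[OF hol]
  have cont: "continuous_on UNIV (\<lambda>p. F (psi1 p))"
    unfolding psi1_def case_prod_beta'
    by (rule continuous_on_compose2[OF holomorphic_on_imp_continuous_on[OF hol]]) (auto intro!: continuous_intros)
  have m[measurable]: "(\<lambda>p. F (psi1 p)) \<in> borel_measurable borel"
    by (rule borel_measurable_continuous_onI[OF cont])
  have m2[measurable]: "(\<lambda>p. F (psi1 (fst p, snd p))) \<in> borel_measurable (borel \<Otimes>\<^sub>M borel)"
    using m by (simp add: borel_prod)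
  have quad: "(cmod (- \<i> * w + sqrt 2 *\<^sub>R a))\<^sup>2 + (cmod w)\<^sup>2 = (cmod a)\<^sup>2 + (cmod (\<i> * a + sqrt 2 *\<^sub>R w))\<^sup>2" for a w
    unfolding cmod_power2 by (simp add: power2_eq_square algebra_simps)
  have psi: "psi1 (- \<i> * w + sqrt 2 *\<^sub>R a, w) = a" for a w
    by (simp add: psi1_def scaleR_conv_of_real)
  \<comment> \<open>An upper bound is enough for finiteness, so the factor \<open>(sqrt 2)^2\<close>
    of the change of variables is simply dropped.\<close>
  have gw: "(\<integral>\<^sup>+w. ennreal (exp (- \<nu> * (cmod (\<i> * a + sqrt 2 *\<^sub>R w))\<^sup>2)) \<partial>lborel) \<le> ennreal (pi / \<nu>)" for a
  proof -
    have "ennreal ((sqrt 2)\<^sup>2) * (\<integral>\<^sup>+w. ennreal (exp (- \<nu> * (cmod (\<i> * a + sqrt 2 *\<^sub>R w))\<^sup>2)) \<partial>lborel) = ennreal (pi / \<nu>)"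
      using nn_integral_gaussian_complex[OF \<nu>] by (subst nn_integral_complex_affine[symmetric]) auto
    moreover have "1 * (\<integral>\<^sup>+w. ennreal (exp (- \<nu> * (cmod (\<i> * a + sqrt 2 *\<^sub>R w))\<^sup>2)) \<partial>lborel)
       \<le> ennreal ((sqrt 2)\<^sup>2) * (\<integral>\<^sup>+w. ennreal (exp (- \<nu> * (cmod (\<i> * a + sqrt 2 *\<^sub>R w))\<^sup>2)) \<partial>lborel)"
      by (rule mult_right_mono) auto
    ultimately show ?thesis by simp
  qed
  define q where "q p = ennreal ((cmod (F (psi1 p)))\<^sup>2 * exp (- \<nu> * ((cmod (fst p))\<^sup>2 + (cmod (snd p))\<^sup>2)))" for p
  have qm[measurable]: "q \<in> borel_measurable (borel \<Otimes>\<^sub>M borel)"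
    unfolding q_def[abs_def] using m by (simp add: borel_prod[symmetric])
  have "sqnorm lborel (\<lambda>p. F (psi1 p) * wt \<nu> p) = (\<integral>\<^sup>+p. q p \<partial>(lborel \<Otimes>\<^sub>M lborel))"
    unfolding sqnorm_def wt_squared[of "\<lambda>p. F (psi1 p)"] q_def lborel_prod by (simp add: norm_prod_def)
  also have "\<dots> = (\<integral>\<^sup>+w. \<integral>\<^sup>+z. q (z, w) \<partial>lborel \<partial>lborel)"
    by (rule lborel_pair.nn_integral_snd[symmetric]) simp
  also have "\<dots> = (\<integral>\<^sup>+w. \<integral>\<^sup>+a. ennreal 2 * q (- \<i> * w + sqrt 2 *\<^sub>R a, w) \<partial>lborel \<partial>lborel)"
  proof (rule nn_integral_cong)
    fix w :: complex
    have "(\<integral>\<^sup>+z. q (z, w) \<partial>lborel) = ennreal ((sqrt 2)\<^sup>2) * (\<integral>\<^sup>+a. q (- \<i> * w + sqrt 2 *\<^sub>R a, w) \<partial>lborel)"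
      by (rule nn_integral_complex_affine) auto
    then show "(\<integral>\<^sup>+z. q (z, w) \<partial>lborel) = (\<integral>\<^sup>+a. ennreal 2 * q (- \<i> * w + sqrt 2 *\<^sub>R a, w) \<partial>lborel)"
      by (subst nn_integral_cmult) auto
  qed
  also have "\<dots> = (\<integral>\<^sup>+w. \<integral>\<^sup>+a. ennreal (2 * (cmod (F a))\<^sup>2 * exp (- \<nu> * (cmod a)\<^sup>2)) *
      ennreal (exp (- \<nu> * (cmod (\<i> * a + sqrt 2 *\<^sub>R w))\<^sup>2)) \<partial>lborel \<partial>lborel)"
    unfolding q_def psi fst_conv snd_conv quad distrib_left exp_add
    by (simp add: ennreal_mult mult_ac)
  also have "\<dots> = (\<integral>\<^sup>+a. \<integral>\<^sup>+w. ennreal (2 * (cmod (F a))\<^sup>2 * exp (- \<nu> * (cmod a)\<^sup>2)) *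
      ennreal (exp (- \<nu> * (cmod (\<i> * a + sqrt 2 *\<^sub>R w))\<^sup>2)) \<partial>lborel \<partial>lborel)"
    by (rule lborel_pair.Fubini') measurable
  also have "\<dots> \<le> (\<integral>\<^sup>+a. ennreal (2 * (cmod (F a))\<^sup>2 * exp (- \<nu> * (cmod a)\<^sup>2)) * ennreal (pi / \<nu>) \<partial>lborel)"
    by (intro nn_integral_mono, subst nn_integral_cmult) (auto intro!: mult_left_mono gw[unfolded mult_minus_left])
  also have "\<dots> = ennreal 2 * sqnorm lborel (\<lambda>z. F z * wt \<nu> z) * ennreal (pi / \<nu>)"
    unfolding sqnorm_def wt_squared
    by (subst nn_integral_multc, measurable, subst nn_integral_cmult[symmetric])
       (auto simp: ennreal_mult mult.assoc)
  also have "\<dots> < \<infinity>"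
    using F by (simp add: fock1_iff ennreal_mult_less_top)
  finally have fin: "sqnorm lborel (\<lambda>p. F (psi1 p) * wt \<nu> p) < \<infinity>" .
  have "sqnorm lborel (\<lambda>p. of_real k * F (psi1 p) * wt \<nu> p) = ennreal (k\<^sup>2) * sqnorm lborel (\<lambda>p. F (psi1 p) * wt \<nu> p)"
    unfolding sqnorm_def by (subst nn_integral_cmult[symmetric])
      (auto simp: norm_mult power_mult_distrib ennreal_mult mult.assoc)
  then have "(\<lambda>p. of_real k * F (psi1 p)) \<in> L2w \<nu>"
    using fin by (simp add: L2w_iff ennreal_mult_less_top)
  moreover have "entire2 (\<lambda>p. of_real k * F (psi1 p))"
    by (rule entire2_psi1[of "\<lambda>z. of_real k * F z"]) (intro holomorphic_intros hol)
  ultimately show ?thesis by (simp add: fock2_def)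
qed

subsection \<open>The Fourier transform\<close>

lemma sqnorm_finite_of_integrable:
  assumes "integrable M (\<lambda>x. f x * cnj (f x))"
  shows "sqnorm M f < \<infinity>"
proof -
  have "integrable M (\<lambda>x. (cmod (f x))\<^sup>2)"
    using assms unfolding cnj_mult_self complex_of_real_integrable_eq .
  then show ?thesis unfolding sqnorm_def by (simp add: integrable_iff_bounded)
qed

lemma sqnorm_gaussian_finite:
  assumes a: "a > 0"
  shows "sqnorm lborel (\<lambda>x. c * exp (b * of_real x - of_real a * (of_real x)\<^sup>2)) < \<infinity>"
proof (rule sqnorm_finite_of_integrable)
  have "integrable lborel (\<lambda>x. c * cnj c * exp ((b + cnj b) * of_real x - of_real (2 * a) * (of_real x)\<^sup>2))"
    using gaussian_integral[of "2 * a" "b + cnj b"] a by (intro integrable_mult_right) (auto simp: has_bochner_integral_iff)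
  also have "(\<lambda>x. c * cnj c * exp ((b + cnj b) * of_real x - of_real (2 * a) * (of_real x)\<^sup>2))
    = (\<lambda>x. c * exp (b * of_real x - of_real a * (of_real x)\<^sup>2) * cnj (c * exp (b * of_real x - of_real a * (of_real x)\<^sup>2)))"
  proof
    fix x :: real
    have "exp ((b + cnj b) * of_real x - of_real (2 * a) * (of_real x)\<^sup>2)
      = exp (b * of_real x - of_real a * (of_real x)\<^sup>2) * exp (cnj (b * of_real x - of_real a * (of_real x)\<^sup>2))"
      unfolding mult_exp_exp by (rule arg_cong[where f = exp]) (simp add: algebra_simps)
    then show "c * cnj c * exp ((b + cnj b) * of_real x - of_real (2 * a) * (of_real x)\<^sup>2)
      = c * exp (b * of_real x - of_real a * (of_real x)\<^sup>2) * cnj (c * exp (b * of_real x - of_real a * (of_real x)\<^sup>2))"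
      by (simp only: complex_cnj_mult exp_cnj mult_ac)
  qed
  finally show "integrable lborel (\<lambda>x. c * exp (b * of_real x - of_real a * (of_real x)\<^sup>2) * cnj (c * exp (b * of_real x - of_real a * (of_real x)\<^sup>2)))" .
qed

lemma sb_kernel_gaussian:
  "sb_kernel \<nu> z x = exp (- (of_real \<nu> * z\<^sup>2 / 2)) * exp (of_real \<nu> * of_real (sqrt 2) * z * of_real x - of_real (\<nu> / 2) * (of_real x)\<^sup>2)"
  unfolding sb_kernel_def mult_exp_exp by (rule arg_cong[where f = exp]) (simp add: field_simps)

lemma sqnorm_sb_kernel_finite: "\<nu> > 0 \<Longrightarrow> sqnorm lborel (sb_kernel \<nu> z) < \<infinity>"
  unfolding sb_kernel_gaussian[abs_def] by (rule sqnorm_gaussian_finite) simp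

text \<open>The Fourier kernel, damped in order to be square integrable.\<close>

definition fourier_kernel :: "real \<Rightarrow> real \<Rightarrow> real \<Rightarrow> real \<Rightarrow> real \<Rightarrow> complex" where
  "fourier_kernel \<nu> \<sigma> \<epsilon> u x =
     of_real (sqrt (\<nu> / (2 * pi))) * exp (- (of_real \<sigma> * \<i> * of_real (\<nu> * x * u)) - of_real (\<epsilon> / 2) * (of_real x)\<^sup>2)"

lemma fourier_kernel_gram:
  assumes \<epsilon>: "\<epsilon> > 0" and \<nu>: "\<nu> > 0" and \<sigma>: "\<sigma>\<^sup>2 = 1"
  shows "has_bochner_integral lborel (\<lambda>x. fourier_kernel \<nu> \<sigma> \<epsilon> u x * cnj (fourier_kernel \<nu> \<sigma> \<epsilon> u' x))
    (of_real (\<nu> / (2 * pi) * sqrt (pi / \<epsilon>) * exp (- (\<nu>\<^sup>2 / (4 * \<epsilon>)) * (u - u')\<^sup>2)))"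
proof -
  define b where "b = - (of_real \<sigma> * \<i> * of_real (\<nu> * (u - u')))"
  have "has_bochner_integral lborel (\<lambda>x. of_real (\<nu> / (2 * pi)) * exp (b * of_real x - of_real \<epsilon> * (of_real x)\<^sup>2))
    (of_real (\<nu> / (2 * pi)) * (of_real (sqrt (pi / \<epsilon>)) * exp (b\<^sup>2 / (4 * of_real \<epsilon>))))"
    by (intro has_bochner_integral_mult_right gaussian_integral \<epsilon>)
  also have "(\<lambda>x. of_real (\<nu> / (2 * pi)) * exp (b * of_real x - of_real \<epsilon> * (of_real x)\<^sup>2))
    = (\<lambda>x. fourier_kernel \<nu> \<sigma> \<epsilon> u x * cnj (fourier_kernel \<nu> \<sigma> \<epsilon> u' x))"
  proof
    fix x :: real
    let ?e = "\<lambda>u. - (of_real \<sigma> * \<i> * of_real (\<nu> * x * u)) - of_real (\<epsilon> / 2) * (of_real x)\<^sup>2 :: complex"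
    have "fourier_kernel \<nu> \<sigma> \<epsilon> u x * cnj (fourier_kernel \<nu> \<sigma> \<epsilon> u' x)
      = of_real (sqrt (\<nu> / (2 * pi)) * sqrt (\<nu> / (2 * pi))) * (exp (?e u) * exp (cnj (?e u')))"
      unfolding fourier_kernel_def complex_cnj_mult exp_cnj complex_cnj_complex_of_real of_real_mult by (simp only: mult_ac)
    also have "sqrt (\<nu> / (2 * pi)) * sqrt (\<nu> / (2 * pi)) = \<nu> / (2 * pi)"
      using \<nu> by simp
    also have "exp (?e u) * exp (cnj (?e u')) = exp (b * of_real x - of_real \<epsilon> * (of_real x)\<^sup>2)"
      unfolding mult_exp_exp b_def by (rule arg_cong[where f = exp]) (simp add: field_simps)
    finally show "of_real (\<nu> / (2 * pi)) * exp (b * of_real x - of_real \<epsilon> * (of_real x)\<^sup>2)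
      = fourier_kernel \<nu> \<sigma> \<epsilon> u x * cnj (fourier_kernel \<nu> \<sigma> \<epsilon> u' x)" ..
  qed
  also have "b\<^sup>2 / (4 * of_real \<epsilon>) = of_real (- (\<nu>\<^sup>2 / (4 * \<epsilon>)) * (u - u')\<^sup>2)"
  proof -
    have "b\<^sup>2 = of_real (- (\<sigma>\<^sup>2 * (\<nu>\<^sup>2 * (u - u')\<^sup>2)))"
      unfolding b_def by (simp add: power_mult_distrib)
    then show ?thesis unfolding \<sigma> by simp
  qed
  finally show ?thesis unfolding exp_of_real by (simp only: of_real_mult mult.assoc)
qed

text \<open>The Gram kernel is a Gaussian in \<open>u - u'\<close> of total mass one, an approximate
  identity as \<epsilon> tends to 0. The Schur constant 1 is thus independent of \<epsilon>,
  although the L^2 bound of the rows blows up.\<close>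

lemma L2_kernel_fourier:
  assumes \<epsilon>: "\<epsilon> > 0" and \<nu>: "\<nu> > 0" and \<sigma>: "\<sigma>\<^sup>2 = 1"
  shows "L2_kernel (fourier_kernel \<nu> \<sigma> \<epsilon>) (sqrt (\<nu> / (2 * pi))) (\<nu> / (2 * pi) * sqrt (pi / \<epsilon>)) 1"
proof
  note gram = fourier_kernel_gram[OF assms]
  show "(\<lambda>p. fourier_kernel \<nu> \<sigma> \<epsilon> (fst p) (snd p)) \<in> borel_measurable borel"
    unfolding fourier_kernel_def by (intro borel_measurable_continuous_onI continuous_intros)
  show "cmod (fourier_kernel \<nu> \<sigma> \<epsilon> u x) \<le> sqrt (\<nu> / (2 * pi))" for u x
  proof -
    have "cmod (fourier_kernel \<nu> \<sigma> \<epsilon> u x) = sqrt (\<nu> / (2 * pi)) * exp (- (\<epsilon> / 2 * x\<^sup>2))"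
      using \<nu> unfolding fourier_kernel_def norm_mult norm_exp_eq_Re by simp
    also have "\<dots> \<le> sqrt (\<nu> / (2 * pi)) * 1"
      using \<epsilon> \<nu> by (intro mult_left_mono) auto
    finally show ?thesis by simp
  qed
  show "sqnorm lborel (fourier_kernel \<nu> \<sigma> \<epsilon> u) \<le> ennreal (\<nu> / (2 * pi) * sqrt (pi / \<epsilon>))" for u
    using sqnorm_eq_integral[OF gram[of u u]] by simp
  show "(\<integral>\<^sup>+u'. ennreal (cmod (LINT x|lborel. fourier_kernel \<nu> \<sigma> \<epsilon> u x * cnj (fourier_kernel \<nu> \<sigma> \<epsilon> u' x))) \<partial>lborel) \<le> ennreal 1" for u
  proof -
    define k where "k = \<nu> / (2 * pi) * sqrt (pi / \<epsilon>)"
    define d where "d = \<nu>\<^sup>2 / (4 * \<epsilon>)"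
    have k: "k \<ge> 0" using \<nu> \<epsilon> by (simp add: k_def)
    have d: "d > 0" using \<nu> \<epsilon> by (simp add: d_def)
    have "(\<integral>\<^sup>+u'. ennreal (cmod (LINT x|lborel. fourier_kernel \<nu> \<sigma> \<epsilon> u x * cnj (fourier_kernel \<nu> \<sigma> \<epsilon> u' x))) \<partial>lborel)
      = (\<integral>\<^sup>+u'. ennreal k * ennreal (exp (- d * (u - u')\<^sup>2)) \<partial>lborel)"
      unfolding has_bochner_integral_integral_eq[OF gram] k_def[symmetric] d_def[symmetric] norm_of_real
      using k by (simp add: abs_mult ennreal_mult)
    also have "\<dots> = (\<integral>\<^sup>+u'. ennreal k * ennreal (exp (- d * (u - (u + u'))\<^sup>2)) \<partial>lborel)"
      by (rule nn_integral_lborel_translate[symmetric]) measurable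
    also have "\<dots> = ennreal k * ennreal (sqrt (pi / d))"
      using nn_integral_gaussian_real[OF d] by (simp add: nn_integral_cmult)
    also have "\<dots> = ennreal (k * sqrt (pi / d))"
      using k by (simp add: ennreal_mult')
    also have "k * sqrt (pi / d) = \<nu> / (2 * pi) * sqrt ((2 * pi / \<nu>)\<^sup>2)"
      unfolding k_def d_def mult.assoc real_sqrt_mult[symmetric]
      using \<epsilon> by (simp add: power2_eq_square field_simps)
    also have "\<dots> = 1" using \<nu> by simp
    finally show ?thesis by simp
  qed
qed

text \<open>The kernel carries the opposite sign of \<sigma> because \<open>synth\<close> conjugates
  it; the damping factor does not involve \<open>u\<close> and leaves the integral.\<close>

lemma synth_fourier:
  assumes "\<epsilon> > 0" "\<nu> > 0" "\<sigma>\<^sup>2 = 1"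
  shows "L2_kernel.synth (fourier_kernel \<nu> \<sigma> \<epsilon>) g x = of_real (exp (- (\<epsilon> / 2) * x\<^sup>2)) * fourier_integral \<nu> \<sigma> g x"
proof -
  interpret L2_kernel "fourier_kernel \<nu> \<sigma> \<epsilon>" "sqrt (\<nu> / (2 * pi))" "\<nu> / (2 * pi) * sqrt (pi / \<epsilon>)" 1
    by (rule L2_kernel_fourier[OF assms])
  have e: "g u * cnj (fourier_kernel \<nu> \<sigma> \<epsilon> u x) = of_real (exp (- (\<epsilon> / 2) * x\<^sup>2)) * of_real (sqrt (\<nu> / (2 * pi))) *
      (g u * exp (of_real \<sigma> * \<i> * of_real (\<nu> * x * u)))" for u
  proof -
    have "cnj (exp (- (of_real \<sigma> * \<i> * of_real (\<nu> * x * u)) - of_real (\<epsilon> / 2) * (of_real x)\<^sup>2))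
       = of_real (exp (- (\<epsilon> / 2) * x\<^sup>2)) * exp (of_real \<sigma> * \<i> * of_real (\<nu> * x * u))"
      unfolding exp_cnj exp_of_real[symmetric] mult_exp_exp by (rule arg_cong[where f = exp]) simp
    then show ?thesis
      unfolding fourier_kernel_def complex_cnj_mult by (simp only: complex_cnj_complex_of_real mult_ac)
  qed
  show ?thesis
    unfolding synth_def e integral_mult_right_zero fourier_integral_def by (simp only: mult.assoc)
qed

lemma fourier_integral_measurable [measurable]:
  assumes [measurable]: "g \<in> borel_measurable borel"
  shows "fourier_integral \<nu> \<sigma> g \<in> borel_measurable borel"
  unfolding fourier_integral_def[abs_def] by measurable

text \<open>The bound for the damped kernels is uniform in the damping, and Fatou's lemma removes
  the damping along \<open>1 / real (Suc n)\<close>. The factor 2, where Plancherel's theorem has 1,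
  comes from \<open>sqnorm_synth_le\<close>.\<close>

lemma sqnorm_fourier_integral_le:
  assumes \<nu>: "\<nu> > 0" and \<sigma>: "\<sigma>\<^sup>2 = 1" and g: "integrable lborel g" "sqnorm lborel g < \<infinity>"
  shows "sqnorm lborel (fourier_integral \<nu> \<sigma> g) \<le> 2 * sqnorm lborel g"
proof -
  have [measurable]: "g \<in> borel_measurable borel" using g by auto
  define h where "h n x = of_real (exp (- (1 / real (Suc n) / 2) * x\<^sup>2)) * fourier_integral \<nu> \<sigma> g x" for n x
  have le: "sqnorm lborel (h n) \<le> 2 * sqnorm lborel g" for n
  proof -
    have \<epsilon>: "1 / real (Suc n) > 0" by simp
    interpret L2_kernel "fourier_kernel \<nu> \<sigma> (1 / real (Suc n))" "sqrt (\<nu> / (2 * pi))"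
        "\<nu> / (2 * pi) * sqrt (pi / (1 / real (Suc n)))" 1
      by (rule L2_kernel_fourier[OF \<epsilon> \<nu> \<sigma>])
    have "h n = synth g" unfolding h_def[abs_def] by (intro ext synth_fourier[OF \<epsilon> \<nu> \<sigma>, symmetric])
    then show ?thesis using sqnorm_synth_le[OF g] by simp
  qed
  have lim: "(\<lambda>n. ennreal ((cmod (h n x))\<^sup>2)) \<longlonglongrightarrow> ennreal ((cmod (fourier_integral \<nu> \<sigma> g x))\<^sup>2)" for x
  proof -
    have "(\<lambda>n. 1 / real (Suc n)) \<longlonglongrightarrow> 0"
      by (rule LIMSEQ_Suc[OF lim_1_over_n])
    then have "(\<lambda>n. h n x) \<longlonglongrightarrow> of_real (exp (- (0 / 2) * x\<^sup>2)) * fourier_integral \<nu> \<sigma> g x"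
      unfolding h_def by (intro tendsto_intros) auto
    then show ?thesis by (intro tendsto_ennrealI tendsto_intros) simp
  qed
  have "sqnorm lborel (fourier_integral \<nu> \<sigma> g) = (\<integral>\<^sup>+x. liminf (\<lambda>n. ennreal ((cmod (h n x))\<^sup>2)) \<partial>lborel)"
    unfolding sqnorm_def by (intro nn_integral_cong lim_imp_Liminf[symmetric] lim) simp
  also have "\<dots> \<le> liminf (\<lambda>n. sqnorm lborel (h n))"
    unfolding sqnorm_def by (rule nn_integral_liminf) (simp add: h_def[abs_def])
  also have "\<dots> \<le> 2 * sqnorm lborel g"
    by (rule Liminf_le) (auto intro!: always_eventually le)
  finally show ?thesis .
qed

lemma fourier_integral_diff:
  assumes "integrable lborel g" "integrable lborel h"
  shows "fourier_integral \<nu> \<sigma> (\<lambda>u. g u - h u) x = fourier_integral \<nu> \<sigma> g x - fourier_integral \<nu> \<sigma> h x"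
proof -
  have i: "integrable lborel (\<lambda>u. f u * exp (of_real \<sigma> * \<i> * of_real (\<nu> * x * u)))" if f: "integrable lborel f" for f
  proof (rule Bochner_Integration.integrable_bound[OF f])
    have [measurable]: "f \<in> borel_measurable borel" using f by auto
    show "(\<lambda>u. f u * exp (of_real \<sigma> * \<i> * of_real (\<nu> * x * u))) \<in> borel_measurable lborel" by measurable
    have "cmod (exp (of_real \<sigma> * \<i> * of_real (\<nu> * x * u))) = 1" for u
      unfolding norm_exp_eq_Re by simp
    then show "AE u in lborel. norm (f u * exp (of_real \<sigma> * \<i> * of_real (\<nu> * x * u))) \<le> norm (f u)"
      by (simp only: norm_mult mult_1_right order_refl eventually_True)
  qed
  show ?thesis
    unfolding fourier_integral_def left_diff_distrib Bochner_Integration.integral_diff[OF i[OF assms(1)] i[OF assms(2)]]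
    by (rule right_diff_distrib)
qed

lemma wt_0 [simp]: "wt 0 x = 1"
  by (simp add: wt_def)

context
  fixes \<nu> \<sigma> :: real and g :: "real \<Rightarrow> complex"
  assumes \<nu>: "\<nu> > 0" and \<sigma>: "\<sigma>\<^sup>2 = 1"
    and g_borel [measurable]: "g \<in> borel_measurable borel" and g_fin: "sqnorm lborel g < \<infinity>"
begin

abbreviation (input) "trunc n \<equiv> (\<lambda>u. indicator {- real n..real n} u * g u)"

lemma trunc_integrable: "integrable lborel (trunc n)"
  using g_fin by (intro integrable_truncate) auto

lemma trunc_sqnorm: "sqnorm lborel (trunc n) < \<infinity>"
  using sqnorm_truncate_le[of lborel _ g] g_fin le_less_trans by blast

lemma trunc_tendsto: "(\<lambda>n. sqnorm lborel (\<lambda>u. trunc n u - g u)) \<longlonglongrightarrow> 0"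
proof (rule sqnorm_truncate_tendsto)
  fix u :: real
  obtain n0 where n0: "\<bar>u\<bar> \<le> real n0" using real_arch_simple by blast
  show "eventually (\<lambda>n. u \<in> {- real n..real n}) sequentially"
    using eventually_ge_at_top[of n0]
  proof eventually_elim
    fix n assume "n \<ge> n0"
    then have "real n0 \<le> real n" by simp
    then show "u \<in> {- real n..real n}" using n0 by auto
  qed
qed (use g_fin in auto)

lemma fourier_trunc_finite: "sqnorm lborel (fourier_integral \<nu> \<sigma> (trunc n)) < \<infinity>"
  by (rule le_less_trans[OF sqnorm_fourier_integral_le[OF \<nu> \<sigma> trunc_integrable trunc_sqnorm]])
     (use trunc_sqnorm[of n] in \<open>simp add: ennreal_mult_less_top\<close>)

text \<open>All that is used later about the function picked by \<open>SOME\<close>: it is the limit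
  in the mean of the truncated integrals. A limit exists because the Fourier integral is bounded on
  truncations and L^2 is complete.\<close>

lemma fourier_L2_props:
  shows "fourier_L2 \<nu> \<sigma> g \<in> borel_measurable borel" "sqnorm lborel (fourier_L2 \<nu> \<sigma> g) < \<infinity>"
    and "(\<lambda>n. sqnorm lborel (\<lambda>x. fourier_integral \<nu> \<sigma> (trunc n) x - fourier_L2 \<nu> \<sigma> g x)) \<longlonglongrightarrow> 0"
proof -
  have bound: "sqnorm lborel (\<lambda>x. fourier_integral \<nu> \<sigma> (trunc m) x - fourier_integral \<nu> \<sigma> (trunc n) x)
      \<le> ennreal 2 * sqnorm lborel (\<lambda>u. trunc m u - trunc n u)" for m n
  proof -
    have "sqnorm lborel (fourier_integral \<nu> \<sigma> (\<lambda>u. trunc m u - trunc n u)) \<le> 2 * sqnorm lborel (\<lambda>u. trunc m u - trunc n u)"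
      by (intro sqnorm_fourier_integral_le \<nu> \<sigma> Bochner_Integration.integrable_diff trunc_integrable
            sqnorm_diff_finite[of "trunc m" lborel "trunc n"] trunc_sqnorm) measurable
    also have "fourier_integral \<nu> \<sigma> (\<lambda>u. trunc m u - trunc n u) =
        (\<lambda>x. fourier_integral \<nu> \<sigma> (trunc m) x - fourier_integral \<nu> \<sigma> (trunc n) x)"
      by (intro ext fourier_integral_diff trunc_integrable)
    finally show ?thesis by simp
  qed
  obtain h where h: "h \<in> borel_measurable lborel"
    "(\<lambda>n. sqnorm lborel (\<lambda>x. fourier_integral \<nu> \<sigma> (trunc n) x - h x)) \<longlonglongrightarrow> 0"
    by (rule L2_bounded_image_limit[of "\<lambda>n. fourier_integral \<nu> \<sigma> (trunc n)" lborel trunc lborel g,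
          OF _ _ _ bound trunc_tendsto]) measurable
  have "sqnorm lborel h < \<infinity>"
    by (rule sqnorm_limit_finite[OF _ h(1) fourier_trunc_finite h(2)]) measurable
  define Q where "Q h \<longleftrightarrow> h \<in> L2w 0 \<and>
    (\<lambda>n. \<integral>\<^sup>+x. ennreal ((cmod (h x - fourier_integral \<nu> \<sigma> (trunc n) x))\<^sup>2) \<partial>lborel) \<longlonglongrightarrow> 0" for h
  have "Q h"
    using h \<open>sqnorm lborel h < \<infinity>\<close> by (simp add: Q_def L2w_iff sqnorm_def norm_minus_commute)
  moreover have "fourier_L2 \<nu> \<sigma> g = (SOME h. Q h)"
    unfolding fourier_L2_def Q_def ..
  ultimately have "Q (fourier_L2 \<nu> \<sigma> g)"
    by (simp only: someI[of Q h])
  then show "fourier_L2 \<nu> \<sigma> g \<in> borel_measurable borel" "sqnorm lborel (fourier_L2 \<nu> \<sigma> g) < \<infinity>"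
    "(\<lambda>n. sqnorm lborel (\<lambda>x. fourier_integral \<nu> \<sigma> (trunc n) x - fourier_L2 \<nu> \<sigma> g x)) \<longlonglongrightarrow> 0"
    by (simp_all add: Q_def L2w_iff sqnorm_def norm_minus_commute)
qed

end

text \<open>In \<open>x\<close> the kernel is a Gaussian, and so is its Fourier transform. Since
  \<open>\<sigma>^2 = 1\<close>, the new exponent is again that of \<open>sb_kernel\<close>, now at
  \<open>\<sigma> * \<i> * z\<close>, whose square is \<open>- z^2\<close>.\<close>

lemma sb_kernel_fourier_integral:
  assumes \<nu>: "\<nu> > 0" and \<sigma>: "\<sigma>\<^sup>2 = 1" and g: "integrable lborel g"
  shows "(LINT x|lborel. sb_kernel \<nu> z x * fourier_integral \<nu> \<sigma> g x)
    = (LINT u|lborel. g u * sb_kernel \<nu> (of_real \<sigma> * \<i> * z) u)"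
proof -
  \<comment> \<open>A damping parameter below \<open>\<nu>\<close> can be undone on
    \<open>sb_kernel\<close> without losing Gaussian decay. The value \<open>\<nu> / 2\<close> is
    also the quadratic coefficient in the Gaussian integral over \<open>x\<close>, so this fact
    serves twice.\<close>
  have \<epsilon>: "\<nu> / 2 > 0" using \<nu> by simp
  interpret L2_kernel "fourier_kernel \<nu> \<sigma> (\<nu> / 2)" "sqrt (\<nu> / (2 * pi))" "\<nu> / (2 * pi) * sqrt (pi / (\<nu> / 2))" 1
    by (rule L2_kernel_fourier[OF \<epsilon> \<nu> \<sigma>])
  define c where "c = exp (- (of_real \<nu> * z\<^sup>2 / 2))"
  txt \<open>The damping of the Fourier kernel is undone on the other factor, which stays in \<open>L\<^sup>2\<close>.\<close>
  define h where "h x = sb_kernel \<nu> z x * of_real (exp (\<nu> / 2 / 2 * x\<^sup>2))" for x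
  have h_eq: "h x = c * exp (of_real \<nu> * of_real (sqrt 2) * z * of_real x - of_real (\<nu> / 4) * (of_real x)\<^sup>2)" for x
    unfolding h_def c_def sb_kernel_gaussian mult.assoc exp_of_real[symmetric] mult_exp_exp
    by (rule arg_cong[where f = exp]) (simp add: field_simps)
  have hm: "h \<in> borel_measurable borel" unfolding h_def[abs_def] by measurable
  have hf: "sqnorm lborel h < \<infinity>" unfolding h_eq[abs_def] by (rule sqnorm_gaussian_finite) (use \<nu> in simp)
  have inner: "(LINT x|lborel. h x * cnj (fourier_kernel \<nu> \<sigma> (\<nu> / 2) u x)) = sb_kernel \<nu> (of_real \<sigma> * \<i> * z) u" for u
  proof -
    define b where "b = of_real \<nu> * (of_real (sqrt 2) * z + of_real \<sigma> * \<i> * of_real u)"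
    have e: "h x * cnj (fourier_kernel \<nu> \<sigma> (\<nu> / 2) u x)
       = c * of_real (sqrt (\<nu> / (2 * pi))) * exp (b * of_real x - of_real (\<nu> / 2) * (of_real x)\<^sup>2)" for x
    proof -
      have "exp (of_real \<nu> * of_real (sqrt 2) * z * of_real x - of_real (\<nu> / 4) * (of_real x)\<^sup>2) *
          cnj (exp (- (of_real \<sigma> * \<i> * of_real (\<nu> * x * u)) - of_real (\<nu> / 2 / 2) * (of_real x)\<^sup>2))
          = exp (b * of_real x - of_real (\<nu> / 2) * (of_real x)\<^sup>2)"
        unfolding exp_cnj mult_exp_exp b_def by (rule arg_cong[where f = exp]) (simp add: field_simps)
      then show ?thesis
        unfolding h_eq fourier_kernel_def complex_cnj_mult complex_cnj_complex_of_real by (simp only: mult_ac)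
    qed
    have "(LINT x|lborel. h x * cnj (fourier_kernel \<nu> \<sigma> (\<nu> / 2) u x))
      = c * of_real (sqrt (\<nu> / (2 * pi))) * (of_real (sqrt (pi / (\<nu> / 2))) * exp (b\<^sup>2 / (4 * of_real (\<nu> / 2))))"
      unfolding e integral_mult_right_zero has_bochner_integral_integral_eq[OF gaussian_integral[OF \<epsilon>]] ..
    also have "\<dots> = of_real (sqrt (\<nu> / (2 * pi)) * sqrt (pi / (\<nu> / 2))) * (c * exp (b\<^sup>2 / (4 * of_real (\<nu> / 2))))"
      unfolding of_real_mult by (simp only: mult_ac)
    also have "sqrt (\<nu> / (2 * pi)) * sqrt (pi / (\<nu> / 2)) = 1"
      unfolding real_sqrt_mult[symmetric] using \<nu> by simp
    also have "c * exp (b\<^sup>2 / (4 * of_real (\<nu> / 2))) = sb_kernel \<nu> (of_real \<sigma> * \<i> * z) u"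
    proof -
      have s2: "complex_of_real \<sigma> * of_real \<sigma> = 1"
        using \<sigma> by (simp add: power2_eq_square flip: of_real_mult)
      have "(of_real (sqrt 2) * z + of_real \<sigma> * \<i> * of_real u)\<^sup>2
        = (of_real (sqrt 2) * of_real (sqrt 2)) * z\<^sup>2 + 2 * of_real (sqrt 2) * (of_real \<sigma> * \<i> * z) * of_real u
          - (of_real \<sigma> * of_real \<sigma>) * (of_real u)\<^sup>2"
        by (simp add: power2_eq_square algebra_simps)
      then have sq: "(of_real (sqrt 2) * z + of_real \<sigma> * \<i> * of_real u)\<^sup>2
        = 2 * z\<^sup>2 + 2 * of_real (sqrt 2) * (of_real \<sigma> * \<i> * z) * of_real u - (of_real u)\<^sup>2"
        unfolding complex_sqrt2_square s2 by simp
      have "b\<^sup>2 / (4 * of_real (\<nu> / 2)) = of_real \<nu> * (of_real (sqrt 2) * z + of_real \<sigma> * \<i> * of_real u)\<^sup>2 / 2"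
        using \<nu> by (simp add: b_def power_mult_distrib power2_eq_square[of "of_real \<nu>"])
      also have "\<dots> = of_real \<nu> * (z\<^sup>2 + of_real (sqrt 2) * (of_real \<sigma> * \<i> * z) * of_real u - (of_real u)\<^sup>2 / 2)"
        unfolding sq by (simp add: field_simps)
      finally have bb: "b\<^sup>2 / (4 * of_real (\<nu> / 2)) =
          of_real \<nu> * (z\<^sup>2 + of_real (sqrt 2) * (of_real \<sigma> * \<i> * z) * of_real u - (of_real u)\<^sup>2 / 2)" .
      have zz: "(of_real \<sigma> * \<i> * z)\<^sup>2 = - z\<^sup>2"
      proof -
        have "(of_real \<sigma> * \<i> * z)\<^sup>2 = (of_real \<sigma> * of_real \<sigma>) * - (z\<^sup>2)" by (simp add: power_mult_distrib power2_eq_square[of "of_real \<sigma>"])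
        then show ?thesis unfolding s2 by simp
      qed
      show ?thesis
        unfolding c_def bb sb_kernel_def zz mult_exp_exp
        by (rule arg_cong[where f = exp]) (simp add: field_simps)
    qed
    finally show ?thesis by simp
  qed
  have hs: "h x * synth g x = sb_kernel \<nu> z x * fourier_integral \<nu> \<sigma> g x" for x
  proof -
    have "exp (\<nu> / 2 / 2 * x\<^sup>2) * exp (- (\<nu> / 2 / 2) * x\<^sup>2) = 1"
      unfolding mult_exp_exp by simp
    then have "complex_of_real (exp (\<nu> / 2 / 2 * x\<^sup>2)) * of_real (exp (- (\<nu> / 2 / 2) * x\<^sup>2)) = 1"
      unfolding of_real_mult[symmetric] by simp
    then show ?thesis
      unfolding h_def synth_fourier[OF \<epsilon> \<nu> \<sigma>] by (metis mult.assoc mult.commute mult_1)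
  qed
  show ?thesis
    using synth_dual[OF g hm hf] unfolding hs inner .
qed

text \<open>The identity for truncations passes to the limit on both sides, as
  \<open>sb_kernel\<close> is square integrable in the real variable. The outer exponential of
  \<open>rescaled_fourier\<close> cancels the half weight, and the integral does not see which
  representative \<open>fourier_L2\<close> picks.\<close>

lemma segal_bargmann1_rescaled_fourier:
  assumes \<nu>: "\<nu> > 0" and \<sigma>: "\<sigma>\<^sup>2 = 1" and \<phi>: "\<phi> \<in> L2w \<nu>"
  shows "segal_bargmann1 \<nu> (rescaled_fourier \<nu> \<sigma> \<phi>) z = segal_bargmann1 \<nu> \<phi> (of_real \<sigma> * \<i> * z)"
proof -
  define g where "g u = \<phi> u * wt \<nu> u" for u
  have g: "g \<in> borel_measurable borel" "sqnorm lborel g < \<infinity>"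
    using \<phi> by (auto simp: L2w_iff g_def[abs_def])
  define h where "h = fourier_L2 \<nu> \<sigma> g"
  define T where "T n u = indicator {- real n..real n} u * g u" for n u
  have ge: "(\<lambda>u. of_real (exp (- \<nu> / 2 * u\<^sup>2)) * \<phi> u) = g"
    by (simp add: g_def[abs_def] wt_def mult.commute)
  note [measurable] = g(1)
  have [measurable]: "T n \<in> borel_measurable borel" for n unfolding T_def[abs_def] by measurable
  note props = fourier_L2_props[OF \<nu> \<sigma> g, folded T_def h_def]
  have rw: "rescaled_fourier \<nu> \<sigma> \<phi> x * wt \<nu> x = h x" for x
  proof -
    have "complex_of_real (exp (\<nu> / 2 * x\<^sup>2)) * wt \<nu> x = of_real (exp (\<nu> / 2 * x\<^sup>2 + - (\<nu> / 2) * x\<^sup>2))"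
      unfolding wt_def exp_add of_real_mult by simp
    also have "\<dots> = 1" by simp
    finally show ?thesis
      unfolding rescaled_fourier_def ge h_def[symmetric] by (metis mult.assoc mult.commute mult_1)
  qed
  have eq: "(LINT x|lborel. sb_kernel \<nu> z x * fourier_integral \<nu> \<sigma> (T n) x)
      = (LINT u|lborel. sb_kernel \<nu> (of_real \<sigma> * \<i> * z) u * T n u)" for n
    using sb_kernel_fourier_integral[OF \<nu> \<sigma> trunc_integrable[OF \<nu> \<sigma> g], folded T_def]
    by (simp only: mult.commute)
  have "(LINT x|lborel. sb_kernel \<nu> z x * h x) = (LINT u|lborel. sb_kernel \<nu> (of_real \<sigma> * \<i> * z) u * g u)"
  proof (rule LIMSEQ_unique)
    show "(\<lambda>n. LINT x|lborel. sb_kernel \<nu> z x * fourier_integral \<nu> \<sigma> (T n) x) \<longlonglongrightarrow> (LINT x|lborel. sb_kernel \<nu> z x * h x)"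
      by (rule L2_inner_tendsto[OF _ _ _ fourier_trunc_finite[OF \<nu> \<sigma> g, folded T_def] props(2) sqnorm_sb_kernel_finite[OF \<nu>] props(3)])
         (use props(1) in measurable)
    show "(\<lambda>n. LINT x|lborel. sb_kernel \<nu> z x * fourier_integral \<nu> \<sigma> (T n) x) \<longlonglongrightarrow> (LINT u|lborel. sb_kernel \<nu> (of_real \<sigma> * \<i> * z) u * g u)"
      unfolding eq
      by (rule L2_inner_tendsto[OF _ _ _ trunc_sqnorm[OF \<nu> \<sigma> g, folded T_def] g(2) sqnorm_sb_kernel_finite[OF \<nu>]
            trunc_tendsto[OF \<nu> \<sigma> g, folded T_def]]) measurable
  qed
  then show ?thesis
    unfolding segal_bargmann1_eq rw g_def by (simp only: mult.commute)
qed

lemma segal_bargmann1_fourier_inv: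
  assumes "\<nu> > 0" "\<sigma>\<^sup>2 = 1" "F \<in> fock1 \<nu>"
  shows "segal_bargmann1 \<nu> (rescaled_fourier \<nu> \<sigma> (segal_bargmann1_inv \<nu> F)) = rot (of_real \<sigma> * \<i>) F"
  unfolding rot_def
  by (rule ext) (simp only: segal_bargmann1_rescaled_fourier[OF assms(1,2) segal_bargmann1_inv(1)[OF assms(1,3)]]
      segal_bargmann1_inv(2)[OF assms(1,3)])

section \<open>The composed transforms\<close>

lemma T1_eq:
  assumes "\<nu> > 0" "\<sigma>\<^sup>2 = 1" "F \<in> fock1 \<nu>"
  shows "T1 \<nu> \<sigma> F = (\<lambda>p. of_real (sqrt (\<nu> / pi)) * F (of_real \<sigma> * \<i> * psi1 p))"
  unfolding T1_def G_transform_def o_def segal_bargmann1_fourier_inv[OF assms]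
  by (auto simp: rot_def psi1_def fun_eq_iff)

text \<open>The Fourier transform between the two Segal-Bargmann maps acts as a rotation on the
  projection, which \<open>fock_proj_psi2\<close> places in \<open>fock1 \<nu>\<close> and evaluates
  through \<open>psi2\<close>.\<close>

lemma T2_eq:
  assumes \<nu>: "\<nu> > 0" and \<sigma>: "\<sigma>\<^sup>2 = 1" and G: "G \<in> fock2 \<nu>"
  shows "T2 \<nu> \<sigma> G = rot (of_real \<sigma> * \<i>) (fock_proj \<nu> (of_R2 (segal_bargmann2_inv \<nu> G)))"
    and "T2 \<nu> \<sigma> G = (\<lambda>\<xi>. of_real (sqrt (pi / \<nu>)) * G (cscale2 (of_real \<sigma> * \<i>) (psi2 \<xi>)))"
    and "T2 \<nu> \<sigma> G \<in> fock1 \<nu>"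
proof -
  note inv = segal_bargmann2_inv[OF \<nu> G]
  have ent: "entire2 (segal_bargmann2 \<nu> (segal_bargmann2_inv \<nu> G))"
    unfolding inv using G by (simp add: fock2_def)
  note proj = fock_proj_psi2[OF \<nu> inv(1) ent, unfolded inv(2)]
  have P: "fock_proj \<nu> (of_R2 (segal_bargmann2_inv \<nu> G)) \<in> fock1 \<nu>"
    unfolding proj(2) by (rule proj(1))
  show T2: "T2 \<nu> \<sigma> G = rot (of_real \<sigma> * \<i>) (fock_proj \<nu> (of_R2 (segal_bargmann2_inv \<nu> G)))"
    unfolding T2_def R_transform_def o_def segal_bargmann1_fourier_inv[OF \<nu> \<sigma> P] ..
  have "cmod (of_real \<sigma> * \<i>) = 1"
    using \<sigma> by (auto simp: norm_mult power2_eq_1_iff)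
  then show "T2 \<nu> \<sigma> G \<in> fock1 \<nu>"
    unfolding T2 by (rule rot_fock1[OF _ P])
  show "T2 \<nu> \<sigma> G = (\<lambda>\<xi>. of_real (sqrt (pi / \<nu>)) * G (cscale2 (of_real \<sigma> * \<i>) (psi2 \<xi>)))"
    unfolding T2 proj(2) rot_def psi2_def cscale2_def by (simp add: mult_ac)
qed

text \<open>The memberships in \<open>fock2 \<nu>\<close> and \<open>fock1 \<nu>\<close> express
  that the operators act between the stated spaces. The first also secures the compositions, because
  \<open>T2\<close> applies \<open>inv_into\<close> to the values of \<open>T1\<close>.\<close>

theorem theorem4p1:
  fixes \<nu> \<sigma> :: real
  assumes "\<nu> > 0" and "\<sigma> = -1 \<or> \<sigma> = 1"
  shows "(\<forall>F \<in> fock1 \<nu>.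
            T1 \<nu> \<sigma> F \<in> fock2 \<nu> \<and>
            T1 \<nu> \<sigma> F = segal_bargmann2 \<nu> (to_R2 (rot (of_real \<sigma> * \<i>) F)) \<and>
            T1 \<nu> \<sigma> F =
              (\<lambda>p. of_real (sqrt (\<nu> / pi)) * (F \<circ> (\<lambda>q. of_real \<sigma> * \<i> * psi1 q)) p)) \<and>
         (\<forall>G \<in> fock2 \<nu>.
            T2 \<nu> \<sigma> G \<in> fock1 \<nu> \<and>
            T2 \<nu> \<sigma> G =
              rot (of_real \<sigma> * \<i>) (fock_proj \<nu> (of_R2 (segal_bargmann2_inv \<nu> G))) \<and>
            T2 \<nu> \<sigma> G =
              (\<lambda>\<xi>. of_real (sqrt (pi / \<nu>)) * (G \<circ> (\<lambda>\<zeta>. cscale2 (of_real \<sigma> * \<i>) (psi2 \<zeta>))) \<xi>)) \<and>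
         (\<forall>F \<in> fock1 \<nu>.
            T2 \<nu> \<sigma> (T1 \<nu> (- \<sigma>) F) = F \<and>
            T2 \<nu> \<sigma> (T1 \<nu> \<sigma> F) = rot (-1) F)"
proof (intro conjI ballI)
  have \<sigma>: "\<sigma>\<^sup>2 = 1" "(- \<sigma>)\<^sup>2 = 1" using assms(2) by auto
  have unit: "cmod (of_real \<tau> * \<i>) = 1" if "\<tau>\<^sup>2 = 1" for \<tau> :: real
    using that by (auto simp: norm_mult power2_eq_1_iff)
  note \<nu> = assms(1)
  have T1_fock2: "T1 \<nu> \<tau> F \<in> fock2 \<nu>" if "F \<in> fock1 \<nu>" "\<tau>\<^sup>2 = 1" for F \<tau>
    using fock2_psi1[OF \<nu> rot_fock1[OF unit[OF that(2)] that(1)]]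
    unfolding T1_eq[OF \<nu> that(2,1)] rot_def .
  \<comment> \<open>Both composition identities at once: \<open>psi1\<close> is a left inverse of
    \<open>psi2\<close> and commutes with scalars, so the rotations multiply to
    \<open>(\<tau> * \<i>) * (\<sigma> * \<i>) = - (\<sigma> * \<tau>)\<close>, which is 1 for
    \<open>\<tau> = - \<sigma>\<close> and -1 for \<open>\<tau> = \<sigma>\<close>.\<close>
  have comp: "T2 \<nu> \<sigma> (T1 \<nu> \<tau> F) = rot (- of_real (\<sigma> * \<tau>)) F" if F: "F \<in> fock1 \<nu>" and \<tau>: "\<tau>\<^sup>2 = 1" for F \<tau>
  proof
    fix \<xi>
    have arg: "of_real \<tau> * \<i> * psi1 (cscale2 (of_real \<sigma> * \<i>) (psi2 \<xi>)) = - of_real (\<sigma> * \<tau>) * \<xi>"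
    proof -
      have "psi1 (cscale2 (of_real \<sigma> * \<i>) (psi2 \<xi>)) = of_real \<sigma> * \<i> * (2 * \<xi> / (of_real (sqrt 2) * of_real (sqrt 2)))"
        by (simp add: psi1_def psi2_def cscale2_def field_simps)
      then have "of_real \<tau> * \<i> * psi1 (cscale2 (of_real \<sigma> * \<i>) (psi2 \<xi>)) = (\<i> * \<i>) * of_real (\<sigma> * \<tau>) * \<xi>"
        unfolding complex_sqrt2_square by (simp only: of_real_mult mult_ac) simp
      then show ?thesis by simp
    qed
    have "complex_of_real (sqrt (pi / \<nu>)) * of_real (sqrt (\<nu> / pi)) = 1"
      unfolding of_real_mult[symmetric] real_sqrt_mult[symmetric] using \<nu> by simp
    then show "T2 \<nu> \<sigma> (T1 \<nu> \<tau> F) \<xi> = rot (- of_real (\<sigma> * \<tau>)) F \<xi>"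
      unfolding T2_eq(2)[OF \<nu> \<sigma>(1) T1_fock2[OF F \<tau>]] unfolding T1_eq[OF \<nu> \<tau> F] arg rot_def
      by (simp flip: mult.assoc)
  qed
  have \<sigma>\<sigma>: "\<sigma> * \<sigma> = 1" using \<sigma>(1) by (simp add: power2_eq_square)
  fix F assume F: "F \<in> fock1 \<nu>"
  show "T1 \<nu> \<sigma> F \<in> fock2 \<nu>" by (rule T1_fock2[OF F \<sigma>(1)])
  show "T1 \<nu> \<sigma> F = segal_bargmann2 \<nu> (to_R2 (rot (of_real \<sigma> * \<i>) F))"
    unfolding T1_eq[OF \<nu> \<sigma>(1) F]
    by (rule ext) (simp only: segal_bargmann2_fock1[OF \<nu> rot_fock1[OF unit[OF \<sigma>(1)] F]], simp only: rot_def)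
  show "T1 \<nu> \<sigma> F = (\<lambda>p. of_real (sqrt (\<nu> / pi)) * (F \<circ> (\<lambda>q. of_real \<sigma> * \<i> * psi1 q)) p)"
    unfolding T1_eq[OF \<nu> \<sigma>(1) F] o_def ..
  show "T2 \<nu> \<sigma> (T1 \<nu> (- \<sigma>) F) = F"
    unfolding comp[OF F \<sigma>(2)] using \<sigma>\<sigma> by (simp add: rot_def)
  show "T2 \<nu> \<sigma> (T1 \<nu> \<sigma> F) = rot (-1) F"
    unfolding comp[OF F \<sigma>(1)] \<sigma>\<sigma> by simp
next
  have \<sigma>: "\<sigma>\<^sup>2 = 1" using assms(2) by auto
  fix G assume G: "G \<in> fock2 \<nu>"
  note T2 = T2_eq[OF assms(1) \<sigma> G]
  show "T2 \<nu> \<sigma> G \<in> fock1 \<nu>" by (rule T2(3))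
  show "T2 \<nu> \<sigma> G = rot (of_real \<sigma> * \<i>) (fock_proj \<nu> (of_R2 (segal_bargmann2_inv \<nu> G)))" by (rule T2(1))
  show "T2 \<nu> \<sigma> G = (\<lambda>\<xi>. of_real (sqrt (pi / \<nu>)) * (G \<circ> (\<lambda>\<zeta>. cscale2 (of_real \<sigma> * \<i>) (psi2 \<zeta>))) \<xi>)"
    unfolding o_def by (rule T2(2))
qed

end
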